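(* Let $s\in(0,1)$, let $\Omega\subset\mathbb{R}^N$ ($N\geq 2$) be a bounded domain with a $C^1$ boundary, and let $g:\Omega\times\mathbb{R}\to\mathbb{R}$ be a Carathéodory mapping such that, for some constants $C_1>0$ and $r\in(1,2^* )$, for a.e. $x\in\Omega$: (i) $|g(x,t)| \leq C_1(1+|t|^{r-1})$ for all $t\in\mathbb{R}$; (ii) $g(x,\cdot)$ is nonincreasing in $\mathbb{R}$; (iii) $g(x,t)t \leq 0$ for all $t\in\mathbb{R}$. Then there exists $h\in C^\infty_c(\Omega)$ with the following property. For every Carathéodory mapping $f:\Omega\times\mathbb{R}\to\mathbb{R}$ satisfying, for some constants $C_2>0$ and $q\in(1,2^* )$, \[|f(x,t)| \leq C_2(1+|t|^{q-1})\quad\text{for a.e. } x\in\Omega \text{ and all } t\in\mathbb{R},\] there exists $\lambda^*>0$ such that for all $\lambda\in[-\lambda^*,\lambda^*]$ there exists a weak solution $u$ of \[\begin{cases} -\Delta u+(-\Delta)^s u = \lambda f(x,u)+g(x,u)+h(x) & \text{in } \Omega \\ u = 0 & \text{in } \Omega^c \end{cases}\] which in addition satisfies $[u]_s<1$.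
   Context: Notation: $\Omega^c=\mathbb{R}^N\setminus\Omega$; $2^*=\frac{2N}{N-2}$ if $N>2$ and $2^*=\infty$ if $N=2$. Functions on $\Omega$ are identified with their extensions by $0$ to $\mathbb{R}^N$. A Carathéodory mapping $\Omega\times\mathbb{R}\to\mathbb{R}$ is one that is measurable in $x\in\Omega$ for every $t\in\mathbb{R}$ and continuous in $t$ for a.e. $x\in\Omega$. The Gagliardo seminorm is \[[u]_s = \Big[\iint_{\mathbb{R}^N\times\mathbb{R}^N}\frac{|u(x)-u(y)|^2}{|x-y|^{N+2s}}\,dx\,dy\Big]^{\frac12},\] and the constant $C_{N,s}>0$ is \[C_{N,s} = \Big[\int_{\mathbb{R}^N}\frac{1-\cos(z_1)}{|z|^{N+2s}}\,dz\Big]^{-1}.\] A weak solution of the problem is a function $u\in H^1(\mathbb{R}^N)$ such that $u=0$ a.e. in $\Omega^c$ and, for all $v\in C^\infty_c(\Omega)$, \[\int_\Omega\nabla u\cdot\nabla v\,dx+C_{N,s}\iint_{\mathbb{R}^N\times\mathbb{R}^N}\frac{(u(x)-u(y))(v(x)-v(y))}{|x-y|^{N+2s}}\,dx\,dy = \int_\Omega\big[\lambda f(x,u)+g(x,u)+h(x)\big]v\,dx.\] *)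

theory Defs
  imports "HOL-Analysis.Analysis"
begin

text \<open>Functions on \<open>\<Omega>\<close> are represented by total functions on \<open>real ^ 'n\<close>; all integrals and
  ``almost everywhere'' statements refer to Lebesgue measure.\<close>

subsection \<open>Smooth functions\<close>

primrec Ck :: "nat \<Rightarrow> (real ^ 'n::finite \<Rightarrow> real) \<Rightarrow> bool" where
  "Ck 0 f \<longleftrightarrow> continuous_on UNIV f"
| "Ck (Suc k) f \<longleftrightarrow> (\<exists>G. (\<forall>x. GDERIV f x :> G x) \<and> (\<forall>i. Ck k (\<lambda>x. G x $ i)))"

definition grad :: "(real ^ 'n::finite \<Rightarrow> real) \<Rightarrow> real ^ 'n \<Rightarrow> real ^ 'n" where
  "grad f x = (THE D. GDERIV f x :> D)"

definition Cc_infinity :: "(real ^ 'n::finite) set \<Rightarrow> (real ^ 'n \<Rightarrow> real) set" where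
  "Cc_infinity \<Omega> = {v. (\<forall>k. Ck k v) \<and> compact (closure {x. v x \<noteq> 0}) \<and> closure {x. v x \<noteq> 0} \<subseteq> \<Omega>}"

subsection \<open>Domains\<close>

definition domain_set :: "(real ^ 'n::finite) set \<Rightarrow> bool" where
  "domain_set \<Omega> \<longleftrightarrow> open \<Omega> \<and> connected \<Omega> \<and> \<Omega> \<noteq> {}"

text \<open>Near each boundary point, \<open>\<Omega>\<close> is, after reorienting the axes so that the last one points
  along \<open>\<nu>\<close>, the region above the graph of a \<open>C\<^sup>1\<close> function \<open>\<gamma>\<close> of the other \<open>N - 1\<close> coordinates.
  Such a \<open>\<gamma>\<close> is encoded as a function on the whole space that is constant along \<open>\<nu>\<close>.\<close>

definition C1_boundary :: "(real ^ 'n::finite) set \<Rightarrow> bool" where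
  "C1_boundary \<Omega> \<longleftrightarrow>
     (\<forall>p\<in>frontier \<Omega>. \<exists>\<rho>>0. \<exists>\<nu> \<gamma>. norm \<nu> = 1 \<and> Ck 1 \<gamma> \<and> (\<forall>x t. \<gamma> (x + t *\<^sub>R \<nu>) = \<gamma> x) \<and>
        \<Omega> \<inter> ball p \<rho> = {x \<in> ball p \<rho>. \<gamma> x < x \<bullet> \<nu>})"

subsection \<open>Nonlinearities\<close>

definition crit_exponent :: "nat \<Rightarrow> ereal" where
  "crit_exponent N = (if N > 2 then ereal (2 * real N / (real N - 2)) else \<infinity>)"

definition caratheodory :: "(real ^ 'n::finite) set \<Rightarrow> (real ^ 'n \<Rightarrow> real \<Rightarrow> real) \<Rightarrow> bool" where
  "caratheodory \<Omega> f \<longleftrightarrow>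
     (\<forall>t. (\<lambda>x. f x t) \<in> borel_measurable (lebesgue_on \<Omega>)) \<and>
     (AE x\<in>\<Omega> in lebesgue. continuous_on UNIV (f x))"

subsection \<open>The Sobolev space \<open>H\<^sup>1\<close>\<close>

definition square_integrable :: "(real ^ 'n::finite \<Rightarrow> 'b::real_normed_vector) \<Rightarrow> bool" where
  "square_integrable u \<longleftrightarrow> u \<in> borel_measurable lebesgue \<and> integrable lebesgue (\<lambda>x. (norm (u x))\<^sup>2)"

definition weak_gradient :: "(real ^ 'n::finite \<Rightarrow> real) \<Rightarrow> (real ^ 'n \<Rightarrow> real ^ 'n) \<Rightarrow> bool" where
  "weak_gradient u G \<longleftrightarrow>
     (\<forall>\<phi>\<in>Cc_infinity UNIV. \<forall>i.
        (LINT x|lebesgue. u x * grad \<phi> x $ i) = - (LINT x|lebesgue. G x $ i * \<phi> x))"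

definition H1 :: "(real ^ 'n::finite \<Rightarrow> real) set" where
  "H1 = {u. square_integrable u \<and> (\<exists>G. square_integrable G \<and> weak_gradient u G)}"

subsection \<open>Fractional quantities\<close>

text \<open>The seminorm takes values in \<open>ennreal\<close>, so that it is \<open>\<infinity>\<close> when the double integral
  diverges.\<close>

definition gagliardo_seminorm :: "real \<Rightarrow> (real ^ 'n::finite \<Rightarrow> real) \<Rightarrow> ennreal" where
  "gagliardo_seminorm s u =
     (let I = (\<integral>\<^sup>+(x, y). ennreal ((u x - u y)\<^sup>2 / norm (x - y) powr (real CARD('n) + 2 * s))
                 \<partial>(lebesgue :: ((real ^ 'n) \<times> (real ^ 'n)) measure))
      in if I = \<infinity> then \<infinity> else ennreal (sqrt (enn2real I)))"

text \<open>The integral does not depend on which coordinate is called \<open>z\<^sub>1\<close>, since the coordinates can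
  be permuted; the index type carries no order, so an arbitrary one is chosen.\<close>

definition frac_const :: "real \<Rightarrow> 'n::finite itself \<Rightarrow> real" where
  "frac_const s _ =
     inverse (LINT z|(lebesgue :: (real ^ 'n) measure).
        (1 - cos (z $ (SOME i. True))) / norm z powr (real CARD('n) + 2 * s))"

subsection \<open>Weak solutions\<close>

text \<open>Weak solutions of \<open>- \<Delta> u + (- \<Delta>)\<^sup>s u = F(x, u)\<close> in \<open>\<Omega>\<close>, \<open>u = 0\<close> outside \<open>\<Omega>\<close>.
  The gradient \<open>G\<close> of \<open>u\<close> is unique up to a null set.  Integrability is stated
  explicitly because the integral of a non-integrable function is \<open>0\<close> by convention; for the first
  integral it follows from square integrability.\<close>

definition weak_solution ::
    "real \<Rightarrow> (real ^ 'n::finite) set \<Rightarrow> (real ^ 'n \<Rightarrow> real \<Rightarrow> real) \<Rightarrow> (real ^ 'n \<Rightarrow> real) \<Rightarrow> bool" where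
  "weak_solution s \<Omega> F u \<longleftrightarrow>
     u \<in> H1 \<and> (AE x in lebesgue. x \<notin> \<Omega> \<longrightarrow> u x = 0) \<and>
     (\<exists>G. square_integrable G \<and> weak_gradient u G \<and>
       (\<forall>v\<in>Cc_infinity \<Omega>.
          integrable lebesgue (\<lambda>(x, y). (u x - u y) * (v x - v y) /
              norm (x - y) powr (real CARD('n) + 2 * s)) \<and>
          set_integrable lebesgue \<Omega> (\<lambda>x. F x (u x) * v x) \<and>
          (LINT x:\<Omega>|lebesgue. G x \<bullet> grad v x) +
            frac_const s TYPE('n) *
              (LINT (x, y)|lebesgue. (u x - u y) * (v x - v y) /
                 norm (x - y) powr (real CARD('n) + 2 * s)) =
          (LINT x:\<Omega>|lebesgue. F x (u x) * v x)))"

end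

theory Submission
  imports Defs "HOL-Complex_Analysis.Great_Picard"
begin

text \<open>One can take \<open>h = 0\<close>, since then \<open>u = 0\<close> solves the problem for \<open>\<lambda> = 0\<close>: the sign
  condition forces \<open>g(x, 0) = 0\<close>.  Truncating \<open>f\<close> and \<open>g\<close> in \<open>t\<close> at \<open>\<plusminus>1\<close> gives a bounded
  nonlinearity whose positive part for \<open>t \<ge> 0\<close> and negative part for \<open>t \<le> 0\<close> are at most
  \<open>\<epsilon>\<close>, as soon as \<open>2|\<lambda>|C\<^sub>2 \<le> \<epsilon>\<close>.  Minimise the associated energy over compactly supported \<open>C\<^sup>1\<close> functions.  The
  primitive of the nonlinearity is Lipschitz in \<open>u\<close>, so a minimising sequence that is Cauchy in
  \<open>L\<^sup>1\<close> is Cauchy in energy by the parallelogram identity, and its limit satisfies the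
  Euler--Lagrange equation.  Testing the minimality with \<open>\<beta>(u - kw)\<close>, where \<open>w\<close> is a
  superharmonic barrier and \<open>\<beta>\<close> is a \<open>C\<^sup>1\<close> substitute for the positive part, gives
  \<open>|u| \<le> k = O(\<epsilon>)\<close>; for small \<open>\<epsilon>\<close> the truncation is therefore not active.  The energy of \<open>u\<close> is
  \<open>O(\<epsilon>\<^sup>2)\<close> and dominates \<open>[u]\<^sub>s\<^sup>2\<close>.\<close>

subsection \<open>Square-integrable functions\<close>

text \<open>The sign condition does not make g small, so estimates in terms of a bound
  \<open>M\<close> on the whole nonlinearity would not help. The energy and supremum bounds
  therefore see only the one-sided constant \<epsilon>; \<open>M\<close> enters only where some
  finite Lipschitz constant is enough, as in the convergence of the minimising sequence and in
  dominated convergence. Since \<epsilon> is fixed by a ball containing \<Omega>, the Poincare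
  constant and the bound on the nonlocal form, the range of \<lambda> can be read off from
  \<open>C2\<close> afterwards.

  The limit u is a mere L^2 limit, to which no classical chain rule applies. Nonlinear test
  functions are therefore built on the C^1 approximations: for a fixed step length the minimality
  defect is sent to 0, and only then the step length. Minimality itself forces strong convergence,
  so weak limits never appear. The L^1 Cauchy subsequence comes from averages over small balls,
  compared with the function by a translation estimate; that same estimate also yields the Poincare
  inequality and the finiteness of the nonlocal energy.\<close>

definition L2 :: "'a measure \<Rightarrow> ('a \<Rightarrow> 'b::euclidean_space) set" where
  "L2 M = {f \<in> borel_measurable M. integrable M (\<lambda>x. (norm (f x))\<^sup>2)}"

lemma L2_measurable [measurable_dest]: "f \<in> L2 M \<Longrightarrow> f \<in> borel_measurable M"
  by (simp add: L2_def)

lemma L2_integrable_norm_sq: "f \<in> L2 M \<Longrightarrow> integrable M (\<lambda>x. (norm (f x))\<^sup>2)"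
  by (simp add: L2_def)

lemma L2_integrable_inner:
  assumes "f \<in> L2 M" "g \<in> L2 M"
  shows "integrable M (\<lambda>x. f x \<bullet> g x)"
proof (rule Bochner_Integration.integrable_bound)
  show "integrable M (\<lambda>x. (norm (f x))\<^sup>2 + (norm (g x))\<^sup>2)"
    using assms by (simp add: L2_def)
  show "(\<lambda>x. f x \<bullet> g x) \<in> borel_measurable M"
    using assms by (auto simp: L2_def)
  show "AE x in M. norm (f x \<bullet> g x) \<le> norm ((norm (f x))\<^sup>2 + (norm (g x))\<^sup>2)"
  proof (rule AE_I2)
    fix x
    have "\<bar>f x \<bullet> g x\<bar> \<le> norm (f x) * norm (g x)"
      by (rule Cauchy_Schwarz_ineq2)
    also have "\<dots> \<le> (norm (f x))\<^sup>2 + (norm (g x))\<^sup>2"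
      using sum_squares_bound[of "norm (f x)" "norm (g x)"]
        mult_nonneg_nonneg[OF norm_ge_zero[of "f x"] norm_ge_zero[of "g x"]] by linarith
    finally show "norm (f x \<bullet> g x) \<le> norm ((norm (f x))\<^sup>2 + (norm (g x))\<^sup>2)"
      by simp
  qed
qed

lemma L2_integrable_mult:
  fixes f g :: "'a \<Rightarrow> real"
  assumes "f \<in> L2 M" "g \<in> L2 M"
  shows "integrable M (\<lambda>x. f x * g x)"
  using L2_integrable_inner[OF assms] by simp

lemma L2_scaleR: "f \<in> L2 M \<Longrightarrow> (\<lambda>x. c *\<^sub>R f x) \<in> L2 M"
  by (auto simp: L2_def power_mult_distrib)

lemma L2_add:
  assumes "f \<in> L2 M" "g \<in> L2 M"
  shows "(\<lambda>x. f x + g x) \<in> L2 M"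
proof -
  have "(\<lambda>x. (norm (f x + g x))\<^sup>2) = (\<lambda>x. (norm (f x))\<^sup>2 + 2 * (f x \<bullet> g x) + (norm (g x))\<^sup>2)"
    by (auto simp: power2_norm_eq_inner inner_add inner_commute)
  moreover have "integrable M \<dots>"
    using assms L2_integrable_inner[OF assms] by (intro Bochner_Integration.integrable_add) (auto simp: L2_def)
  ultimately show ?thesis
    using assms by (auto simp: L2_def)
qed

lemma L2_diff: "f \<in> L2 M \<Longrightarrow> g \<in> L2 M \<Longrightarrow> (\<lambda>x. f x - g x) \<in> L2 M"
  using L2_add[OF _ L2_scaleR[of g M "-1"]] by simp

lemma L2_iff_nn_integral:
  assumes "f \<in> borel_measurable M"
  shows "f \<in> L2 M \<longleftrightarrow> (\<integral>\<^sup>+x. ennreal ((norm (f x))\<^sup>2) \<partial>M) < \<infinity>"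
  using assms by (auto simp: L2_def integrable_iff_bounded)

text \<open>The integral of the squared norm of \<open>t *\<^sub>R f x - g x\<close> is a
  nonnegative quadratic in t, so its discriminant is not positive. A vanishing leading coefficient
  needs a separate argument.\<close>

lemma L2_Cauchy_Schwarz:
  assumes f: "f \<in> L2 M" and g: "g \<in> L2 M"
  shows "(LINT x|M. f x \<bullet> g x)\<^sup>2 \<le> (LINT x|M. (norm (f x))\<^sup>2) * (LINT x|M. (norm (g x))\<^sup>2)"
proof -
  define A B c where "A = (LINT x|M. (norm (f x))\<^sup>2)" and "B = (LINT x|M. (norm (g x))\<^sup>2)"
    and "c = (LINT x|M. f x \<bullet> g x)"
  have quad: "0 \<le> A * t\<^sup>2 - 2 * c * t + B" for t
  proof -
    have "0 \<le> (LINT x|M. (norm (t *\<^sub>R f x - g x))\<^sup>2)"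
      by simp
    also have "(\<lambda>x. (norm (t *\<^sub>R f x - g x))\<^sup>2) =
        (\<lambda>x. t\<^sup>2 * (norm (f x))\<^sup>2 - 2 * t * (f x \<bullet> g x) + (norm (g x))\<^sup>2)"
      unfolding power2_norm_eq_inner
      by (auto simp: inner_diff_left inner_diff_right inner_commute power2_eq_square algebra_simps)
    also have "(LINT x|M. \<dots> x) = t\<^sup>2 * A - 2 * t * c + B"
      using L2_integrable_inner[OF f g] f g
      by (simp add: A_def B_def c_def L2_def)
    finally show ?thesis
      by (simp add: algebra_simps)
  qed
  have "A \<ge> 0" by (simp add: A_def)
  show ?thesis
  proof (cases "A = 0")
    case True
    have "c = 0"
    proof (rule ccontr)
      assume "c \<noteq> 0"
      \<comment> \<open>With \<open>A = 0\<close> the quadratic is affine, and this argument gives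
        it the value -1.\<close>
      then show False
        using quad[of "(B + 1) / (2 * c)"] True by (simp add: field_simps)
    qed
    then show ?thesis
      using True by (simp flip: A_def B_def c_def)
  next
    case False
    then have "A > 0" using \<open>A \<ge> 0\<close> by simp
    have "0 \<le> A * (A * (c / A)\<^sup>2 - 2 * c * (c / A) + B)"
      by (rule mult_nonneg_nonneg[OF \<open>A \<ge> 0\<close> quad])
    also have "\<dots> = A * B - c\<^sup>2"
      using \<open>A > 0\<close> by (simp add: field_simps power2_eq_square)
    finally show ?thesis
      by (simp flip: A_def B_def c_def)
  qed
qed

text \<open>Cauchy-Schwarz applied to the difference. The limits of the bilinear forms and of
  integration by parts rest on it.\<close>

lemma L2_tendsto_inner:
  assumes f: "\<And>n. f n \<in> L2 M" "f' \<in> L2 M" and g: "g \<in> L2 M"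
    and lim: "(\<lambda>n. LINT x|M. (norm (f n x - f' x))\<^sup>2) \<longlonglongrightarrow> 0"
  shows "(\<lambda>n. LINT x|M. f n x \<bullet> g x) \<longlonglongrightarrow> (LINT x|M. f' x \<bullet> g x)"
proof -
  let ?B = "LINT x|M. (norm (g x))\<^sup>2"
  have "(\<lambda>n. (LINT x|M. f n x \<bullet> g x) - (LINT x|M. f' x \<bullet> g x)) \<longlonglongrightarrow> 0"
  proof (rule Lim_null_comparison)
    show "\<forall>\<^sub>F n in sequentially. norm ((LINT x|M. f n x \<bullet> g x) - (LINT x|M. f' x \<bullet> g x))
        \<le> sqrt ((LINT x|M. (norm (f n x - f' x))\<^sup>2) * ?B)"
    proof (rule always_eventually, rule allI)
      fix n
      have "(LINT x|M. f n x \<bullet> g x) - (LINT x|M. f' x \<bullet> g x) = (LINT x|M. (f n x - f' x) \<bullet> g x)"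
        using L2_integrable_inner[OF f(1) g] L2_integrable_inner[OF f(2) g]
        by (simp add: inner_diff_left)
      moreover have "(LINT x|M. (f n x - f' x) \<bullet> g x)\<^sup>2 \<le> (LINT x|M. (norm (f n x - f' x))\<^sup>2) * ?B"
        by (intro L2_Cauchy_Schwarz L2_diff f g)
      ultimately show "norm ((LINT x|M. f n x \<bullet> g x) - (LINT x|M. f' x \<bullet> g x))
        \<le> sqrt ((LINT x|M. (norm (f n x - f' x))\<^sup>2) * ?B)"
        by (simp add: real_le_rsqrt)
    qed
    have "(\<lambda>n. sqrt ((LINT x|M. (norm (f n x - f' x))\<^sup>2) * ?B)) \<longlonglongrightarrow> sqrt (0 * ?B)"
      by (intro tendsto_intros lim)
    then show "(\<lambda>n. sqrt ((LINT x|M. (norm (f n x - f' x))\<^sup>2) * ?B)) \<longlonglongrightarrow> 0"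
      by simp
  qed
  then show ?thesis
    by (rule LIM_zero_cancel)
qed

text \<open>Fatou's lemma along the subsequence. It is kept apart from completeness because for
  difference quotients the limit is already known pointwise and only has to be recognised as the L^2
  limit.\<close>

lemma L2_limit:
  fixes u :: "nat \<Rightarrow> 'a \<Rightarrow> 'b::euclidean_space"
  assumes [measurable]: "\<And>n. u n \<in> borel_measurable M" "f \<in> borel_measurable M"
    and cauchy: "\<And>e::real. e > 0 \<Longrightarrow> \<exists>N. \<forall>m\<ge>N. \<forall>n\<ge>N. (\<integral>\<^sup>+x. ennreal ((norm (u m x - u n x))\<^sup>2) \<partial>M) \<le> ennreal e"
    and r: "strict_mono r" and AE: "AE x in M. (\<lambda>k. u (r k) x) \<longlonglongrightarrow> f x"
    and "e > 0"
  shows "\<forall>\<^sub>F n in sequentially. (\<integral>\<^sup>+x. ennreal ((norm (u n x - f x))\<^sup>2) \<partial>M) \<le> ennreal e"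
proof -
  define d where "d m n = (\<integral>\<^sup>+x. ennreal ((norm (u m x - u n x))\<^sup>2) \<partial>M)" for m n
  obtain N where N: "\<And>m n. m \<ge> N \<Longrightarrow> n \<ge> N \<Longrightarrow> d m n \<le> ennreal e"
    using cauchy[OF \<open>e > 0\<close>] by (auto simp: d_def)
  have "(\<integral>\<^sup>+x. ennreal ((norm (u n x - f x))\<^sup>2) \<partial>M) \<le> ennreal e" if "n \<ge> N" for n
  proof -
    have "(\<integral>\<^sup>+x. ennreal ((norm (u n x - f x))\<^sup>2) \<partial>M) =
        (\<integral>\<^sup>+x. liminf (\<lambda>k. ennreal ((norm (u n x - u (r k) x))\<^sup>2)) \<partial>M)"
    proof (rule nn_integral_cong_AE, use AE in eventually_elim)
      case (elim x)
      have "(\<lambda>k. ennreal ((norm (u n x - u (r k) x))\<^sup>2)) \<longlonglongrightarrow> ennreal ((norm (u n x - f x))\<^sup>2)"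
        by (intro tendsto_intros elim)
      then show ?case
        by (intro lim_imp_Liminf[symmetric]) auto
    qed
    also have "\<dots> \<le> liminf (\<lambda>k. d n (r k))"
      unfolding d_def by (rule nn_integral_liminf) measurable
    also have "\<dots> \<le> ennreal e"
    proof (rule Liminf_le)
      show "\<forall>\<^sub>F k in sequentially. d n (r k) \<le> ennreal e"
        using eventually_ge_at_top[of N]
        by eventually_elim (use \<open>n \<ge> N\<close> seq_suble[OF r] in \<open>auto intro!: N intro: order_trans\<close>)
    qed simp
    finally show ?thesis .
  qed
  then show ?thesis
    by (auto simp: eventually_sequentially)
qed

text \<open>The Riesz-Fischer argument: a subsequence with fast decaying increments converges almost
  everywhere. The subsequence is returned as well, since the nonlocal part needs the pointwise
  convergence.\<close>

lemma L2_complete: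
  fixes u :: "nat \<Rightarrow> 'a \<Rightarrow> 'b::euclidean_space"
  assumes meas [measurable]: "\<And>n. u n \<in> borel_measurable M"
    and cauchy: "\<And>e::real. e > 0 \<Longrightarrow> \<exists>N. \<forall>m\<ge>N. \<forall>n\<ge>N. (\<integral>\<^sup>+x. ennreal ((norm (u m x - u n x))\<^sup>2) \<partial>M) \<le> ennreal e"
  obtains r f where "strict_mono r" "f \<in> borel_measurable M" "AE x in M. (\<lambda>k. u (r k) x) \<longlonglongrightarrow> f x"
    "\<And>e::real. e > 0 \<Longrightarrow> \<forall>\<^sub>F n in sequentially. (\<integral>\<^sup>+x. ennreal ((norm (u n x - f x))\<^sup>2) \<partial>M) \<le> ennreal e"
proof -
  define d where "d m n = (\<integral>\<^sup>+x. ennreal ((norm (u m x - u n x))\<^sup>2) \<partial>M)" for m n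
  have "\<exists>N. \<forall>k. \<forall>m\<ge>N k. \<forall>n\<ge>N k. d m n \<le> ennreal ((1/8)^k)"
    unfolding d_def by (intro choice allI cauchy) simp
  then obtain N where N: "\<And>k m n. m \<ge> N k \<Longrightarrow> n \<ge> N k \<Longrightarrow> d m n \<le> ennreal ((1/8)^k)"
    by blast
  \<comment> \<open>The maximum with \<open>Suc a\<close> makes the subsequence strictly increasing
    while it stays beyond the thresholds \<open>N\<close>.\<close>
  define r where "r = rec_nat (N 0) (\<lambda>k a. max (Suc a) (N (Suc k)))"
  have r_Suc: "r (Suc k) = max (Suc (r k)) (N (Suc k))" for k
    by (simp add: r_def)
  have r: "strict_mono r"
    by (intro strict_monoI_Suc) (simp add: r_Suc)
  have rN: "r k \<ge> N k" for k
    by (cases k) (simp add: r_def, simp add: r_Suc)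
  \<comment> \<open>The weight \<open>2^k\<close> is affordable, as the integrals decay like
    \<open>(1/8)^k\<close>. Finiteness of the weighted sum at a point then bounds the increments
    there by a geometric sequence of ratio \<open>sqrt (1/2)\<close>.\<close>
  define \<delta> where "\<delta> k x = 2^k * (norm (u (r k) x - u (r (Suc k)) x))\<^sup>2" for k x
  have [measurable]: "\<delta> k \<in> borel_measurable M" for k
    unfolding \<delta>_def by measurable
  have \<delta>_nonneg: "\<delta> k x \<ge> 0" for k x
    by (simp add: \<delta>_def)
  let ?d = "\<lambda>k x. ennreal (\<delta> k x)"
  have "(\<integral>\<^sup>+x. (\<Sum>k. ?d k x) \<partial>M) = (\<Sum>k. \<integral>\<^sup>+x. ?d k x \<partial>M)"
    by (rule nn_integral_suminf) measurable
  also have "\<dots> \<le> (\<Sum>k. ennreal ((1/4)^k))"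
  proof (rule suminf_le)
    fix k
    have "(\<integral>\<^sup>+x. ?d k x \<partial>M) = ennreal (2^k) * d (r k) (r (Suc k))"
      by (simp add: d_def \<delta>_def ennreal_mult nn_integral_cmult)
    also have "\<dots> \<le> ennreal (2^k) * ennreal ((1/8)^k)"
      using rN[of k] rN[of "Suc k"] r
      by (intro mult_left_mono N) (auto simp: strict_mono_Suc_iff intro: order_trans less_imp_le)
    also have "\<dots> = ennreal ((1/4)^k)"
    proof -
      have "(2::real)^k * (1/8)^k = (2 * (1/8))^k"
        by (rule power_mult_distrib [symmetric])
      then show ?thesis
        by (simp add: ennreal_mult' [symmetric])
    qed
    finally show "(\<integral>\<^sup>+x. ?d k x \<partial>M) \<le> ennreal ((1/4)^k)" .
  qed auto
  also have "\<dots> = ennreal (\<Sum>k. (1/4)^k)"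
    by (rule suminf_ennreal2) (auto simp: summable_geometric)
  also have "\<dots> < \<infinity>"
    by simp
  finally have "(\<integral>\<^sup>+x. (\<Sum>k. ?d k x) \<partial>M) \<noteq> \<infinity>"
    by simp
  then have "AE x in M. (\<Sum>k. ?d k x) \<noteq> \<infinity>"
    by (intro nn_integral_PInf_AE) auto
  moreover have conv: "convergent (\<lambda>k. u (r k) x)" if fin: "(\<Sum>k. ?d k x) \<noteq> \<infinity>" for x
  proof -
    define S where "S = enn2real (\<Sum>k. ?d k x)"
    have S: "(\<Sum>k. ?d k x) = ennreal S"
      using fin by (simp add: S_def less_top)
    have "S \<ge> 0"
      by (simp add: S_def)
    have bound: "norm (u (r (Suc k)) x - u (r k) x) \<le> sqrt S * (sqrt (1/2))^k" for k
    proof -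
      have "?d k x \<le> (\<Sum>k. ?d k x)"
        using sum_le_suminf[of "\<lambda>k. ?d k x" "{k}"] by simp
      then have "ennreal (\<delta> k x) \<le> ennreal S"
        by (simp only: S)
      then have "2^k * (norm (u (r k) x - u (r (Suc k)) x))\<^sup>2 \<le> S"
        using \<open>S \<ge> 0\<close> by (simp add: \<delta>_def)
      then have "(norm (u (r (Suc k)) x - u (r k) x))\<^sup>2 \<le> S * (1/2)^k"
        by (simp add: norm_minus_commute field_simps power_divide)
      then have "norm (u (r (Suc k)) x - u (r k) x) \<le> sqrt (S * (1/2)^k)"
        by (rule real_le_rsqrt)
      then show ?thesis
        by (simp add: real_sqrt_mult real_sqrt_power)
    qed
    have "summable (\<lambda>k. sqrt S * (sqrt (1/2))^k)"
      by (intro summable_mult summable_geometric) (simp add: real_sqrt_divide)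
    then have "summable (\<lambda>k. u (r (Suc k)) x - u (r k) x)"
      by (rule summable_comparison_test'[where N = 0]) (rule bound)
    then have "convergent (\<lambda>n. \<Sum>k<n. u (r (Suc k)) x - u (r k) x)"
      by (rule summable_iff_convergent[THEN iffD1])
    then have "convergent (\<lambda>n. u (r n) x - u (r 0) x)"
      by (simp only: sum_lessThan_telescope[of "\<lambda>k. u (r k) x"])
    then show ?thesis
      by (rule convergent_diff_const_right_iff[THEN iffD1])
  qed
  define f where "f x = lim (\<lambda>k. u (r k) x)" for x
  have f_meas [measurable]: "f \<in> borel_measurable M"
    unfolding f_def by measurable
  have AE: "AE x in M. (\<lambda>k. u (r k) x) \<longlonglongrightarrow> f x"
    using \<open>AE x in M. (\<Sum>k. ?d k x) \<noteq> \<infinity>\<close>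
    by eventually_elim (simp add: f_def convergent_LIMSEQ_iff[symmetric] conv)
  then show ?thesis
    using that[OF r f_meas AE] L2_limit[OF meas f_meas cauchy r AE] by blast
qed

lemma L2_tendsto_0:
  assumes [measurable]: "\<And>n. g n \<in> borel_measurable M"
    and lim: "\<And>e::real. e > 0 \<Longrightarrow> \<forall>\<^sub>F n in sequentially. (\<integral>\<^sup>+x. ennreal ((norm (g n x))\<^sup>2) \<partial>M) \<le> ennreal e"
  shows "(\<lambda>n. LINT x|M. (norm (g n x))\<^sup>2) \<longlonglongrightarrow> 0"
proof (rule tendstoI)
  fix e :: real
  assume "e > 0"
  then have "\<forall>\<^sub>F n in sequentially. (\<integral>\<^sup>+x. ennreal ((norm (g n x))\<^sup>2) \<partial>M) \<le> ennreal (e / 2)"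
    by (intro lim) simp
  then show "\<forall>\<^sub>F n in sequentially. dist (LINT x|M. (norm (g n x))\<^sup>2) 0 < e"
  proof eventually_elim
    case (elim n)
    have "(LINT x|M. (norm (g n x))\<^sup>2) = enn2real (\<integral>\<^sup>+x. ennreal ((norm (g n x))\<^sup>2) \<partial>M)"
      by (rule integral_eq_nn_integral) auto
    also have "\<dots> \<le> e / 2"
      using elim \<open>e > 0\<close> by (intro enn2real_leI) auto
    finally show ?case
      using \<open>e > 0\<close> by simp
  qed
qed

subsection \<open>Compactly supported functions of class \<open>C\<^sup>1\<close>\<close>

lemma C1_iff: "Ck 1 f \<longleftrightarrow> (\<exists>G. (\<forall>x. GDERIV f x :> G x) \<and> continuous_on UNIV G)"
proof -
  have "(\<forall>i. continuous_on UNIV (\<lambda>x. G x $ i)) \<longleftrightarrow> continuous_on UNIV G" for G :: "real ^ 'a \<Rightarrow> real ^ 'a"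
  proof
    assume "\<forall>i. continuous_on UNIV (\<lambda>x. G x $ i)"
    then have "continuous_on UNIV (\<lambda>x. \<chi> i. G x $ i)"
      by (intro continuous_on_vec_lambda) auto
    then show "continuous_on UNIV G"
      by simp
  qed (auto intro: continuous_intros)
  then show ?thesis
    by simp
qed

lemma grad_eq: "GDERIV f x :> D \<Longrightarrow> grad f x = D"
proof -
  have "D' = D" if "GDERIV f x :> D'" "GDERIV f x :> D" for D'
    using has_derivative_unique[OF that[unfolded gderiv_def]] by (metis vector_eq_ldot)
  then show "GDERIV f x :> D \<Longrightarrow> grad f x = D"
    unfolding grad_def by blast
qed

lemma GDERIV_0_outside_closure:
  assumes "x \<notin> closure {x. f x \<noteq> 0}"
  shows "GDERIV f x :> 0"
  unfolding gderiv_def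
proof (rule has_derivative_transform_within_open)
  show "((\<lambda>_. 0) has_derivative (\<lambda>h. h \<bullet> 0)) (at x)"
    by simp
  show "open (- closure {x. f x \<noteq> 0})"
    by auto
  show "0 = f y" if "y \<in> - closure {x. f x \<noteq> 0}" for y
    using that closure_subset[of "{x. f x \<noteq> 0}"] by auto
qed (use assms in auto)

text \<open>The energy is minimised over this class and not over smooth functions because the supremum
  bound tests with compositions \<open>\<beta> \<circ> p\<close> in which \<open>\<beta>\<close> is only of class \<open>C\<^sup>1\<close>.\<close>

definition C1c :: "(real ^ 'n::finite) set \<Rightarrow> (real ^ 'n \<Rightarrow> real) set" where
  "C1c \<Omega> = {v. Ck 1 v \<and> compact (closure {x. v x \<noteq> 0}) \<and> closure {x. v x \<noteq> 0} \<subseteq> \<Omega>}"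

lemma C1c_GDERIV: "v \<in> C1c \<Omega> \<Longrightarrow> GDERIV v x :> grad v x"
  unfolding C1c_def C1_iff using grad_eq[of v x] by force

lemma C1c_continuous: "v \<in> C1c \<Omega> \<Longrightarrow> continuous_on UNIV v"
  by (rule has_derivative_continuous_on[where f' = "\<lambda>x h. h \<bullet> grad v x"])
    (use C1c_GDERIV in \<open>auto simp: gderiv_def\<close>)

lemma C1c_continuous_grad:
  assumes "v \<in> C1c \<Omega>"
  shows "continuous_on UNIV (grad v)"
proof -
  obtain G where G: "\<And>x. GDERIV v x :> G x" "continuous_on UNIV G"
    using assms unfolding C1c_def C1_iff by auto
  moreover have "grad v = G"
    using grad_eq[OF G(1)] by auto
  ultimately show ?thesis by simp
qed

lemma C1c_eq_0: "v \<in> C1c \<Omega> \<Longrightarrow> x \<notin> \<Omega> \<Longrightarrow> v x = 0"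
  using closure_subset[of "{x. v x \<noteq> 0}"] by (auto simp: C1c_def)

lemma C1c_grad_eq_0: "v \<in> C1c \<Omega> \<Longrightarrow> x \<notin> closure {x. v x \<noteq> 0} \<Longrightarrow> grad v x = 0"
  by (rule grad_eq[OF GDERIV_0_outside_closure])

lemma C1c_grad_eq_0': "v \<in> C1c \<Omega> \<Longrightarrow> x \<notin> \<Omega> \<Longrightarrow> grad v x = 0"
  by (rule C1c_grad_eq_0) (auto simp: C1c_def)

text \<open>The compact set \<open>K\<close> spares computing the closed support of sums, products
  and compositions.\<close>

lemma C1cI:
  assumes deriv: "\<And>x. GDERIV v x :> G x" and cont: "continuous_on UNIV G"
    and supp: "{x. v x \<noteq> 0} \<subseteq> K" "compact K" "K \<subseteq> \<Omega>"
  shows "v \<in> C1c \<Omega>" "grad v = G"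
proof -
  have "closure {x. v x \<noteq> 0} \<subseteq> K"
    using supp by (intro closure_minimal) (auto intro: compact_imp_closed)
  moreover from this have "compact (closure {x. v x \<noteq> 0})"
    using compact_Int_closed[OF supp(2), of "closure {x. v x \<noteq> 0}"] by (simp add: Int_absorb1)
  ultimately show "v \<in> C1c \<Omega>"
    using assms unfolding C1c_def C1_iff by blast
  show "grad v = G"
    using grad_eq[OF deriv] by auto
qed

lemma C1c_mono: "\<Omega> \<subseteq> \<Omega>' \<Longrightarrow> C1c \<Omega> \<subseteq> C1c \<Omega>'"
  by (auto simp: C1c_def)

lemma C1c_UNIV: "v \<in> C1c \<Omega> \<Longrightarrow> v \<in> C1c UNIV"
  using C1c_mono[of \<Omega> UNIV] by auto

lemma Cc_infinity_subset_C1c: "Cc_infinity \<Omega> \<subseteq> C1c \<Omega>"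
  by (auto simp: Cc_infinity_def C1c_def simp del: Ck.simps)

lemma C1c_support:
  assumes "v \<in> C1c \<Omega>"
  obtains K where "compact K" "K \<subseteq> \<Omega>" "\<And>x. x \<notin> K \<Longrightarrow> v x = 0" "\<And>x. x \<notin> K \<Longrightarrow> grad v x = 0"
proof
  show "compact (closure {x. v x \<noteq> 0})" "closure {x. v x \<noteq> 0} \<subseteq> \<Omega>"
    using assms by (auto simp: C1c_def)
  show "v x = 0" if "x \<notin> closure {x. v x \<noteq> 0}" for x
    using that closure_subset[of "{x. v x \<noteq> 0}"] by auto
  show "grad v x = 0" if "x \<notin> closure {x. v x \<noteq> 0}" for x
    using that C1c_grad_eq_0[OF assms] by auto
qed

lemma C1c_zero: "(\<lambda>_. 0) \<in> C1c \<Omega>"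
  by (rule C1cI[where G = "\<lambda>_. 0" and K = "{}"]) (auto intro: GDERIV_const)

lemma C1c_lincomb:
  assumes u: "u \<in> C1c \<Omega>" and v: "v \<in> C1c \<Omega>"
  shows "(\<lambda>x. a * u x + b * v x) \<in> C1c \<Omega>"
    and "grad (\<lambda>x. a * u x + b * v x) = (\<lambda>x. a *\<^sub>R grad u x + b *\<^sub>R grad v x)"
proof -
  obtain K where K: "compact K" "K \<subseteq> \<Omega>" "\<And>x. x \<notin> K \<Longrightarrow> u x = 0"
    using C1c_support[OF u] by metis
  obtain L where L: "compact L" "L \<subseteq> \<Omega>" "\<And>x. x \<notin> L \<Longrightarrow> v x = 0"
    using C1c_support[OF v] by metis
  have D: "GDERIV (\<lambda>x. a * u x + b * v x) x :> a *\<^sub>R grad u x + b *\<^sub>R grad v x" for x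
    using C1c_GDERIV[OF u, of x] C1c_GDERIV[OF v, of x]
    unfolding gderiv_def by (auto intro!: derivative_eq_intros simp: inner_add_right)
  have C: "continuous_on UNIV (\<lambda>x. a *\<^sub>R grad u x + b *\<^sub>R grad v x)"
    by (intro continuous_intros C1c_continuous_grad[OF u] C1c_continuous_grad[OF v])
  have S: "{x. a * u x + b * v x \<noteq> 0} \<subseteq> K \<union> L" "compact (K \<union> L)" "K \<union> L \<subseteq> \<Omega>"
    using K L by (auto, blast+)
  show "(\<lambda>x. a * u x + b * v x) \<in> C1c \<Omega>"
    "grad (\<lambda>x. a * u x + b * v x) = (\<lambda>x. a *\<^sub>R grad u x + b *\<^sub>R grad v x)"
    by (rule C1cI[OF D C S])+
qed

lemmas C1c_diff = C1c_lincomb[where a = 1 and b = "-1", simplified]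
lemmas C1c_minus = C1c_lincomb[where a = "-1" and b = 0, OF _ C1c_zero, simplified]

text \<open>Only one factor has compact support, so that \<open>p\<close> may be a component of the
  barrier gradient.\<close>

lemma C1c_mult:
  assumes u: "u \<in> C1c \<Omega>" and p: "\<And>x. GDERIV p x :> P x" "continuous_on UNIV P"
  shows "(\<lambda>x. u x * p x) \<in> C1c \<Omega>"
    and "grad (\<lambda>x. u x * p x) = (\<lambda>x. u x *\<^sub>R P x + p x *\<^sub>R grad u x)"
proof -
  obtain K where K: "compact K" "K \<subseteq> \<Omega>" "\<And>x. x \<notin> K \<Longrightarrow> u x = 0"
    using C1c_support[OF u] by metis
  have cp: "continuous_on UNIV p"
    by (rule has_derivative_continuous_on[where f' = "\<lambda>x h. h \<bullet> P x"])
      (use p in \<open>auto simp: gderiv_def\<close>)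
  have D: "GDERIV (\<lambda>x. u x * p x) x :> u x *\<^sub>R P x + p x *\<^sub>R grad u x" for x
    by (rule GDERIV_mult[OF C1c_GDERIV[OF u] p(1)])
  have C: "continuous_on UNIV (\<lambda>x. u x *\<^sub>R P x + p x *\<^sub>R grad u x)"
    by (intro continuous_intros C1c_continuous_grad[OF u] C1c_continuous[OF u] p cp)
  have S: "{x. u x * p x \<noteq> 0} \<subseteq> K"
    using K by auto
  show "(\<lambda>x. u x * p x) \<in> C1c \<Omega>" "grad (\<lambda>x. u x * p x) = (\<lambda>x. u x *\<^sub>R P x + p x *\<^sub>R grad u x)"
    by (rule C1cI[OF D C S K(1,2)])+
qed

lemma integrable_continuous_compact_support:
  fixes f :: "'a::euclidean_space \<Rightarrow> 'b::{banach, second_countable_topology}"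
  assumes "continuous_on UNIV f" "compact K" "\<And>x. x \<notin> K \<Longrightarrow> f x = 0"
  shows "integrable lborel f"
proof -
  have "integrable lborel (\<lambda>x. indicator K x *\<^sub>R f x)"
    using assms by (intro borel_integrable_compact) (auto intro: continuous_on_subset)
  moreover have "(\<lambda>x. indicator K x *\<^sub>R f x) = f"
    using assms by (auto simp: indicator_def)
  ultimately show ?thesis by simp
qed

lemma C1c_borel [measurable_dest]: "v \<in> C1c \<Omega> \<Longrightarrow> v \<in> borel_measurable borel"
  by (intro borel_measurable_continuous_onI C1c_continuous)

lemma C1c_grad_borel: "v \<in> C1c \<Omega> \<Longrightarrow> grad v \<in> borel_measurable borel"
  by (intro borel_measurable_continuous_onI C1c_continuous_grad)

lemma C1c_integrable: "v \<in> C1c \<Omega> \<Longrightarrow> integrable lborel v"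
  using C1c_support[of v \<Omega>] by (metis integrable_continuous_compact_support C1c_continuous)

lemma C1c_L2:
  assumes v: "v \<in> C1c \<Omega>"
  shows "v \<in> L2 lborel" "grad v \<in> L2 lborel"
proof -
  obtain K where K: "compact K" "\<And>x. x \<notin> K \<Longrightarrow> v x = 0" "\<And>x. x \<notin> K \<Longrightarrow> grad v x = 0"
    using C1c_support[OF v] by metis
  show "v \<in> L2 lborel"
    unfolding L2_def using C1c_borel[OF v] C1c_continuous[OF v] K
    by (auto intro!: integrable_continuous_compact_support[OF _ K(1)] continuous_intros)
  show "grad v \<in> L2 lborel"
    unfolding L2_def using C1c_grad_borel[OF v] C1c_continuous_grad[OF v] K
    by (auto intro!: integrable_continuous_compact_support[OF _ K(1)] continuous_intros)
qed

subsection \<open>Translations\<close>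

lemma nn_integral_lborel_translate:
  fixes f :: "'a::euclidean_space \<Rightarrow> ennreal"
  assumes [measurable]: "f \<in> borel_measurable borel"
  shows "(\<integral>\<^sup>+x. f (x + h) \<partial>lborel) = (\<integral>\<^sup>+x. f x \<partial>lborel)"
proof -
  have "(\<integral>\<^sup>+x. f x \<partial>lborel) = (\<integral>\<^sup>+x. f x \<partial>distr lborel borel ((+) h))"
    by (simp add: lborel_distr_plus)
  also have "\<dots> = (\<integral>\<^sup>+x. f (h + x) \<partial>lborel)"
    by (rule nn_integral_distr) auto
  finally show ?thesis
    by (simp add: add.commute)
qed

lemma integral_lborel_translate:
  fixes f :: "'a::euclidean_space \<Rightarrow> 'b::{banach, second_countable_topology}"
  assumes [measurable]: "f \<in> borel_measurable borel"
  shows "(LINT x|lborel. f (x + h)) = (LINT x|lborel. f x)"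
proof -
  have "(LINT x|lborel. f x) = (LINT x|distr lborel borel ((+) h). f x)"
    by (simp add: lborel_distr_plus)
  also have "\<dots> = (LINT x|lborel. f (h + x))"
    by (rule integral_distr) auto
  finally show ?thesis
    by (simp add: add.commute)
qed

lemma integrable_lborel_translate:
  fixes f :: "'a::euclidean_space \<Rightarrow> 'b::{banach, second_countable_topology}"
  assumes "integrable lborel f"
  shows "integrable lborel (\<lambda>x. f (x + h))"
proof -
  have "integrable (distr lborel borel ((+) h)) f"
    using assms by (simp add: lborel_distr_plus)
  then have "integrable lborel (\<lambda>x. f (h + x))"
    by (subst (asm) integrable_distr_eq) (use assms in auto)
  then show ?thesis
    by (simp add: add.commute)
qed

section \<open>Translation estimates controlled by the gradient\<close>

lemma C1c_line_derivative:
  assumes "v \<in> C1c \<Omega>"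
  shows "((\<lambda>t. v (x + t *\<^sub>R h)) has_vector_derivative (grad v (x + t *\<^sub>R h) \<bullet> h)) (at t within T)"
proof -
  have "(v has_derivative (\<lambda>k. k \<bullet> grad v (x + t *\<^sub>R h))) (at (x + t *\<^sub>R h))"
    using C1c_GDERIV[OF assms] by (simp add: gderiv_def)
  then have "((\<lambda>t. v (x + t *\<^sub>R h)) has_derivative (\<lambda>\<tau>. (\<tau> *\<^sub>R h) \<bullet> grad v (x + t *\<^sub>R h))) (at t within T)"
    by (rule has_derivative_compose[rotated]) (auto intro!: derivative_eq_intros)
  then show ?thesis
    by (simp add: has_vector_derivative_def inner_commute)
qed

text \<open>Jensen's inequality for the square: the variance about the mean \<open>c\<close> is
  nonnegative.\<close>

lemma power2_integral_le:
  fixes \<phi> :: "real \<Rightarrow> real"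
  assumes "continuous_on {0..1} \<phi>"
  shows "(integral {0..1} \<phi>)\<^sup>2 \<le> integral {0..1} (\<lambda>t. (\<phi> t)\<^sup>2)"
proof -
  define c where "c = integral {0..1} \<phi>"
  have int: "\<phi> integrable_on {0..1}" "(\<lambda>t. (\<phi> t)\<^sup>2) integrable_on {0..1}"
    by (intro integrable_continuous_real continuous_intros assms)+
  have "0 \<le> integral {0..1} (\<lambda>t. (\<phi> t - c)\<^sup>2)"
    by (intro integral_nonneg integrable_continuous_real continuous_intros assms) auto
  also have "(\<lambda>t. (\<phi> t - c)\<^sup>2) = (\<lambda>t. ((\<phi> t)\<^sup>2 - 2 * c * \<phi> t) + c\<^sup>2)"
    by (auto simp: power2_eq_square algebra_simps)
  also have "integral {0..1} \<dots> = integral {0..1} (\<lambda>t. (\<phi> t)\<^sup>2) - 2 * c * c + c\<^sup>2"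
  proof (rule integral_unique)
    have "((\<lambda>t. (\<phi> t)\<^sup>2 - 2 * c * \<phi> t + c\<^sup>2) has_integral
        (integral {0..1} (\<lambda>t. (\<phi> t)\<^sup>2) - 2 * c * c + c\<^sup>2 * (1 - 0))) {0..1}"
      using int has_integral_const_real[of "c\<^sup>2" 0 1] unfolding c_def
      by (intro has_integral_add has_integral_diff has_integral_mult_right integrable_integral) auto
    then show "((\<lambda>t. (\<phi> t)\<^sup>2 - 2 * c * \<phi> t + c\<^sup>2) has_integral
        (integral {0..1} (\<lambda>t. (\<phi> t)\<^sup>2) - 2 * c * c + c\<^sup>2)) {0..1}"
      by simp
  qed
  finally show ?thesis
    by (simp add: c_def power2_eq_square)
qed

text \<open>The fundamental theorem of calculus on the segment from \<open>x\<close> to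
  \<open>x + h\<close>, then Jensen and Cauchy-Schwarz. The right side is a nonnegative integral
  over the line so that Tonelli applies to it next.\<close>

lemma C1c_translation_pointwise:
  assumes v: "v \<in> C1c \<Omega>"
  shows "ennreal ((v (x + h) - v x)\<^sup>2)
    \<le> (\<integral>\<^sup>+t. indicator {0..1} t * ennreal ((norm h)\<^sup>2 * (norm (grad v (x + t *\<^sub>R h)))\<^sup>2) \<partial>lborel)"
proof -
  define \<phi> where "\<phi> t = grad v (x + t *\<^sub>R h) \<bullet> h" for t
  define \<psi> where "\<psi> t = (norm h)\<^sup>2 * (norm (grad v (x + t *\<^sub>R h)))\<^sup>2" for t
  have [continuous_intros]: "continuous_on S (\<lambda>t. grad v (x + t *\<^sub>R h))" for S :: "real set"
    by (rule continuous_on_compose2[OF C1c_continuous_grad[OF v]]) (auto intro!: continuous_intros)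
  have c: "continuous_on S \<phi>" "continuous_on S \<psi>" for S
    unfolding \<phi>_def \<psi>_def by (intro continuous_intros)+
  have "(\<phi> has_integral (v (x + 1 *\<^sub>R h) - v (x + 0 *\<^sub>R h))) {0..1}"
    unfolding \<phi>_def by (intro fundamental_theorem_of_calculus C1c_line_derivative[OF v]) auto
  then have "v (x + h) - v x = integral {0..1} \<phi>"
    by (simp add: integral_unique)
  then have "(v (x + h) - v x)\<^sup>2 \<le> integral {0..1} (\<lambda>t. (\<phi> t)\<^sup>2)"
    using power2_integral_le[OF c(1)] by simp
  also have "\<dots> \<le> integral {0..1} \<psi>"
  proof (rule integral_le)
    show "(\<phi> t)\<^sup>2 \<le> \<psi> t" for t
      using power_mono[OF Cauchy_Schwarz_ineq2[of "grad v (x + t *\<^sub>R h)" h], of 2]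
      by (simp add: \<phi>_def \<psi>_def power_mult_distrib mult.commute)
  qed (auto intro!: integrable_continuous_real continuous_intros c)
  finally have "ennreal ((v (x + h) - v x)\<^sup>2) \<le> ennreal (integral {0..1} \<psi>)"
    by (rule ennreal_leI)
  also have "\<dots> = (\<integral>\<^sup>+t. indicator {0..1} t * ennreal (\<psi> t) \<partial>lborel)"
  proof -
    have "(\<psi> has_integral integral {0..1} \<psi>) {0..1}"
      by (intro integrable_integral integrable_continuous_real c)
    then have "(\<integral>\<^sup>+t. ennreal (\<psi> t) * indicator {0..1} t \<partial>lborel) = ennreal (integral {0..1} \<psi>)"
      by (rule nn_integral_has_integral_lebesgue'[rotated]) (simp add: \<psi>_def)
    then show ?thesis
      by (simp add: mult.commute)
  qed
  finally show ?thesis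
    by (simp add: \<psi>_def)
qed

text \<open>After exchanging the integrals, translation invariance makes the inner one independent
  of the position \<open>t\<close> on the segment.\<close>

lemma C1c_translation_nn:
  assumes v: "v \<in> C1c \<Omega>"
  shows "(\<integral>\<^sup>+x. ennreal ((v (x + h) - v x)\<^sup>2) \<partial>lborel)
    \<le> ennreal ((norm h)\<^sup>2) * (\<integral>\<^sup>+x. ennreal ((norm (grad v x))\<^sup>2) \<partial>lborel)"
proof -
  have [measurable]: "grad v \<in> borel_measurable borel"
    by (rule C1c_grad_borel[OF v])
  let ?g = "\<lambda>x t. indicator {0..1} t * ennreal ((norm h)\<^sup>2 * (norm (grad v (x + t *\<^sub>R h)))\<^sup>2)"
  have "(\<integral>\<^sup>+x. ennreal ((v (x + h) - v x)\<^sup>2) \<partial>lborel) \<le> (\<integral>\<^sup>+x. \<integral>\<^sup>+t. ?g x t \<partial>lborel \<partial>lborel)"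
    by (intro nn_integral_mono C1c_translation_pointwise[OF v])
  also have "\<dots> = (\<integral>\<^sup>+t. \<integral>\<^sup>+x. ?g x t \<partial>lborel \<partial>lborel)"
    by (rule lborel_pair.Fubini'[symmetric]) measurable
  also have "\<dots> = (\<integral>\<^sup>+t. indicator {0..1} t * (ennreal ((norm h)\<^sup>2) *
      (\<integral>\<^sup>+x. ennreal ((norm (grad v x))\<^sup>2) \<partial>lborel)) \<partial>(lborel :: real measure))"
  proof (rule nn_integral_cong)
    fix t :: real
    have "(\<integral>\<^sup>+x. ?g x t \<partial>lborel) =
        indicator {0..1} t * (ennreal ((norm h)\<^sup>2) * (\<integral>\<^sup>+x. ennreal ((norm (grad v (x + t *\<^sub>R h)))\<^sup>2) \<partial>lborel))"
      by (simp add: nn_integral_cmult ennreal_mult)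
    also have "(\<integral>\<^sup>+x. ennreal ((norm (grad v (x + t *\<^sub>R h)))\<^sup>2) \<partial>lborel) =
        (\<integral>\<^sup>+x. ennreal ((norm (grad v x))\<^sup>2) \<partial>lborel)"
      by (rule nn_integral_lborel_translate) measurable
    finally show "(\<integral>\<^sup>+x. ?g x t \<partial>lborel) = indicator {0..1} t * (ennreal ((norm h)\<^sup>2) *
      (\<integral>\<^sup>+x. ennreal ((norm (grad v x))\<^sup>2) \<partial>lborel))" .
  qed
  also have "\<dots> = ennreal ((norm h)\<^sup>2) * (\<integral>\<^sup>+x. ennreal ((norm (grad v x))\<^sup>2) \<partial>lborel)"
    by (subst nn_integral_multc) auto
  finally show ?thesis .
qed

text \<open>Difference quotients have integral 0 by translation invariance, and they converge
  dominatedly to the partial derivative.\<close>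

lemma C1c_integral_grad:
  assumes v: "v \<in> C1c \<Omega>"
  shows "(LINT x|lborel. grad v x $ i) = 0"
proof -
  define e :: "real ^ 'a" where "e = axis i 1"
  define \<tau> :: "nat \<Rightarrow> real" where "\<tau> n = inverse (real (Suc n))" for n
  have \<tau>: "0 < \<tau> n" "\<tau> n \<le> 1" for n
    by (auto simp: \<tau>_def field_simps)
  have \<tau>_lim: "filterlim \<tau> (at 0) sequentially"
    using \<tau>(1) LIMSEQ_inverse_real_of_nat unfolding filterlim_at \<tau>_def
    by (auto simp: less_le)
  obtain K where K: "compact K" "\<And>x. x \<notin> K \<Longrightarrow> v x = 0" "\<And>x. x \<notin> K \<Longrightarrow> grad v x = 0"
    using C1c_support[OF v] by metis
  obtain R where R: "\<And>x. x \<in> K \<Longrightarrow> norm x \<le> R"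
    using compact_imp_bounded[OF K(1)] by (auto simp: bounded_iff)
  obtain B where B: "\<And>x. norm (grad v x) \<le> B" "B \<ge> 0"
  proof -
    have "bounded (grad v ` K)"
      by (intro compact_imp_bounded compact_continuous_image K
          continuous_on_subset[OF C1c_continuous_grad[OF v]]) auto
    then obtain B where "\<And>x. x \<in> K \<Longrightarrow> norm (grad v x) \<le> B"
      by (auto simp: bounded_iff)
    then have "norm (grad v x) \<le> max B 0" for x
      using K(3)[of x] by (cases "x \<in> K") (auto simp: le_max_iff_disj)
    then show ?thesis
      using that[of "max B 0"] by auto
  qed
  have lip: "\<bar>v y - v x\<bar> \<le> B * norm (y - x)" for x y
  proof -
    have "norm (v y - v x) \<le> B * norm (y - x)"
    proof (rule differentiable_bound[of UNIV])
      show "(v has_derivative (\<lambda>k. k \<bullet> grad v z)) (at z within UNIV)" for z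
        using C1c_GDERIV[OF v] by (simp add: gderiv_def)
      show "onorm (\<lambda>k. k \<bullet> grad v z) \<le> B" for z
      proof (rule onorm_le)
        fix k
        have "\<bar>k \<bullet> grad v z\<bar> \<le> norm k * norm (grad v z)"
          by (rule Cauchy_Schwarz_ineq2)
        also have "\<dots> \<le> norm k * B"
          by (intro mult_left_mono B) auto
        finally show "norm (k \<bullet> grad v z) \<le> B * norm k"
          by (simp add: mult.commute)
      qed
    qed auto
    then show ?thesis by simp
  qed
  let ?q = "\<lambda>n x. (v (x + \<tau> n *\<^sub>R e) - v x) / \<tau> n"
  have "(\<lambda>n. LINT x|lborel. ?q n x) \<longlonglongrightarrow> (LINT x|lborel. grad v x $ i)"
  proof (rule integral_dominated_convergence)
    \<comment> \<open>As \<open>\<tau> n \<le> 1\<close>, all quotients vanish outside the ball of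
      radius \<open>R + 1\<close>, and the Lipschitz constant \<open>B\<close> bounds them
      inside.\<close>
    show "integrable lborel (\<lambda>x :: real ^ 'a. indicator (cball 0 (R + 1)) x *\<^sub>R B)"
      by (intro borel_integrable_compact) auto
    show "AE x in lborel. (\<lambda>n. ?q n x) \<longlonglongrightarrow> grad v x $ i"
    proof (rule AE_I2)
      fix x
      have "((\<lambda>t. v (x + t *\<^sub>R e)) has_real_derivative (grad v (x + 0 *\<^sub>R e) \<bullet> e)) (at 0)"
        using C1c_line_derivative[OF v, of x e 0] by (simp add: has_real_derivative_iff_has_vector_derivative)
      then have "(\<lambda>t. (v (x + t *\<^sub>R e) - v x) / t) \<midarrow>0\<rightarrow> grad v x \<bullet> e"
        by (simp add: has_field_derivative_iff)
      then show "(\<lambda>n. ?q n x) \<longlonglongrightarrow> grad v x $ i"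
        using filterlim_compose[OF _ \<tau>_lim] by (fastforce simp: e_def inner_axis)
    qed
    show "AE x in lborel. norm (?q n x) \<le> indicator (cball 0 (R + 1)) x *\<^sub>R B" for n
    proof (rule AE_I2)
      fix x
      have ne: "norm e = 1"
        by (simp add: e_def)
      show "norm (?q n x) \<le> indicator (cball 0 (R + 1)) x *\<^sub>R B"
      proof (cases "x \<in> cball 0 (R + 1)")
        case True
        then show ?thesis
          using lip[of "x + \<tau> n *\<^sub>R e" x] \<tau>[of n] ne by (simp add: divide_le_eq)
      next
        case False
        have "x \<notin> K"
          using False R by force
        moreover have "x + \<tau> n *\<^sub>R e \<notin> K"
        proof
          assume "x + \<tau> n *\<^sub>R e \<in> K"
          then have "norm (x + \<tau> n *\<^sub>R e) \<le> R"
            by (rule R)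
          then have "norm x \<le> R + norm (\<tau> n *\<^sub>R e)"
            using norm_triangle_ineq2[of x "- (\<tau> n *\<^sub>R e)"] by simp
          then show False
            using False \<tau>[of n] ne by simp
        qed
        ultimately show ?thesis
          using B K by simp
      qed
    qed
  next
    have [measurable]: "v \<in> borel_measurable borel"
      by (rule C1c_borel[OF v])
    show "?q n \<in> borel_measurable lborel" for n
      by measurable
    show "(\<lambda>x. grad v x $ i) \<in> borel_measurable lborel"
      using C1c_continuous_grad[OF v]
      by (auto intro!: borel_measurable_continuous_onI continuous_intros)
  qed
  moreover have "(\<lambda>n. LINT x|lborel. ?q n x) = (\<lambda>n. 0)"
  proof
    fix n
    have "(LINT x|lborel. v (x + \<tau> n *\<^sub>R e) - v x) =
        (LINT x|lborel. v (x + \<tau> n *\<^sub>R e)) - (LINT x|lborel. v x)"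
      by (intro Bochner_Integration.integral_diff integrable_lborel_translate C1c_integrable[OF v])
    also have "\<dots> = 0"
      by (simp add: integral_lborel_translate C1c_borel[OF v])
    finally show "(LINT x|lborel. ?q n x) = 0"
      by simp
  qed
  ultimately show ?thesis
    by (simp only: LIMSEQ_const_iff)
qed

text \<open>The product \<open>u x * p x\<close> is again compactly supported, so the integral of
  its partial derivative vanishes and the product rule splits it.\<close>

lemma C1c_integration_by_parts:
  assumes u: "u \<in> C1c \<Omega>" and p: "\<And>x. GDERIV p x :> P x" "continuous_on UNIV P"
  shows "(LINT x|lborel. u x * P x $ i) = - (LINT x|lborel. grad u x $ i * p x)"
proof -
  obtain K where K: "compact K" "\<And>x. x \<notin> K \<Longrightarrow> u x = 0" "\<And>x. x \<notin> K \<Longrightarrow> grad u x = 0"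
    using C1c_support[OF u] by metis
  have cp: "continuous_on UNIV p"
    by (rule has_derivative_continuous_on[where f' = "\<lambda>x h. h \<bullet> P x"])
      (use p in \<open>auto simp: gderiv_def\<close>)
  have "0 = (LINT x|lborel. grad (\<lambda>x. u x * p x) x $ i)"
    by (rule C1c_integral_grad[symmetric, OF C1c_mult(1)[OF u p]])
  also have "\<dots> = (LINT x|lborel. u x * P x $ i + grad u x $ i * p x)"
    unfolding C1c_mult(2)[OF u p] by (simp add: mult.commute)
  also have "\<dots> = (LINT x|lborel. u x * P x $ i) + (LINT x|lborel. grad u x $ i * p x)"
  proof (rule Bochner_Integration.integral_add)
    show "integrable lborel (\<lambda>x. u x * P x $ i)"
      by (rule integrable_continuous_compact_support[OF _ K(1)])
        (use K in \<open>auto intro!: continuous_intros C1c_continuous[OF u] p\<close>)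
    show "integrable lborel (\<lambda>x. grad u x $ i * p x)"
      by (rule integrable_continuous_compact_support[OF _ K(1)])
        (use K in \<open>auto intro!: continuous_intros C1c_continuous_grad[OF u] cp\<close>)
  qed
  finally show ?thesis by simp
qed

section \<open>The Poincare inequality\<close>

abbreviation dirichlet :: "(real ^ 'n::finite \<Rightarrow> real) \<Rightarrow> real" where
  "dirichlet v \<equiv> LINT x|lborel. (norm (grad v x))\<^sup>2"

text \<open>A shift longer than the diameter of \<Omega> makes \<open>v\<close> and its translate
  vanish alternately, so the square of \<open>v\<close> is dominated by that of the difference, and
  the translation estimate applies.\<close>

lemma Poincare_inequality:
  fixes \<Omega> :: "(real ^ 'n::finite) set"
  assumes "bounded \<Omega>"
  obtains P where "P > 0" "\<And>v. v \<in> C1c \<Omega> \<Longrightarrow>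
    (LINT x|lborel. (v x)\<^sup>2) \<le> P * dirichlet v"
proof -
  obtain R where R: "R > 0" "\<And>x. x \<in> \<Omega> \<Longrightarrow> norm x \<le> R"
    using assms unfolding bounded_pos by auto
  \<comment> \<open>Any coordinate direction will do; the length \<open>3 * R\<close> exceeds
    \<open>2 * R\<close>, which bounds all distances inside \<Omega>.\<close>
  define h :: "real ^ 'n" where "h = (3 * R) *\<^sub>R axis undefined 1"
  have h: "norm h = 3 * R"
    using R by (simp add: h_def)
  have "(LINT x|lborel. (v x)\<^sup>2) \<le> (3 * R)\<^sup>2 * dirichlet v"
    if v: "v \<in> C1c \<Omega>" for v
  proof -
    have disj: "v (x + h) = 0 \<or> v x = 0" for x
    proof (rule ccontr)
      assume "\<not> ?thesis"
      then have "x + h \<in> \<Omega>" "x \<in> \<Omega>"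
        using C1c_eq_0[OF v] by blast+
      then have "norm h \<le> 2 * R"
        using R(2)[of "x + h"] R(2)[of x] norm_triangle_ineq4[of "x + h" x] by simp
      then show False
        using h R by simp
    qed
    have "(\<integral>\<^sup>+x. ennreal ((v x)\<^sup>2) \<partial>lborel) \<le> (\<integral>\<^sup>+x. ennreal ((v (x + h) - v x)\<^sup>2) \<partial>lborel)"
    proof (rule order_trans)
      show "(\<integral>\<^sup>+x. ennreal ((v x)\<^sup>2) \<partial>lborel) \<le> (\<integral>\<^sup>+x. ennreal ((v (x + h) - v x)\<^sup>2) \<partial>lborel)"
        using disj by (intro nn_integral_mono ennreal_leI) (metis diff_0 diff_zero order_refl power2_minus zero_le_power2 zero_power2 power_zero_numeral)
    qed simp
    also have "\<dots> \<le> ennreal ((norm h)\<^sup>2) * (\<integral>\<^sup>+x. ennreal ((norm (grad v x))\<^sup>2) \<partial>lborel)"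
      by (rule C1c_translation_nn[OF v])
    also have "\<dots> = ennreal ((norm h)\<^sup>2 * dirichlet v)"
      using L2_integrable_norm_sq[OF C1c_L2(2)[OF v]]
      by (simp add: nn_integral_eq_integral ennreal_mult)
    also have "(\<integral>\<^sup>+x. ennreal ((v x)\<^sup>2) \<partial>lborel) = ennreal (LINT x|lborel. (v x)\<^sup>2)"
      using L2_integrable_norm_sq[OF C1c_L2(1)[OF v]]
      by (simp add: nn_integral_eq_integral)
    finally show ?thesis
      using h by simp
  qed
  then show ?thesis
    using that[of "(3 * R)\<^sup>2"] R(1) by simp
qed

subsection \<open>The Gagliardo kernel\<close>

definition kern :: "real \<Rightarrow> real ^ 'n::finite \<Rightarrow> real" where
  "kern s z = 1 / norm z powr (real CARD('n) + 2 * s)"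

lemma kern_nonneg [simp]: "kern s z \<ge> 0"
  by (simp add: kern_def)

lemma kern_measurable [measurable]: "kern s \<in> borel_measurable borel"
  unfolding kern_def by measurable

lemma ball_sets_borel [measurable]: "ball c r \<in> sets borel" "cball c r \<in> sets borel"
  by auto

lemma ex_dyadic:
  fixes y :: real
  assumes "y \<ge> 1"
  obtains j :: nat where "2 ^ j \<le> y" "y < 2 ^ Suc j"
proof -
  define n where "n = (LEAST n. y < 2 ^ n)"
  have ex: "\<exists>n. y < 2 ^ n"
    using real_arch_pow[of 2 y] by auto
  have n: "y < 2 ^ n"
    unfolding n_def by (rule LeastI_ex[OF ex])
  then obtain j where j: "n = Suc j"
    using assms by (cases n) auto
  have "\<not> y < 2 ^ j"
    using not_less_Least[of j "\<lambda>n. y < 2 ^ n"] j unfolding n_def by simp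
  then show ?thesis
    using that[of j] n j by simp
qed

text \<open>Dyadic shells, enlarged to balls whose volume is explicit. The shells far out contribute
  a geometric series of ratio \<open>2 powr (- 2 * s)\<close>, those near 0 one of ratio
  \<open>2 powr (2 * s - 2)\<close>; both ratios are below 1 exactly for 0 < s < 1.\<close>

lemma nn_integral_kern_finite:
  assumes s: "0 < s" "s < 1"
  shows "(\<integral>\<^sup>+z. ennreal (min 1 ((norm z)\<^sup>2) * kern s (z :: real ^ 'n::finite)) \<partial>lborel) < \<infinity>"
proof -
  define p where "p = real CARD('n) + 2 * s"
  define \<omega> where "\<omega> = unit_ball_vol (real CARD('n))"
  \<comment> \<open>\<open>a j\<close> bounds the kernel where \<open>norm z\<close> lies between
    \<open>2 ^ j\<close> and \<open>2 ^ Suc j\<close>; \<open>b j\<close> bounds the kernel times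
    the squared norm where \<open>1 / norm z\<close> does.\<close>
  define a where "a j = (2::real) powr (- real j * p)" for j :: nat
  define b where "b j = (2::real) powr (real (Suc j) * p - 2 * real j)" for j :: nat
  let ?A = "\<lambda>j. ball (0 :: real ^ 'n) (2 powr real (Suc j))"
  \<comment> \<open>The radius is twice the outer radius of the shell, so that the open ball
    contains the outer sphere.\<close>
  let ?B = "\<lambda>j. ball (0 :: real ^ 'n) (2 powr (1 - real j))"
  let ?f = "\<lambda>j z. ennreal (a j) * indicator (?A j) z + ennreal (b j) * indicator (?B j) z"
  have p: "p > 0"
    using s by (simp add: p_def add_nonneg_pos)
  have "ennreal (min 1 ((norm z)\<^sup>2) * kern s z) \<le> (\<Sum>j. ?f j z)" for z :: "real ^ 'n"
  proof -
    have "\<exists>j. ennreal (min 1 ((norm z)\<^sup>2) * kern s z) \<le> ?f j z"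
    proof (cases "norm z \<ge> 1")
      case True
      then obtain j where j: "2 ^ j \<le> norm z" "norm z < 2 ^ Suc j"
        by (rule ex_dyadic)
      have "1 / norm z powr p \<le> 1 / (2 ^ j) powr p"
        using j p True by (intro divide_left_mono powr_mono2 mult_pos_pos) auto
      also have "\<dots> = a j"
        by (simp add: a_def powr_minus_divide powr_powr flip: powr_realpow)
      finally have "min 1 ((norm z)\<^sup>2) * kern s z \<le> 1 * a j"
        unfolding kern_def p_def[symmetric] by (intro mult_mono) auto
      moreover have "z \<in> ?A j"
        using j(2) by (simp add: powr_realpow[symmetric] powr_add)
      ultimately have "ennreal (min 1 ((norm z)\<^sup>2) * kern s z) \<le> ?f j z"
        by (auto intro!: add_increasing2 ennreal_leI)
      then show ?thesis ..
    next
      case False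
      show ?thesis
      proof (cases "z = 0")
        case True
        then show ?thesis by simp
      next
        case z: False
        then have "1 / norm z \<ge> 1"
          using False by simp
        then obtain j where j: "2 ^ j \<le> 1 / norm z" "1 / norm z < 2 ^ Suc j"
          by (rule ex_dyadic)
        have up: "norm z \<le> 2 powr (- real j)" and lo: "2 powr (- real (Suc j)) \<le> norm z"
        proof -
          have "2 powr (- real j) = 1 / 2 ^ j" "2 powr (- real (Suc j)) = (1 :: real) / 2 ^ Suc j"
            by (simp_all only: powr_minus_divide powr_realpow zero_less_numeral)
          moreover have "norm z \<le> 1 / 2 ^ j" "1 / 2 ^ Suc j \<le> norm z"
            using j z by (simp_all add: field_simps)
          ultimately show "norm z \<le> 2 powr (- real j)" "2 powr (- real (Suc j)) \<le> norm z"
            by (simp_all only:)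
        qed
        have "(norm z)\<^sup>2 \<le> (2 powr (- real j))\<^sup>2"
          by (intro power_mono up) auto
        also have "\<dots> = 2 powr (- 2 * real j)"
          by (simp add: power2_eq_square flip: powr_add)
        finally have 1: "(norm z)\<^sup>2 \<le> 2 powr (- 2 * real j)" .
        have "1 / norm z powr p \<le> 1 / (2 powr (- real (Suc j))) powr p"
          using lo p z by (intro divide_left_mono powr_mono2 mult_pos_pos) auto
        also have "\<dots> = 2 powr (real (Suc j) * p)"
        proof -
          have "(2 powr (- x)) powr p = 2 powr (- (x * p))" for x :: real
            by (simp only: powr_powr mult_minus_left)
          then show ?thesis
            by (simp only: powr_minus) (simp add: inverse_eq_divide)
        qed
        finally have "min 1 ((norm z)\<^sup>2) * kern s z \<le> 2 powr (- 2 * real j) * 2 powr (real (Suc j) * p)"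
          using 1 unfolding kern_def p_def[symmetric] by (intro mult_mono) auto
        also have "\<dots> = b j"
          by (simp add: b_def algebra_simps flip: powr_add)
        finally have "min 1 ((norm z)\<^sup>2) * kern s z \<le> b j" .
        moreover have "z \<in> ?B j"
        proof -
          have "norm z \<le> 2 powr (- real j)" by (rule up)
          also have "\<dots> < 2 powr (1 - real j)" by simp
          finally show ?thesis by simp
        qed
        ultimately have "ennreal (min 1 ((norm z)\<^sup>2) * kern s z) \<le> ?f j z"
          by (auto intro!: add_increasing ennreal_leI)
        then show ?thesis ..
      qed
    qed
    then obtain j where "ennreal (min 1 ((norm z)\<^sup>2) * kern s z) \<le> ?f j z" ..
    also have "\<dots> \<le> (\<Sum>j. ?f j z)"
      using sum_le_suminf[of "\<lambda>j. ?f j z" "{j}"] by simp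
    finally show ?thesis .
  qed
  then have "(\<integral>\<^sup>+z. ennreal (min 1 ((norm z)\<^sup>2) * kern s (z :: real ^ 'n)) \<partial>lborel) \<le>
      (\<integral>\<^sup>+z. (\<Sum>j. ?f j z) \<partial>lborel)"
    by (intro nn_integral_mono)
  also have "\<dots> = (\<Sum>j. \<integral>\<^sup>+z. ?f j z \<partial>lborel)"
    by (rule nn_integral_suminf) measurable
  also have "\<dots> = (\<Sum>j. ennreal (\<omega> * 2 ^ CARD('n) * (2 powr (- 2 * s)) ^ j + \<omega> * 2 powr (p + real CARD('n)) * (2 powr (2 * s - 2)) ^ j))"
  proof (rule suminf_cong)
    fix j
    have "(\<integral>\<^sup>+z. ?f j z \<partial>lborel) = ennreal (a j) * emeasure lborel (?A j) + ennreal (b j) * emeasure lborel (?B j)"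
      by (subst nn_integral_add) (auto simp: nn_integral_cmult_indicator)
    also have "\<dots> = ennreal (a j * (\<omega> * (2 powr real (Suc j)) ^ CARD('n)) + b j * (\<omega> * (2 powr (1 - real j)) ^ CARD('n)))"
      by (simp add: emeasure_ball \<omega>_def a_def b_def ennreal_mult'' ennreal_plus)
    also have "a j * (\<omega> * (2 powr real (Suc j)) ^ CARD('n)) = \<omega> * 2 ^ CARD('n) * (2 powr (- 2 * s)) ^ j"
      by (simp add: a_def p_def powr_realpow[symmetric] powr_powr algebra_simps flip: powr_add)
    also have "b j * (\<omega> * (2 powr (1 - real j)) ^ CARD('n)) = \<omega> * 2 powr (p + real CARD('n)) * (2 powr (2 * s - 2)) ^ j"
      by (simp add: b_def p_def powr_realpow[symmetric] powr_powr algebra_simps flip: powr_add)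
    finally show "(\<integral>\<^sup>+z. ?f j z \<partial>lborel) = ennreal (\<omega> * 2 ^ CARD('n) * (2 powr (- 2 * s)) ^ j + \<omega> * 2 powr (p + real CARD('n)) * (2 powr (2 * s - 2)) ^ j)" .
  qed
  also have "\<dots> < \<infinity>"
  proof -
    have "(2::real) powr (- 2 * s) < 2 powr 0" "(2::real) powr (2 * s - 2) < 2 powr 0"
      using s by (intro powr_less_mono; simp)+
    then have "summable (\<lambda>j. \<omega> * 2 ^ CARD('n) * (2 powr (- 2 * s)) ^ j + \<omega> * 2 powr (p + real CARD('n)) * (2 powr (2 * s - 2)) ^ j)"
      by (intro summable_add summable_mult summable_geometric) auto
    then show ?thesis
      by (subst suminf_ennreal2) (auto simp: \<omega>_def)
  qed
  finally show ?thesis .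
qed

subsection \<open>The nonlocal form\<close>

abbreviation lborel2 :: "('a::euclidean_space \<times> 'a) measure" where
  "lborel2 \<equiv> lborel \<Otimes>\<^sub>M lborel"

text \<open>In the coordinates \<open>(x, z)\<close> with \<open>y = x + z\<close> the Gagliardo seminorm of \<open>u\<close> is the
  \<open>L\<^sup>2\<close> norm of the following function.\<close>

definition fdq :: "real \<Rightarrow> (real ^ 'n::finite \<Rightarrow> real) \<Rightarrow> (real ^ 'n) \<times> (real ^ 'n) \<Rightarrow> real" where
  "fdq s u = (\<lambda>(x, z). (u (x + z) - u x) * sqrt (kern s z))"

lemma fdq_measurable [measurable]:
  assumes [measurable]: "u \<in> borel_measurable borel"
  shows "fdq s u \<in> borel_measurable lborel2"
  unfolding fdq_def by measurable

lemma fdq_lincomb: "fdq s (\<lambda>x. a * u x + b * v x) = (\<lambda>p. a * fdq s u p + b * fdq s v p)"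
  by (auto simp: fdq_def algebra_simps)

lemma fdq_mult: "fdq s u (x, z) * fdq s v (x, z) = (u (x + z) - u x) * (v (x + z) - v x) * kern s z"
proof -
  have "(a * sqrt (kern s z)) * (b * sqrt (kern s z)) = a * b * (sqrt (kern s z) * sqrt (kern s z))" for a b
    by (simp only: mult_ac)
  then show ?thesis
    by (simp add: fdq_def)
qed

text \<open>For each increment \<open>z\<close> there are two bounds: the translation estimate, with
  factor \<open>(norm z)\<^sup>2\<close>, and four times the squared L^2 norm. Using the first for
  short and the second for long increments leaves the integral of
  \<open>min 1 ((norm z)\<^sup>2) * kern s z\<close>.\<close>

lemma fdq_bound:
  assumes s: "0 < s" "s < 1"
  obtains K where "K > 0"
    "\<And>v :: real ^ 'n::finite \<Rightarrow> real. v \<in> C1c UNIV \<Longrightarrow> fdq s v \<in> L2 lborel2"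
    "\<And>v :: real ^ 'n::finite \<Rightarrow> real. v \<in> C1c UNIV \<Longrightarrow> (LINT p|lborel2. (fdq s v p)\<^sup>2)
      \<le> K * ((LINT x|lborel. (v x)\<^sup>2) + dirichlet v)"
proof -
  define k where "k = (\<integral>\<^sup>+z. ennreal (min 1 ((norm z)\<^sup>2) * kern s (z :: real ^ 'n)) \<partial>lborel)"
  define K where "K = enn2real k"
  have "K \<ge> 0"
    by (simp add: K_def)
  have k: "k = ennreal K"
    using nn_integral_kern_finite[OF s, where 'n = 'n] by (simp add: K_def k_def[symmetric])
  have bound: "(\<integral>\<^sup>+p. ennreal ((fdq s v p)\<^sup>2) \<partial>lborel2)
      \<le> ennreal ((4 * K + 1) * ((LINT x|lborel. (v x)\<^sup>2) + dirichlet v))"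
    if v: "v \<in> C1c UNIV" for v :: "real ^ 'n \<Rightarrow> real"
  proof -
    define V D where "V = (LINT x|lborel. (v x)\<^sup>2)" and "D = dirichlet v"
    have VD: "V \<ge> 0" "D \<ge> 0"
      by (auto simp: V_def D_def)
    have [measurable]: "v \<in> borel_measurable borel"
      by (rule C1c_borel[OF v])
    have V: "(\<integral>\<^sup>+x. ennreal ((v x)\<^sup>2) \<partial>lborel) = ennreal V"
      using L2_integrable_norm_sq[OF C1c_L2(1)[OF v]] by (simp add: V_def nn_integral_eq_integral)
    have D: "(\<integral>\<^sup>+x. ennreal ((norm (grad v x))\<^sup>2) \<partial>lborel) = ennreal D"
      using L2_integrable_norm_sq[OF C1c_L2(2)[OF v]] by (simp add: D_def nn_integral_eq_integral)
    have small: "(\<integral>\<^sup>+x. ennreal ((v (x + z) - v x)\<^sup>2) \<partial>lborel) \<le> ennreal ((norm z)\<^sup>2 * D)" for z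
      using C1c_translation_nn[OF v, of z] by (simp add: D ennreal_mult VD)
    have large: "(\<integral>\<^sup>+x. ennreal ((v (x + z) - v x)\<^sup>2) \<partial>lborel) \<le> ennreal (4 * V)" for z
    proof -
      have "(\<integral>\<^sup>+x. ennreal ((v (x + z) - v x)\<^sup>2) \<partial>lborel)
          \<le> (\<integral>\<^sup>+x. ennreal (2 * (v (x + z))\<^sup>2) + ennreal (2 * (v x)\<^sup>2) \<partial>lborel)"
      proof (rule nn_integral_mono)
        fix x
        have "(v (x + z) - v x)\<^sup>2 \<le> 2 * (v (x + z))\<^sup>2 + 2 * (v x)\<^sup>2"
          using zero_le_power2[of "v (x + z) + v x"] by (simp add: power2_sum power2_diff)
        then show "ennreal ((v (x + z) - v x)\<^sup>2) \<le> ennreal (2 * (v (x + z))\<^sup>2) + ennreal (2 * (v x)\<^sup>2)"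
          by (simp flip: ennreal_plus)
      qed
      also have "\<dots> = 2 * (\<integral>\<^sup>+x. ennreal ((v (x + z))\<^sup>2) \<partial>lborel) + 2 * (\<integral>\<^sup>+x. ennreal ((v x)\<^sup>2) \<partial>lborel)"
        by (subst nn_integral_add) (auto simp: ennreal_mult nn_integral_cmult)
      also have "(\<integral>\<^sup>+x. ennreal ((v (x + z))\<^sup>2) \<partial>lborel) = (\<integral>\<^sup>+x. ennreal ((v x)\<^sup>2) \<partial>lborel)"
        by (rule nn_integral_lborel_translate[where f = "\<lambda>x. ennreal ((v x)\<^sup>2)"]) measurable
      also have "2 * (\<integral>\<^sup>+x. ennreal ((v x)\<^sup>2) \<partial>lborel) + 2 * (\<integral>\<^sup>+x. ennreal ((v x)\<^sup>2) \<partial>lborel) = ennreal (4 * V)"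
      proof -
        have "2 * ennreal V + 2 * ennreal V = ennreal (2 * V) + ennreal (2 * V)"
          by (simp add: ennreal_mult')
        also have "\<dots> = ennreal (4 * V)"
          using VD by (subst ennreal_plus[symmetric]) auto
        finally show ?thesis by (simp add: V)
      qed
      finally show ?thesis .
    qed
    have "(\<integral>\<^sup>+p. ennreal ((fdq s v p)\<^sup>2) \<partial>lborel2) =
        (\<integral>\<^sup>+z. \<integral>\<^sup>+x. ennreal ((fdq s v (x, z))\<^sup>2) \<partial>lborel \<partial>lborel)"
      by (rule lborel_pair.nn_integral_snd[symmetric]) measurable
    also have "\<dots> \<le> (\<integral>\<^sup>+z. ennreal (4 * V + D) * ennreal (min 1 ((norm z)\<^sup>2) * kern s (z :: real ^ 'n)) \<partial>lborel)"
    proof (rule nn_integral_mono)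
      fix z :: "real ^ 'n"
      have "(\<integral>\<^sup>+x. ennreal ((fdq s v (x, z))\<^sup>2) \<partial>lborel) =
          (\<integral>\<^sup>+x. ennreal ((v (x + z) - v x)\<^sup>2) \<partial>lborel) * ennreal (kern s z)"
        by (subst nn_integral_multc[symmetric]) (auto simp: fdq_def power_mult_distrib ennreal_mult)
      also have "\<dots> \<le> ennreal (min 1 ((norm z)\<^sup>2) * (4 * V + D)) * ennreal (kern s z)"
      proof (rule mult_right_mono)
        have "min ((norm z)\<^sup>2 * D) (4 * V) \<le> min 1 ((norm z)\<^sup>2) * (4 * V + D)"
        proof (cases "(norm z)\<^sup>2 \<le> 1")
          case True
          then have "(norm z)\<^sup>2 * D \<le> min 1 ((norm z)\<^sup>2) * (4 * V + D)"
            using VD by (simp add: min_absorb2 mult_left_mono)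
          then show ?thesis
            by (rule min.coboundedI1)
        next
          case False
          then have "4 * V \<le> min 1 ((norm z)\<^sup>2) * (4 * V + D)"
            using VD by (simp add: min_absorb1)
          then show ?thesis
            by (rule min.coboundedI2)
        qed
        then have "ennreal (min ((norm z)\<^sup>2 * D) (4 * V)) \<le> ennreal (min 1 ((norm z)\<^sup>2) * (4 * V + D))"
          by (rule ennreal_leI)
        then show "(\<integral>\<^sup>+x. ennreal ((v (x + z) - v x)\<^sup>2) \<partial>lborel)
            \<le> ennreal (min 1 ((norm z)\<^sup>2) * (4 * V + D))"
          using small[of z] large[of z] by (auto simp: min_def split: if_splits)
      qed simp
      also have "\<dots> = ennreal (4 * V + D) * ennreal (min 1 ((norm z)\<^sup>2) * kern s z)"
      proof -
        have *: "ennreal (a * W) * ennreal b = ennreal W * ennreal (a * b)"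
          if "a \<ge> 0" "b \<ge> 0" "W \<ge> 0" for a b W
          using that by (simp add: ennreal_mult mult_ac)
        then show ?thesis
          using VD by (intro *) auto
      qed
      finally show "(\<integral>\<^sup>+x. ennreal ((fdq s v (x, z))\<^sup>2) \<partial>lborel)
          \<le> ennreal (4 * V + D) * ennreal (min 1 ((norm z)\<^sup>2) * kern s z)" .
    qed
    also have "\<dots> = ennreal (4 * V + D) * k"
      unfolding k_def by (rule nn_integral_cmult) measurable
    also have "\<dots> = ennreal ((4 * V + D) * K)"
      using VD \<open>K \<ge> 0\<close> by (simp add: k ennreal_mult)
    also have "\<dots> \<le> ennreal ((4 * K + 1) * (V + D))"
    proof -
      have "(4 * V + D) * K \<le> (4 * K + 1) * (V + D)"
        using VD \<open>K \<ge> 0\<close> mult_nonneg_nonneg[of D K] by (simp add: algebra_simps)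
      then show ?thesis by (rule ennreal_leI)
    qed
    finally show ?thesis
      by (simp add: V_def D_def)
  qed
  show ?thesis
  proof
    \<comment> \<open>The summand 1 makes the constant strictly positive, so that it may later
      appear in a denominator.\<close>
    show "4 * K + 1 > 0"
      using \<open>K \<ge> 0\<close> by simp
    fix v :: "real ^ 'n \<Rightarrow> real"
    assume v: "v \<in> C1c UNIV"
    have [measurable]: "v \<in> borel_measurable borel"
      by (rule C1c_borel[OF v])
    show L2: "fdq s v \<in> L2 lborel2"
      using bound[OF v] by (subst L2_iff_nn_integral) (auto intro: le_less_trans)
    have "ennreal (LINT p|lborel2. (fdq s v p)\<^sup>2) = (\<integral>\<^sup>+p. ennreal ((fdq s v p)\<^sup>2) \<partial>lborel2)"
      using L2_integrable_norm_sq[OF L2] by (simp add: nn_integral_eq_integral)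
    also have "\<dots> \<le> ennreal ((4 * K + 1) * ((LINT x|lborel. (v x)\<^sup>2) + dirichlet v))"
      by (rule bound[OF v])
    finally show "(LINT p|lborel2. (fdq s v p)\<^sup>2)
      \<le> (4 * K + 1) * ((LINT x|lborel. (v x)\<^sup>2) + dirichlet v)"
      by (subst (asm) ennreal_le_iff) (use \<open>K \<ge> 0\<close> in \<open>auto intro!: mult_nonneg_nonneg add_nonneg_nonneg\<close>)
  qed
qed

text \<open>The shear translates each fibre over a fixed first coordinate, so Tonelli and
  translation invariance show that it preserves volume.\<close>

lemma distr_shear_lborel:
  "distr lborel2 lborel2 (\<lambda>(x, z). (x, x + z)) =
    (lborel2 :: ('a::euclidean_space \<times> 'a) measure)"
proof (rule measure_eqI)
  fix A :: "('a \<times> 'a) set"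
  assume "A \<in> sets (distr lborel2 lborel2 (\<lambda>(x, z). (x, x + z)))"
  then have [measurable]: "A \<in> sets lborel2"
    by simp
  have "emeasure (distr lborel2 lborel2 (\<lambda>(x, z). (x, x + z))) A =
      (\<integral>\<^sup>+p. indicator A p \<partial>distr lborel2 lborel2 (\<lambda>(x, z). (x, x + z)))"
    by (rule nn_integral_indicator[symmetric]) measurable
  also have "\<dots> = (\<integral>\<^sup>+p. indicator A (fst p, fst p + snd p) \<partial>lborel2)"
    by (subst nn_integral_distr) (auto simp: case_prod_beta)
  also have "\<dots> = (\<integral>\<^sup>+x. \<integral>\<^sup>+z. indicator A (x, x + z) \<partial>lborel \<partial>lborel)"
    by (subst lborel.nn_integral_fst[symmetric]) auto
  also have "\<dots> = (\<integral>\<^sup>+x. \<integral>\<^sup>+z. indicator A (x, z) \<partial>lborel \<partial>lborel)"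
  proof (rule nn_integral_cong)
    fix x
    have "(\<integral>\<^sup>+z. indicator A (x, z + x) \<partial>lborel) = (\<integral>\<^sup>+z. indicator A (x, z) \<partial>lborel)"
      by (rule nn_integral_lborel_translate[where f = "\<lambda>z. indicator A (x, z)"]) measurable
    then show "(\<integral>\<^sup>+z. indicator A (x, x + z) \<partial>lborel) = (\<integral>\<^sup>+z. indicator A (x, z) \<partial>lborel)"
      by (simp add: add.commute)
  qed
  also have "\<dots> = (\<integral>\<^sup>+p. indicator A p \<partial>lborel2)"
    by (rule lborel.nn_integral_fst) measurable
  also have "\<dots> = emeasure lborel2 A"
    by (rule nn_integral_indicator) measurable
  finally show "emeasure (distr lborel2 lborel2 (\<lambda>(x, z). (x, x + z))) A =
      emeasure lborel2 A" .
qed simp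

text \<open>Connects the completed measure on the product type with \<open>lborel2\<close>: the
  integrand is Borel, so completion changes nothing, and the shear substitutes
  \<open>y = x + z\<close>.\<close>

lemma gagliardo_integral_eq_fdq:
  fixes u :: "real ^ 'n::finite \<Rightarrow> real"
  assumes [measurable]: "u \<in> borel_measurable borel"
  shows "(\<integral>\<^sup>+(x, y). ennreal ((u x - u y)\<^sup>2 / norm (x - y) powr (real CARD('n) + 2 * s)) \<partial>lebesgue) =
    (\<integral>\<^sup>+p. ennreal ((fdq s u p)\<^sup>2) \<partial>lborel2)"
proof -
  let ?f = "\<lambda>p. ennreal ((u (fst p) - u (snd p))\<^sup>2 / norm (fst p - snd p) powr (real CARD('n) + 2 * s))"
  have "(\<integral>\<^sup>+(x, y). ennreal ((u x - u y)\<^sup>2 / norm (x - y) powr (real CARD('n) + 2 * s)) \<partial>lebesgue) =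
      (\<integral>\<^sup>+p. ?f p \<partial>lborel2)"
    by (simp add: nn_integral_completion lborel_prod case_prod_unfold)
  also have "\<dots> = (\<integral>\<^sup>+p. ?f p \<partial>distr lborel2 lborel2 (\<lambda>(x, z). (x, x + z)))"
    by (simp add: distr_shear_lborel)
  also have "\<dots> = (\<integral>\<^sup>+p. ?f (case p of (x, z) \<Rightarrow> (x, x + z)) \<partial>lborel2)"
    by (rule nn_integral_distr) measurable
  also have "\<dots> = (\<integral>\<^sup>+p. ennreal ((fdq s u p)\<^sup>2) \<partial>lborel2)"
  proof (rule nn_integral_cong)
    fix p :: "(real ^ 'n) \<times> (real ^ 'n)"
    have "(u x - u (x + z))\<^sup>2 = (u (x + z) - u x)\<^sup>2" for x z
      by (rule power2_commute)
    then show "?f (case p of (x, z) \<Rightarrow> (x, x + z)) = ennreal ((fdq s u p)\<^sup>2)"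
      by (cases p) (simp add: fdq_def power_mult_distrib kern_def)
  qed
  finally show ?thesis .
qed

text \<open>The substitution \<open>y = x + z\<close> reverses the sign of both differences and so
  leaves their product unchanged. Integrability, which a weak solution has to provide, comes from
  the product of two L^2 functions.\<close>

lemma nonlocal_form_eq_fdq:
  fixes u v :: "real ^ 'n::finite \<Rightarrow> real"
  assumes [measurable]: "u \<in> borel_measurable borel" "v \<in> borel_measurable borel"
    and L2: "fdq s u \<in> L2 lborel2" "fdq s v \<in> L2 lborel2"
  shows "integrable lebesgue (\<lambda>(x, y). (u x - u y) * (v x - v y) / norm (x - y) powr (real CARD('n) + 2 * s))"
    and "(LINT (x, y)|lebesgue. (u x - u y) * (v x - v y) / norm (x - y) powr (real CARD('n) + 2 * s)) =
      (LINT p|lborel2. fdq s u p * fdq s v p)"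
proof -
  let ?f = "\<lambda>p. (u (fst p) - u (snd p)) * (v (fst p) - v (snd p)) /
    norm (fst p - snd p) powr (real CARD('n) + 2 * s)"
  let ?T = "\<lambda>(x, z). (x, x + z)"
  have f_meas [measurable]: "?f \<in> borel_measurable lborel2"
    by measurable
  have fT: "?f (?T p) = fdq s u p * fdq s v p" for p
  proof -
    have "(a - b) * (c - d) = (b - a) * (d - c)" for a b c d :: real
      by (simp add: algebra_simps)
    then show ?thesis
      by (cases p) (simp add: fdq_mult kern_def)
  qed
  have int: "integrable lborel2 (\<lambda>p. fdq s u p * fdq s v p)"
    by (rule L2_integrable_mult[OF L2])
  have "integrable (distr lborel2 lborel2 ?T) ?f"
    using int by (subst integrable_distr_eq) (simp_all only: fT f_meas, measurable)
  then have int_f: "integrable lborel2 ?f"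
    by (simp only: distr_shear_lborel)
  have "(LINT p|lborel2. ?f p) = (LINT p|(distr lborel2 lborel2 ?T). ?f p)"
    by (simp only: distr_shear_lborel)
  also have "\<dots> = (LINT p|lborel2. ?f (?T p))"
    by (rule integral_distr) measurable
  finally have eq: "(LINT p|lborel2. ?f p) = (LINT p|lborel2. fdq s u p * fdq s v p)"
    by (simp only: fT)
  have f_eq: "(\<lambda>(x, y). (u x - u y) * (v x - v y) / norm (x - y) powr (real CARD('n) + 2 * s)) = ?f"
    by (auto simp: case_prod_beta)
  have f_lborel: "?f \<in> borel_measurable lborel"
    using f_meas by (simp only: lborel_prod)
  show "integrable lebesgue (\<lambda>(x, y). (u x - u y) * (v x - v y) / norm (x - y) powr (real CARD('n) + 2 * s))"
    unfolding f_eq integrable_completion[OF f_lborel] using int_f by (simp only: lborel_prod)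
  show "(LINT (x, y)|lebesgue. (u x - u y) * (v x - v y) / norm (x - y) powr (real CARD('n) + 2 * s)) =
      (LINT p|lborel2. fdq s u p * fdq s v p)"
    unfolding f_eq integral_completion[OF f_lborel] eq[symmetric] by (simp only: lborel_prod)
qed

subsection \<open>Compactness in \<open>L\<^sup>1\<close>\<close>

lemma C1c_integrable_abs: "v \<in> C1c \<Omega> \<Longrightarrow> integrable lborel (\<lambda>x. \<bar>v x\<bar>)"
  using C1c_integrable by auto

text \<open>A form of Young's inequality. The free weight \<tau> takes over the role of
  Cauchy-Schwarz on bounded sets.\<close>

lemma abs_le_weighted: "\<tau> > 0 \<Longrightarrow> \<bar>a\<bar> \<le> \<tau> + a\<^sup>2 / \<tau>" for a \<tau> :: real
proof (cases "\<bar>a\<bar> \<le> \<tau>")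
  case False
  assume "\<tau> > 0"
  then have "\<bar>a\<bar> * \<tau> \<le> \<bar>a\<bar> * \<bar>a\<bar>"
    using False by (intro mult_left_mono) auto
  then show ?thesis
    using \<open>\<tau> > 0\<close> by (simp add: field_simps power2_eq_square add_increasing)
qed (simp add: add_increasing2)

lemma L1_le_L2:
  fixes w :: "real ^ 'n::finite \<Rightarrow> real"
  assumes w: "w \<in> L2 lborel" and supp: "AE x in lborel. x \<notin> cball 0 R \<longrightarrow> w x = 0"
  shows "integrable lborel w"
    and "\<tau> > 0 \<Longrightarrow> (LINT x|lborel. \<bar>w x\<bar>) \<le> \<tau> * measure lborel (cball (0::real ^ 'n) R) + (LINT x|lborel. (w x)\<^sup>2) / \<tau>"
proof -
  have sq: "integrable lborel (\<lambda>x. (w x)\<^sup>2)"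
    using L2_integrable_norm_sq[OF w] by simp
  have ind: "integrable lborel (indicator (cball (0::real ^ 'n) R) :: real ^ 'n \<Rightarrow> real)"
    using emeasure_bounded_finite[OF bounded_cball, of "0 :: real ^ 'n" R]
    by (intro integrable_real_indicator) auto
  let ?b = "\<lambda>\<tau> x. \<tau> * indicator (cball 0 R) x + (w x)\<^sup>2 / \<tau>"
  have int: "integrable lborel (?b \<tau>)" for \<tau>
    by (intro Bochner_Integration.integrable_add integrable_mult_right integrable_divide sq ind)
  have bound: "AE x in lborel. \<bar>w x\<bar> \<le> ?b \<tau> x" if "\<tau> > 0" for \<tau>
    using supp
  proof eventually_elim
    case (elim x)
    then show ?case
      using abs_le_weighted[OF that, of "w x"] that by (cases "x \<in> cball 0 R") auto
  qed
  have "AE x in lborel. norm (w x) \<le> norm (?b 1 x)"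
    using bound[of 1] by (auto elim!: eventually_mono)
  with int[of 1] L2_measurable[OF w] show int_w: "integrable lborel w"
    by (rule Bochner_Integration.integrable_bound)
  assume "\<tau> > 0"
  have "(LINT x|lborel. \<bar>w x\<bar>) \<le> (LINT x|lborel. ?b \<tau> x)"
    using int_w by (intro integral_mono_AE int bound[OF \<open>\<tau> > 0\<close>]) auto
  also have "\<dots> = \<tau> * measure lborel (cball (0::real ^ 'n) R) + (LINT x|lborel. (w x)\<^sup>2) / \<tau>"
    using sq ind by (subst Bochner_Integration.integral_add) auto
  finally show "(LINT x|lborel. \<bar>w x\<bar>) \<le> \<tau> * measure lborel (cball (0::real ^ 'n) R) + (LINT x|lborel. (w x)\<^sup>2) / \<tau>" .
qed

lemma C1c_L1_le:
  fixes v :: "real ^ 'n::finite \<Rightarrow> real"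
  assumes v: "v \<in> C1c \<Omega>" and \<Omega>: "\<Omega> \<subseteq> cball 0 R" and \<tau>: "\<tau> > 0"
  shows "(LINT x|lborel. \<bar>v x\<bar>) \<le> \<tau> * measure lborel (cball (0::real ^ 'n) R) + (LINT x|lborel. (v x)\<^sup>2) / \<tau>"
  using C1c_eq_0[OF v] \<Omega> by (intro L1_le_L2(2)[OF C1c_L2(1)[OF v] _ \<tau>] AE_I2) blast

text \<open>On a ball of the cover containing \<open>x\<close>, the value \<open>w x\<close> is the
  average of \<open>w\<close> plus the average of \<open>w x - w y\<close>. Points of one ball
  differ by less than \<open>2 * \<epsilon>\<close>, so the translation estimate controls the second
  average. The factor \<open>2 ^ CARD('n)\<close> is the volume ratio of balls of radius
  \<open>2 * \<epsilon>\<close> and \<epsilon>.\<close>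

lemma C1c_L1_le_averages:
  fixes w :: "real ^ 'n::finite \<Rightarrow> real"
  assumes w: "w \<in> C1c \<Omega>" and \<Omega>: "\<Omega> \<subseteq> cball 0 R" and \<epsilon>: "\<epsilon> > 0"
    and T: "finite T" "\<Omega> \<subseteq> (\<Union>c\<in>T. ball c \<epsilon>)"
  defines "V \<equiv> measure lborel (cball (0::real ^ 'n) R)"
    and "\<beta> \<equiv> unit_ball_vol (real CARD('n)) * \<epsilon> ^ CARD('n)"
  shows "(LINT x|lborel. \<bar>w x\<bar>) \<le>
    2 ^ CARD('n) * (2 * \<epsilon>) * (V + dirichlet w) +
    V / \<beta> * (\<Sum>c\<in>T. \<bar>LINT x|lborel. indicator (ball c \<epsilon>) x * w x\<bar>)"
proof -
  define D where "D = dirichlet w"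
  define S where "S = (\<Sum>c\<in>T. \<bar>LINT x|lborel. indicator (ball c \<epsilon>) x * w x\<bar>)"
  have nonneg: "D \<ge> 0" "S \<ge> 0" "V \<ge> 0"
    by (auto simp: D_def S_def V_def intro: sum_nonneg)
  have \<beta>: "\<beta> > 0"
    using \<epsilon> by (simp add: \<beta>_def)
  have ball: "emeasure lborel (ball (c :: real ^ 'n) \<epsilon>) = ennreal \<beta>" for c
    using \<epsilon> by (simp add: emeasure_ball \<beta>_def)
  have ball2: "emeasure lborel (ball (c :: real ^ 'n) (2 * \<epsilon>)) = ennreal (2 ^ CARD('n) * \<beta>)" for c
    using \<epsilon> by (simp add: emeasure_ball \<beta>_def power_mult_distrib mult_ac)
  have [measurable]: "w \<in> borel_measurable borel"
    by (rule C1c_borel[OF w])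
  have int_w: "integrable lborel w"
    by (rule C1c_integrable[OF w])
  have int_ind: "integrable lborel (\<lambda>y. indicator (ball c \<epsilon>) y * w y)" for c
    using integrable_mult_indicator[OF _ int_w, of "ball c \<epsilon>"] by simp
  let ?h = "\<lambda>x z. indicator (cball 0 R) x * (indicator (ball 0 (2 * \<epsilon>)) z * ennreal \<bar>w (x + z) - w x\<bar>)"
  have pointwise: "ennreal \<beta> * ennreal \<bar>w x\<bar> \<le> (\<integral>\<^sup>+z. ?h x z \<partial>lborel) + ennreal S * indicator (cball 0 R) x" for x
  proof (cases "x \<in> \<Omega>")
    case False
    then show ?thesis
      using C1c_eq_0[OF w] by simp
  next
    case True
    then obtain c where c: "c \<in> T" "x \<in> ball c \<epsilon>"
      using T by auto
    define I where "I = (LINT y|lborel. indicator (ball c \<epsilon>) y * w y)"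
    have int_c: "integrable lborel (\<lambda>y. indicator (ball c \<epsilon>) y * w x)"
      by (rule integrable_mult_left) (simp add: ball)
    have "\<beta> * w x = (LINT y|lborel. indicator (ball c \<epsilon>) y * w x)"
      using \<beta> by (simp add: measure_def ball)
    also have "\<dots> = (LINT y|lborel. indicator (ball c \<epsilon>) y * (w x - w y)) + I"
      unfolding I_def using int_c int_ind[of c]
      by (subst Bochner_Integration.integral_add[symmetric]) (auto simp: algebra_simps)
    finally have "\<bar>\<beta> * w x\<bar> \<le> \<bar>LINT y|lborel. indicator (ball c \<epsilon>) y * (w x - w y)\<bar> + \<bar>I\<bar>"
      by linarith
    also have "\<bar>I\<bar> \<le> S"
      unfolding S_def I_def using c T by (intro member_le_sum) auto
    finally have "ennreal (\<beta> * \<bar>w x\<bar>) \<le> ennreal (\<bar>LINT y|lborel. indicator (ball c \<epsilon>) y * (w x - w y)\<bar> + S)"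
      using \<beta> by (intro ennreal_leI) (simp add: abs_mult)
    also have "\<dots> = ennreal \<bar>LINT y|lborel. indicator (ball c \<epsilon>) y * (w x - w y)\<bar> + ennreal S"
      using nonneg by simp
    also have "ennreal \<bar>LINT y|lborel. indicator (ball c \<epsilon>) y * (w x - w y)\<bar> \<le>
        (\<integral>\<^sup>+y. ennreal \<bar>indicator (ball c \<epsilon>) y * (w x - w y)\<bar> \<partial>lborel)"
    proof -
      have "integrable lborel (\<lambda>y. indicator (ball c \<epsilon>) y * (w x - w y))"
        using Bochner_Integration.integrable_diff[OF int_c int_ind[of c]] by (simp add: algebra_simps)
      from integral_norm_bound_ennreal[OF this] show ?thesis
        by simp
    qed
    also have "\<dots> \<le> (\<integral>\<^sup>+y. indicator (ball 0 (2 * \<epsilon>)) (y - x) * ennreal \<bar>w (x + (y - x)) - w x\<bar> \<partial>lborel)"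
    proof (rule nn_integral_mono)
      fix y
      show "ennreal \<bar>indicator (ball c \<epsilon>) y * (w x - w y)\<bar> \<le>
          indicator (ball 0 (2 * \<epsilon>)) (y - x) * ennreal \<bar>w (x + (y - x)) - w x\<bar>"
      proof (cases "y \<in> ball c \<epsilon>")
        case True
        have "dist y x < \<epsilon> + \<epsilon>"
          using True c(2) dist_triangle[of y x c] by (simp add: dist_commute)
        then have "y - x \<in> ball 0 (2 * \<epsilon>)"
          by (simp add: dist_norm norm_minus_commute)
        then show ?thesis
          using True by (simp add: abs_minus_commute)
      qed simp
    qed
    also have "\<dots> = (\<integral>\<^sup>+z. indicator (ball 0 (2 * \<epsilon>)) z * ennreal \<bar>w (x + z) - w x\<bar> \<partial>lborel)"
      using nn_integral_lborel_translate[of "\<lambda>z. indicator (ball 0 (2 * \<epsilon>)) z * ennreal \<bar>w (x + z) - w x\<bar>" "- x"]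
      by simp
    finally show ?thesis
      using True \<Omega> \<beta> by (auto simp: ennreal_mult subset_eq)
  qed
  have "ennreal \<beta> * ennreal (LINT x|lborel. \<bar>w x\<bar>) = (\<integral>\<^sup>+x. ennreal \<beta> * ennreal \<bar>w x\<bar> \<partial>lborel)"
    using C1c_integrable_abs[OF w] by (simp add: nn_integral_cmult nn_integral_eq_integral)
  also have "\<dots> \<le> (\<integral>\<^sup>+x. (\<integral>\<^sup>+z. ?h x z \<partial>lborel) + ennreal S * indicator (cball 0 R) x \<partial>lborel)"
    by (intro nn_integral_mono pointwise)
  also have "\<dots> = (\<integral>\<^sup>+x. \<integral>\<^sup>+z. ?h x z \<partial>lborel \<partial>lborel) + ennreal S * emeasure lborel (cball (0::real ^ 'n) R)"
    by (subst nn_integral_add) (auto simp: nn_integral_cmult_indicator)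
  also have "(\<integral>\<^sup>+x. \<integral>\<^sup>+z. ?h x z \<partial>lborel \<partial>lborel) = (\<integral>\<^sup>+z. \<integral>\<^sup>+x. ?h x z \<partial>lborel \<partial>lborel)"
    by (rule lborel_pair.Fubini'[symmetric]) measurable
  also have "\<dots> \<le> (\<integral>\<^sup>+z. ennreal (2 * \<epsilon> * (V + D)) * indicator (ball (0::real ^ 'n) (2 * \<epsilon>)) z \<partial>lborel)"
  proof (rule nn_integral_mono)
    fix z :: "real ^ 'n"
    show "(\<integral>\<^sup>+x. ?h x z \<partial>lborel) \<le> ennreal (2 * \<epsilon> * (V + D)) * indicator (ball (0::real ^ 'n) (2 * \<epsilon>)) z"
    proof (cases "z \<in> ball 0 (2 * \<epsilon>)")
      case True
      then have z: "norm z \<le> 2 * \<epsilon>"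
        by simp
      have "(\<integral>\<^sup>+x. ?h x z \<partial>lborel) \<le> (\<integral>\<^sup>+x. ennreal (2 * \<epsilon>) * indicator (cball 0 R) x +
          ennreal (1 / (2 * \<epsilon>)) * ennreal ((w (x + z) - w x)\<^sup>2) \<partial>lborel)"
      proof (rule nn_integral_mono)
        fix x
        \<comment> \<open>With the weight \<open>2 * \<epsilon>\<close>, equal to the bound on
          \<open>norm z\<close>, the volume term and the gradient term receive the same factor
          \<open>2 * \<epsilon>\<close>.\<close>
        have "\<bar>w (x + z) - w x\<bar> \<le> 2 * \<epsilon> + 1 / (2 * \<epsilon>) * (w (x + z) - w x)\<^sup>2"
          using abs_le_weighted[of "2 * \<epsilon>" "w (x + z) - w x"] \<epsilon> by simp
        then have "ennreal \<bar>w (x + z) - w x\<bar> \<le> ennreal (2 * \<epsilon> + 1 / (2 * \<epsilon>) * (w (x + z) - w x)\<^sup>2)"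
          by (rule ennreal_leI)
        also have "\<dots> = ennreal (2 * \<epsilon>) + ennreal (1 / (2 * \<epsilon>)) * ennreal ((w (x + z) - w x)\<^sup>2)"
        proof -
          have *: "ennreal (a + b * c) = ennreal a + ennreal b * ennreal c" if "a \<ge> 0" "b \<ge> 0" "c \<ge> 0" for a b c
            using that by (simp add: ennreal_mult)
          show ?thesis
            by (rule *) (use \<epsilon> in auto)
        qed
        finally show "?h x z \<le> ennreal (2 * \<epsilon>) * indicator (cball 0 R) x +
          ennreal (1 / (2 * \<epsilon>)) * ennreal ((w (x + z) - w x)\<^sup>2)"
          using True by (auto simp: indicator_def)
      qed
      also have "\<dots> = ennreal (2 * \<epsilon>) * emeasure lborel (cball (0::real ^ 'n) R) +
          ennreal (1 / (2 * \<epsilon>)) * (\<integral>\<^sup>+x. ennreal ((w (x + z) - w x)\<^sup>2) \<partial>lborel)"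
        by (subst nn_integral_add) (auto simp: nn_integral_cmult_indicator nn_integral_cmult)
      also have "emeasure lborel (cball (0::real ^ 'n) R) = ennreal V"
        unfolding V_def by (rule emeasure_eq_ennreal_measure) (use emeasure_bounded_finite[OF bounded_cball, of "0 :: real ^ 'n" R] in auto)
      also have "(\<integral>\<^sup>+x. ennreal ((w (x + z) - w x)\<^sup>2) \<partial>lborel) \<le> ennreal ((2 * \<epsilon>)\<^sup>2 * D)"
      proof -
        have "(\<integral>\<^sup>+x. ennreal ((w (x + z) - w x)\<^sup>2) \<partial>lborel) \<le>
            ennreal ((norm z)\<^sup>2) * (\<integral>\<^sup>+x. ennreal ((norm (grad w x))\<^sup>2) \<partial>lborel)"
          by (rule C1c_translation_nn[OF w])
        also have "(\<integral>\<^sup>+x. ennreal ((norm (grad w x))\<^sup>2) \<partial>lborel) = ennreal D"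
          using L2_integrable_norm_sq[OF C1c_L2(2)[OF w]] by (simp add: D_def nn_integral_eq_integral)
        also have "ennreal ((norm z)\<^sup>2) * ennreal D = ennreal ((norm z)\<^sup>2 * D)"
          using nonneg by (simp add: ennreal_mult)
        also have "\<dots> \<le> ennreal ((2 * \<epsilon>)\<^sup>2 * D)"
          using z nonneg by (intro ennreal_leI mult_right_mono power_mono) auto
        finally show ?thesis .
      qed
      also have "ennreal (2 * \<epsilon>) * ennreal V + ennreal (1 / (2 * \<epsilon>)) * ennreal ((2 * \<epsilon>)\<^sup>2 * D) =
          ennreal (2 * \<epsilon> * V + 1 / (2 * \<epsilon>) * ((2 * \<epsilon>)\<^sup>2 * D))"
        using \<epsilon> nonneg by (subst ennreal_plus) (auto simp: ennreal_mult[symmetric])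
      also have "2 * \<epsilon> * V + 1 / (2 * \<epsilon>) * ((2 * \<epsilon>)\<^sup>2 * D) = 2 * \<epsilon> * (V + D)"
        using \<epsilon> by (simp add: field_simps power2_eq_square)
      finally show ?thesis
        using True by (simp add: mult_left_mono add_left_mono)
    qed simp
  qed
  also have "\<dots> = ennreal (2 * \<epsilon> * (V + D)) * ennreal (2 ^ CARD('n) * \<beta>)"
    by (simp add: nn_integral_cmult_indicator ball2)
  also have "emeasure lborel (cball (0::real ^ 'n) R) = ennreal V"
    unfolding V_def by (rule emeasure_eq_ennreal_measure) (use emeasure_bounded_finite[OF bounded_cball, of "0 :: real ^ 'n" R] in auto)
  also have "ennreal (2 * \<epsilon> * (V + D)) * ennreal (2 ^ CARD('n) * \<beta>) + ennreal S * ennreal V =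
      ennreal (2 * \<epsilon> * (V + D) * (2 ^ CARD('n) * \<beta>) + S * V)"
    using \<epsilon> \<beta> nonneg by (subst ennreal_plus) (auto simp: ennreal_mult[symmetric])
  finally have "ennreal \<beta> * ennreal (LINT x|lborel. \<bar>w x\<bar>) \<le>
      ennreal (2 * \<epsilon> * (V + D) * (2 ^ CARD('n) * \<beta>) + S * V)"
    by (simp add: add_right_mono)
  then have "\<beta> * (LINT x|lborel. \<bar>w x\<bar>) \<le> 2 * \<epsilon> * (V + D) * (2 ^ CARD('n) * \<beta>) + S * V"
    using \<epsilon> \<beta> nonneg by (simp add: ennreal_mult[symmetric] ennreal_le_iff del: ennreal_plus)
  also have "\<dots> = \<beta> * (2 ^ CARD('n) * (2 * \<epsilon>) * (V + D) + V / \<beta> * S)"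
    using \<beta> by (simp add: field_simps)
  finally show ?thesis
    using \<beta> unfolding D_def S_def by (simp only: mult_le_cancel_left_pos)
qed

lemma dirichlet_diff_le:
  assumes u: "u \<in> C1c \<Omega>" and v: "v \<in> C1c \<Omega>"
  shows "dirichlet (\<lambda>x. u x - v x) \<le>
    2 * dirichlet u + 2 * dirichlet v"
proof -
  note int = L2_integrable_norm_sq[OF C1c_L2(2)[OF u]] L2_integrable_norm_sq[OF C1c_L2(2)[OF v]]
  have "dirichlet (\<lambda>x. u x - v x) \<le>
      (LINT x|lborel. 2 * (norm (grad u x))\<^sup>2 + 2 * (norm (grad v x))\<^sup>2)"
  proof (rule integral_mono)
    show "(norm (grad (\<lambda>x. u x - v x) x))\<^sup>2 \<le> 2 * (norm (grad u x))\<^sup>2 + 2 * (norm (grad v x))\<^sup>2" for x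
      using zero_le_power2[of "norm (grad u x + grad v x)"]
      by (simp add: C1c_diff(2)[OF u v] power2_norm_eq_inner inner_add inner_diff inner_commute)
    show "integrable lborel (\<lambda>x. (norm (grad (\<lambda>x. u x - v x) x))\<^sup>2)"
      by (rule L2_integrable_norm_sq[OF C1c_L2(2)[OF C1c_diff(1)[OF u v]]])
  qed (use int in auto)
  also have "\<dots> = 2 * dirichlet u + 2 * dirichlet v"
    using int by simp
  finally show ?thesis .
qed

text \<open>A Rellich theorem in Cauchy form. For every mesh \<open>\<epsilon> k\<close> finitely
  many balls cover \<Omega>; in total there are countably many averages, and one diagonal
  subsequence makes all of them converge. \<open>C1c_L1_le_averages\<close>, applied to differences,
  then gives smallness in L^1.\<close>

lemma L1_compactness:
  fixes u :: "nat \<Rightarrow> real ^ 'n::finite \<Rightarrow> real"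
  assumes \<Omega>: "bounded \<Omega>" and u: "\<And>n. u n \<in> C1c \<Omega>"
    and B: "\<And>n. dirichlet (u n) \<le> B"
  obtains r where "strict_mono (r :: nat \<Rightarrow> nat)"
    "\<And>e. e > 0 \<Longrightarrow> \<exists>N. \<forall>m\<ge>N. \<forall>n\<ge>N. (LINT x|lborel. \<bar>u (r m) x - u (r n) x\<bar>) < e"
proof -
  obtain R where R: "\<Omega> \<subseteq> cball 0 R"
    using \<Omega> by (auto simp: bounded_iff subset_eq)
  obtain P where P: "P > 0" "\<And>v. v \<in> C1c \<Omega> \<Longrightarrow>
      (LINT x|lborel. (v x)\<^sup>2) \<le> P * dirichlet v"
    using Poincare_inequality[OF \<Omega>] by blast
  define V where "V = measure lborel (cball (0::real ^ 'n) R)"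
  have "V \<ge> 0"
    by (simp add: V_def)
  have "B \<ge> 0"
    using B[of 0] by (rule order_trans[rotated]) simp
  define \<epsilon> where "\<epsilon> k = inverse (real (Suc k))" for k
  have \<epsilon>: "\<epsilon> k > 0" for k
    by (simp add: \<epsilon>_def)
  have "\<forall>k. \<exists>T. finite T \<and> closure \<Omega> \<subseteq> (\<Union>c\<in>T. ball c (\<epsilon> k))"
    using compact_closure[of \<Omega>] \<Omega> \<epsilon> unfolding compact_eq_totally_bounded by blast
  then obtain T where T: "\<And>k. finite (T k)" "\<And>k. closure \<Omega> \<subseteq> (\<Union>c\<in>T k. ball c (\<epsilon> k))"
    by metis
  define S where "S = Sigma UNIV T"
  define f where "f n = (\<lambda>(k, c). LINT x|lborel. indicator (ball c (\<epsilon> k)) x * u n x)" for n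
  have "countable S"
    unfolding S_def using T(1) by (intro countable_SIGMA) (auto intro: countable_finite)
  \<comment> \<open>Diagonal extraction needs one bound for all averages; it is the L^1 bound with
    weight 1 combined with the Poincare inequality.\<close>
  moreover have "norm (f n p) \<le> V + P * B" for n p
  proof -
    obtain k c where p: "p = (k, c)"
      by (cases p)
    have "norm (f n p) \<le> (LINT x|lborel. norm (indicator (ball c (\<epsilon> k)) x * u n x))"
      unfolding p f_def by (simp only: prod.case integral_norm_bound)
    also have "\<dots> \<le> (LINT x|lborel. \<bar>u n x\<bar>)"
      using C1c_integrable_abs[OF u]
      by (intro integral_mono') (auto simp: indicator_def)
    also have "\<dots> \<le> 1 * V + (LINT x|lborel. (u n x)\<^sup>2) / 1"
      unfolding V_def by (rule C1c_L1_le[OF u R]) simp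
    also have "(LINT x|lborel. (u n x)\<^sup>2) / 1 \<le> P * B"
      using P(2)[OF u, of n] mult_left_mono[OF B[of n], of P] P(1) by linarith
    finally show ?thesis by simp
  qed
  ultimately obtain r where r: "strict_mono (r :: nat \<Rightarrow> nat)" "\<And>p. p \<in> S \<Longrightarrow> \<exists>l. (\<lambda>n. f (r n) p) \<longlonglongrightarrow> l"
    using function_convergent_subsequence[of S f "V + P * B"] by metis
  have "\<exists>N. \<forall>m\<ge>N. \<forall>n\<ge>N. (LINT x|lborel. \<bar>u (r m) x - u (r n) x\<bar>) < e" if "e > 0" for e
  proof -
    \<comment> \<open>The gradient energy of a difference is at most \<open>4 * B\<close>, so
      \<open>A * \<epsilon> k\<close> bounds the first term of the averages estimate.\<close>
    define A where "A = 2 ^ CARD('n) * 2 * (V + 4 * B)"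
    have "A \<ge> 0"
      using \<open>V \<ge> 0\<close> \<open>B \<ge> 0\<close> by (simp add: A_def)
    obtain k where k: "inverse (real (Suc k)) < e / (2 * (A + 1))"
      using reals_Archimedean[of "e / (2 * (A + 1))"] \<open>e > 0\<close> \<open>A \<ge> 0\<close> by auto
    then have "A * \<epsilon> k \<le> A * (e / (2 * (A + 1)))"
      unfolding \<epsilon>_def using \<open>A \<ge> 0\<close> by (intro mult_left_mono) auto
    also have "\<dots> < e / 2"
      using \<open>A \<ge> 0\<close> \<open>e > 0\<close> by (simp add: field_simps)
    finally have first: "A * \<epsilon> k < e / 2" .
    define \<beta> where "\<beta> = unit_ball_vol (real CARD('n)) * \<epsilon> k ^ CARD('n)"
    have \<beta>: "\<beta> > 0"
      using \<epsilon>[of k] by (simp add: \<beta>_def)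
    \<comment> \<open>Chosen so that the sum over all averages contributes at most
      \<open>e / 2\<close>; the added ones keep the denominator positive.\<close>
    define \<eta> where "\<eta> = e / 2 / ((V / \<beta> + 1) * (real (card (T k)) + 1))"
    have "\<eta> > 0"
      unfolding \<eta>_def using \<open>V \<ge> 0\<close> \<beta> \<open>e > 0\<close>
      by (intro divide_pos_pos mult_pos_pos add_nonneg_pos divide_nonneg_pos) auto
    have "\<forall>c\<in>T k. \<exists>N. \<forall>m\<ge>N. \<forall>n\<ge>N. \<bar>f (r m) (k, c) - f (r n) (k, c)\<bar> < \<eta>"
    proof
      fix c
      assume "c \<in> T k"
      then have "Cauchy (\<lambda>n. f (r n) (k, c))"
        using r(2)[of "(k, c)"] by (auto simp: S_def intro: LIMSEQ_imp_Cauchy)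
      then show "\<exists>N. \<forall>m\<ge>N. \<forall>n\<ge>N. \<bar>f (r m) (k, c) - f (r n) (k, c)\<bar> < \<eta>"
        using \<open>\<eta> > 0\<close> unfolding Cauchy_def dist_real_def by blast
    qed
    then obtain N where N: "\<And>c m n. c \<in> T k \<Longrightarrow> m \<ge> N c \<Longrightarrow> n \<ge> N c \<Longrightarrow> \<bar>f (r m) (k, c) - f (r n) (k, c)\<bar> < \<eta>"
      by metis
    have "(LINT x|lborel. \<bar>u (r m) x - u (r n) x\<bar>) < e"
      if mn: "m \<ge> Max (insert 0 (N ` T k))" "n \<ge> Max (insert 0 (N ` T k))" for m n
    proof -
      let ?w = "\<lambda>x. u (r m) x - u (r n) x"
      define D where "D = dirichlet ?w"
      have w: "?w \<in> C1c \<Omega>"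
        by (rule C1c_diff(1)[OF u u])
      have "D \<le> 4 * B"
        unfolding D_def using dirichlet_diff_le[OF u u, of "r m" "r n"] B[of "r m"] B[of "r n"] by linarith
      have avg: "\<bar>LINT x|lborel. indicator (ball c (\<epsilon> k)) x * ?w x\<bar> \<le> \<eta>" if c: "c \<in> T k" for c
      proof -
        have int: "integrable lborel (\<lambda>x. indicator (ball c (\<epsilon> k)) x * u j x)" for j
          using integrable_mult_indicator[OF _ C1c_integrable[OF u[of j]], of "ball c (\<epsilon> k)"] by simp
        have "(LINT x|lborel. indicator (ball c (\<epsilon> k)) x * ?w x) = f (r m) (k, c) - f (r n) (k, c)"
          by (simp add: f_def right_diff_distrib int)
        moreover have "m \<ge> N c" "n \<ge> N c"
          using mn c T(1)[of k] by auto
        ultimately show ?thesis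
          using N[OF c] by (simp add: less_imp_le)
      qed
      have "(LINT x|lborel. \<bar>?w x\<bar>) \<le> 2 ^ CARD('n) * (2 * \<epsilon> k) * (V + D) +
          V / \<beta> * (\<Sum>c\<in>T k. \<bar>LINT x|lborel. indicator (ball c (\<epsilon> k)) x * ?w x\<bar>)"
        unfolding V_def D_def \<beta>_def
        by (rule C1c_L1_le_averages[OF w R \<epsilon> T(1)]) (use T(2)[of k] closure_subset[of \<Omega>] in blast)
      moreover have "2 ^ CARD('n) * (2 * \<epsilon> k) * (V + D) \<le> A * \<epsilon> k"
      proof -
        have "2 ^ CARD('n) * (2 * \<epsilon> k) * (V + D) \<le> 2 ^ CARD('n) * (2 * \<epsilon> k) * (V + 4 * B)"
          using \<open>D \<le> 4 * B\<close> \<epsilon>[of k] by (intro mult_left_mono) auto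
        then show ?thesis
          by (simp add: A_def mult_ac)
      qed
      moreover have "V / \<beta> * (\<Sum>c\<in>T k. \<bar>LINT x|lborel. indicator (ball c (\<epsilon> k)) x * ?w x\<bar>)
          \<le> V / \<beta> * (real (card (T k)) * \<eta>)"
        using \<open>V \<ge> 0\<close> \<beta> by (intro mult_left_mono sum_bounded_above avg) auto
      moreover have "V / \<beta> * (real (card (T k)) * \<eta>) \<le> (V / \<beta> + 1) * ((real (card (T k)) + 1) * \<eta>)"
        using \<open>V \<ge> 0\<close> \<beta> \<open>\<eta> > 0\<close> by (intro mult_mono) auto
      moreover have "(V / \<beta> + 1) * ((real (card (T k)) + 1) * \<eta>) = e / 2"
      proof -
        have "V / \<beta> + 1 > 0"
          using \<open>V \<ge> 0\<close> \<beta> by (intro add_nonneg_pos) auto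
        moreover have "a * (b * (e / 2 / (a * b))) = e / 2" if "a > 0" "b > 0" for a b
          using that by simp
        ultimately show ?thesis
          unfolding \<eta>_def by (meson add_nonneg_pos of_nat_0_le_iff zero_less_one)
      qed
      ultimately show ?thesis
        using first by linarith
    qed
    then show ?thesis by blast
  qed
  with r(1) show ?thesis
    by (rule that)
qed

subsection \<open>Bounded nonlinearities and their primitives\<close>

text \<open>The conditions hold at every \<open>x\<close>, not merely almost everywhere: the
  instance used later is set to 0 on an exceptional null set and outside \<Omega>.\<close>

locale bounded_nonlinearity =
  fixes F :: "real ^ 'n::finite \<Rightarrow> real \<Rightarrow> real" and M \<epsilon> :: real
  assumes F_measurable: "\<And>t. (\<lambda>x. F x t) \<in> borel_measurable lebesgue"
    and F_continuous: "\<And>x. continuous_on UNIV (F x)"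
    and F_bound: "\<And>x t. \<bar>F x t\<bar> \<le> M"
    and F_upper: "\<And>x t. t \<ge> 0 \<Longrightarrow> F x t \<le> \<epsilon>"
    and F_lower: "\<And>x t. t \<le> 0 \<Longrightarrow> - \<epsilon> \<le> F x t"
    and \<epsilon>_pos: "\<epsilon> > 0"
begin

text \<open>The primitive of \<open>F x\<close> from 0 to \<open>t\<close>, rescaled to the unit
  interval: the domain of integration depends neither on \<open>t\<close> nor on its sign, so
  measurability in \<open>x\<close> follows from that of a parametric integral.\<close>

definition \<Phi> :: "real ^ 'n \<Rightarrow> real \<Rightarrow> real" where
  "\<Phi> x t = (LINT \<sigma>|lborel. (t * F x (\<sigma> * t)) * indicator {0..1} \<sigma>)"

text \<open>Rounding \<open>g\<close> down to multiples of \<open>1 / real (Suc n)\<close> leaves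
  countably many values, for which measurability at fixed \<open>t\<close> suffices; continuity in
  \<open>t\<close> passes to the limit. The map \<open>h\<close> allows points of a product space,
  as needed for \<Phi>.\<close>

lemma F_comp_measurable:
  assumes h: "h \<in> measurable N lebesgue" and [measurable]: "g \<in> borel_measurable N"
  shows "(\<lambda>p. F (h p) (g p)) \<in> borel_measurable N"
proof (rule borel_measurable_LIMSEQ_real)
  fix p
  have "(\<lambda>n. of_int \<lfloor>real (Suc n) * g p\<rfloor> / real (Suc n)) \<longlonglongrightarrow> g p"
  proof (rule real_tendsto_sandwich)
    show "\<forall>\<^sub>F n in sequentially. g p - inverse (real (Suc n)) \<le> of_int \<lfloor>real (Suc n) * g p\<rfloor> / real (Suc n)"
    proof (rule always_eventually, rule allI)
      fix n
      have "real (Suc n) * g p - 1 \<le> of_int \<lfloor>real (Suc n) * g p\<rfloor>"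
        by linarith
      then have "(real (Suc n) * g p - 1) / real (Suc n) \<le> of_int \<lfloor>real (Suc n) * g p\<rfloor> / real (Suc n)"
        by (rule divide_right_mono) simp
      moreover have "(real (Suc n) * g p - 1) / real (Suc n) = g p - inverse (real (Suc n))"
        by (simp add: field_simps del: of_nat_Suc)
      ultimately show "g p - inverse (real (Suc n)) \<le> of_int \<lfloor>real (Suc n) * g p\<rfloor> / real (Suc n)"
        by simp
    qed
    show "\<forall>\<^sub>F n in sequentially. of_int \<lfloor>real (Suc n) * g p\<rfloor> / real (Suc n) \<le> g p"
    proof (rule always_eventually, rule allI)
      fix n
      have "of_int \<lfloor>real (Suc n) * g p\<rfloor> \<le> real (Suc n) * g p"
        by linarith
      then show "of_int \<lfloor>real (Suc n) * g p\<rfloor> / real (Suc n) \<le> g p"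
        by (simp add: field_simps del: of_nat_Suc)
    qed
    show "(\<lambda>n. g p - inverse (real (Suc n))) \<longlonglongrightarrow> g p"
      using tendsto_diff[OF tendsto_const LIMSEQ_inverse_real_of_nat, of "g p"] by simp
  qed simp
  then show "(\<lambda>n. F (h p) (of_int \<lfloor>real (Suc n) * g p\<rfloor> / real (Suc n))) \<longlonglongrightarrow> F (h p) (g p)"
    by (rule continuous_on_tendsto_compose[OF F_continuous]) auto
next
  fix n
  show "(\<lambda>p. F (h p) (of_int \<lfloor>real (Suc n) * g p\<rfloor> / real (Suc n))) \<in> borel_measurable N"
  proof (rule measurable_compose_countable[where f = "\<lambda>i p. F (h p) (of_int i / real (Suc n))"
        and g = "\<lambda>p. \<lfloor>real (Suc n) * g p\<rfloor>"])
    show "(\<lambda>p. F (h p) (of_int i / real (Suc n))) \<in> borel_measurable N" for i :: int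
      by (rule measurable_compose[OF h F_measurable])
    show "(\<lambda>p. \<lfloor>real (Suc n) * g p\<rfloor>) \<in> measurable N (count_space UNIV)"
      by measurable
  qed
qed

lemma \<Phi>_measurable:
  assumes [measurable]: "u \<in> borel_measurable lebesgue"
  shows "(\<lambda>x. \<Phi> x (u x)) \<in> borel_measurable lebesgue"
proof -
  have "(\<lambda>p. F (fst p) (snd p * u (fst p))) \<in> borel_measurable (lebesgue \<Otimes>\<^sub>M lborel)"
    by (intro F_comp_measurable measurable_fst) measurable
  then show ?thesis
    unfolding \<Phi>_def by (intro lborel.borel_measurable_lebesgue_integral) (simp add: case_prod_beta)
qed

text \<open>A continuous \<open>F x\<close> has an antiderivative \<open>A\<close> on the whole
  line, and the chain rule undoes the rescaling: \<open>\<Phi> x t = A t - A 0\<close>.\<close>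

lemma \<Phi>_DERIV: "(\<Phi> x has_real_derivative F x t) (at t)"
proof -
  have cont: "isCont (F x) t" for t
    using F_continuous[of x] by (simp add: continuous_on_eq_continuous_at)
  obtain A where "\<And>t :: real. (A has_vector_derivative F x t) (at t)"
    using einterval_antiderivative[of "-\<infinity>" \<infinity> "F x"] cont by auto
  then have A: "(A has_real_derivative F x t) (at t)" for t
    by (simp add: has_real_derivative_iff_has_vector_derivative)
  have "\<Phi> x t = A (1 * t) - A (0 * t)" for t
    unfolding \<Phi>_def
  proof (rule integral_FTC_Icc_real)
    show "((\<lambda>\<sigma>. A (\<sigma> * t)) has_real_derivative t * F x (\<sigma> * t)) (at \<sigma>)" for \<sigma>
    proof -
      have "((\<lambda>\<sigma>. \<sigma> * t) has_real_derivative t) (at \<sigma>)"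
        by (auto intro!: derivative_eq_intros)
      from DERIV_chain2[OF A this] show ?thesis
        by (simp add: mult.commute)
    qed
    show "isCont (\<lambda>\<sigma>. t * F x (\<sigma> * t)) \<sigma>" for \<sigma>
      by (intro continuous_intros isCont_o2[OF _ cont])
  qed simp
  then have "\<Phi> x = (\<lambda>t. A t - A 0)"
    by auto
  then show ?thesis
    by (auto intro!: derivative_eq_intros A)
qed

lemma \<Phi>_0 [simp]: "\<Phi> x 0 = 0"
  by (simp add: \<Phi>_def)

lemma \<Phi>_Lipschitz: "\<bar>\<Phi> x a - \<Phi> x b\<bar> \<le> M * \<bar>a - b\<bar>"
  using field_differentiable_bound[of UNIV "\<Phi> x" "F x" M a b] \<Phi>_DERIV F_bound by simp

lemma \<Phi>_bound: "\<bar>\<Phi> x a\<bar> \<le> M * \<bar>a\<bar>"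
  using \<Phi>_Lipschitz[of x a 0] by simp

text \<open>The whole interval from \<open>b\<close> to \<open>a\<close> lies in the range where
  \<open>F x t \<le> \<epsilon>\<close>, so \<open>\<epsilon> * t - \<Phi> x t\<close> is
  nondecreasing there.\<close>

lemma \<Phi>_upper_increment:
  assumes "0 \<le> b" "b \<le> a"
  shows "\<Phi> x a - \<Phi> x b \<le> \<epsilon> * (a - b)"
proof -
  have "\<epsilon> * b - \<Phi> x b \<le> \<epsilon> * a - \<Phi> x a"
  proof (rule DERIV_nonneg_imp_nondecreasing[OF \<open>b \<le> a\<close>])
    fix t
    assume "b \<le> t"
    then have "\<epsilon> - F x t \<ge> 0"
      using F_upper[of t x] assms by simp
    moreover have "((\<lambda>t. \<epsilon> * t - \<Phi> x t) has_real_derivative \<epsilon> - F x t) (at t)"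
      by (auto intro!: derivative_eq_intros \<Phi>_DERIV)
    ultimately show "\<exists>y. ((\<lambda>t. \<epsilon> * t - \<Phi> x t) has_real_derivative y) (at t) \<and> 0 \<le> y"
      by blast
  qed
  then show ?thesis
    by (simp add: algebra_simps)
qed

text \<open>Replacing u by -u exchanges the two one-sided bounds, so estimates from above also yield
  those from below.\<close>

lemma reflected: "bounded_nonlinearity (\<lambda>x t. - F x (- t)) M \<epsilon>"
proof
  show "(\<lambda>x. - F x (- t)) \<in> borel_measurable lebesgue" for t
    using F_measurable by simp
  show "continuous_on UNIV (\<lambda>t. - F x (- t))" for x
    by (intro continuous_intros continuous_on_compose2[OF F_continuous[of x]]) auto
  show "\<bar>- F x (- t)\<bar> \<le> M" for x t
    using F_bound[of x "- t"] by simp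
  show "- F x (- t) \<le> \<epsilon>" if "t \<ge> 0" for x t
    using F_lower[of "- t" x] that by simp
  show "- \<epsilon> \<le> - F x (- t)" if "t \<le> 0" for x t
    using F_upper[of "- t" x] that by simp
qed (rule \<epsilon>_pos)

lemma reflected_\<Phi>: "bounded_nonlinearity.\<Phi> (\<lambda>x t. - F x (- t)) x t = \<Phi> x (- t)"
  unfolding bounded_nonlinearity.\<Phi>_def[OF reflected] \<Phi>_def by simp

lemma \<Phi>_le: "\<Phi> x t \<le> \<epsilon> * \<bar>t\<bar>"
proof (cases "t \<ge> 0")
  case True
  then show ?thesis
    using \<Phi>_upper_increment[of 0 t x] by simp
next
  case False
  then show ?thesis
    using bounded_nonlinearity.\<Phi>_upper_increment[OF reflected, of 0 "- t" x] by (simp add: reflected_\<Phi>)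
qed

lemma \<Phi>_integrable:
  assumes "integrable lborel u"
  shows "integrable lebesgue (\<lambda>x. \<Phi> x (u x))"
proof (rule Bochner_Integration.integrable_bound)
  show "integrable lebesgue (\<lambda>x. M * u x)"
    using assms by (simp add: integrable_completion)
  show "(\<lambda>x. \<Phi> x (u x)) \<in> borel_measurable lebesgue"
    using assms by (intro \<Phi>_measurable measurable_completion) auto
  show "AE x in lebesgue. norm (\<Phi> x (u x)) \<le> norm (M * u x)"
  proof (rule AE_I2)
    fix x
    show "norm (\<Phi> x (u x)) \<le> norm (M * u x)"
      using \<Phi>_bound[of x "u x"] F_bound[of x 0] by (simp add: abs_mult)
  qed
qed

text \<open>This is why compactness in L^1 suffices: the potential is controlled by L^1 distances
  alone.\<close>

lemma \<Phi>_integral_Lipschitz: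
  assumes u: "integrable lborel u" and v: "integrable lborel v"
  shows "\<bar>(LINT x|lebesgue. \<Phi> x (u x)) - (LINT x|lebesgue. \<Phi> x (v x))\<bar> \<le> M * (LINT x|lborel. \<bar>u x - v x\<bar>)"
proof -
  have uv: "integrable lborel (\<lambda>x. \<bar>u x - v x\<bar>)"
    using u v by auto
  have "\<bar>(LINT x|lebesgue. \<Phi> x (u x)) - (LINT x|lebesgue. \<Phi> x (v x))\<bar> =
      \<bar>LINT x|lebesgue. \<Phi> x (u x) - \<Phi> x (v x)\<bar>"
    using \<Phi>_integrable[OF u] \<Phi>_integrable[OF v] by simp
  also have "\<dots> \<le> (LINT x|lebesgue. \<bar>\<Phi> x (u x) - \<Phi> x (v x)\<bar>)"
    by (rule integral_abs_bound)
  also have "\<dots> \<le> (LINT x|lebesgue. M * \<bar>u x - v x\<bar>)"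
  proof (rule integral_mono)
    show "integrable lebesgue (\<lambda>x. M * \<bar>u x - v x\<bar>)"
      using uv by (simp add: integrable_completion borel_measurable_integrable)
    show "integrable lebesgue (\<lambda>x. \<bar>\<Phi> x (u x) - \<Phi> x (v x)\<bar>)"
      using \<Phi>_integrable[OF u] \<Phi>_integrable[OF v] by auto
  qed (rule \<Phi>_Lipschitz)
  also have "\<dots> = M * (LINT x|lborel. \<bar>u x - v x\<bar>)"
    using uv by (simp add: integral_completion borel_measurable_integrable)
  finally show ?thesis .
qed

end

subsection \<open>The energy functional\<close>

lemma AE_lborel_translate:
  fixes N :: "'a::euclidean_space set"
  assumes "N \<in> null_sets lborel"
  shows "AE z in lborel. x + z \<notin> N"
proof -
  have [measurable]: "N \<in> sets borel"
    using assms by (auto simp: null_sets_def)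
  have "(\<integral>\<^sup>+z. indicator N (z + x) \<partial>lborel) = (\<integral>\<^sup>+z. indicator N z \<partial>lborel)"
    by (rule nn_integral_lborel_translate) measurable
  also have "\<dots> = 0"
    using assms by (simp add: null_sets_def)
  finally have "AE z in lborel. indicator N (z + x) = (0 :: ennreal)"
    by (subst (asm) nn_integral_0_iff_AE) auto
  then show ?thesis
    by eventually_elim (auto simp: indicator_def add.commute split: if_splits)
qed

text \<open>Convergence can fail only where \<open>x\<close> or \<open>x + z\<close> lies in the
  exceptional set; the latter happens for a null set of \<open>z\<close>, for each fixed
  \<open>x\<close>.\<close>

lemma fdq_tendsto_AE:
  fixes u :: "nat \<Rightarrow> real ^ 'n::finite \<Rightarrow> real"
  assumes AE: "AE x in lborel. (\<lambda>k. u k x) \<longlonglongrightarrow> v x"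
  shows "AE p in lborel2. (\<lambda>k. fdq s (u k) p) \<longlonglongrightarrow> fdq s v p"
proof -
  obtain N where N: "{x. \<not> (\<lambda>k. u k x) \<longlonglongrightarrow> v x} \<subseteq> N" "N \<in> null_sets lborel"
    using AE by (auto simp: eventually_ae_filter)
  have [measurable]: "N \<in> sets borel"
    using N by (auto simp: null_sets_def)
  have "AE p in lborel2. fst p \<notin> N \<and> fst p + snd p \<notin> N"
  proof (rule lborel_pair.AE_pair_measure)
    show "{p \<in> space lborel2. fst p \<notin> N \<and> fst p + snd p \<notin> N} \<in> sets lborel2"
      by measurable
    show "AE x in lborel. AE z in lborel. fst (x, z) \<notin> N \<and> fst (x, z) + snd (x, z) \<notin> N"
      using AE_not_in[OF N(2)] AE_lborel_translate[OF N(2)] by auto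
  qed
  then show ?thesis
  proof eventually_elim
    case (elim p)
    then have "(\<lambda>k. u k (fst p)) \<longlonglongrightarrow> v (fst p)" "(\<lambda>k. u k (fst p + snd p)) \<longlonglongrightarrow> v (fst p + snd p)"
      using N by auto
    then show ?case
      by (auto simp: fdq_def case_prod_beta intro!: tendsto_intros)
  qed
qed

text \<open>\<open>R\<close>, \<open>P\<close> and \<open>K\<close> are parameters, not obtained
  inside, because \<epsilon> is chosen in terms of them before the truncated nonlinearity
  exists.\<close>

locale energy = bounded_nonlinearity F M \<epsilon>
  for F :: "real ^ 'n::finite \<Rightarrow> real \<Rightarrow> real" and M \<epsilon> :: real +
  fixes s C :: real and \<Omega> :: "(real ^ 'n) set" and R P K :: real
  assumes C: "C \<ge> 0"
    and \<Omega>: "\<Omega> \<subseteq> cball 0 R"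
    and P_pos: "P > 0" and K_pos: "K > 0"
    and Poincare: "\<And>v. v \<in> C1c \<Omega> \<Longrightarrow> (LINT x|lborel. (v x)\<^sup>2) \<le> P * dirichlet v"
    and fdq_L2: "\<And>v :: real ^ 'n \<Rightarrow> real. v \<in> C1c UNIV \<Longrightarrow> fdq s v \<in> L2 lborel2"
    and fdq_le: "\<And>v :: real ^ 'n \<Rightarrow> real. v \<in> C1c UNIV \<Longrightarrow> (LINT p|lborel2. (fdq s v p)\<^sup>2)
      \<le> K * ((LINT x|lborel. (v x)\<^sup>2) + dirichlet v)"
begin

definition D :: "(real ^ 'n \<Rightarrow> real) \<Rightarrow> (real ^ 'n \<Rightarrow> real) \<Rightarrow> real" where
  "D u v = (LINT x|lborel. grad u x \<bullet> grad v x)"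

definition E :: "(real ^ 'n \<Rightarrow> real) \<Rightarrow> (real ^ 'n \<Rightarrow> real) \<Rightarrow> real" where
  "E u v = (LINT p|lborel2. fdq s u p * fdq s v p)"

definition a :: "(real ^ 'n \<Rightarrow> real) \<Rightarrow> (real ^ 'n \<Rightarrow> real) \<Rightarrow> real" where
  "a u v = D u v + C * E u v"

definition potential :: "(real ^ 'n \<Rightarrow> real) \<Rightarrow> real" where
  "potential u = (LINT x|lebesgue. \<Phi> x (u x))"

definition J :: "(real ^ 'n \<Rightarrow> real) \<Rightarrow> real" where
  "J u = a u u / 2 - potential u"

definition vol :: real where
  "vol = measure lborel (cball (0::real ^ 'n) R)"

lemma vol_nonneg: "vol \<ge> 0"
  by (simp add: vol_def)

lemma M_nonneg: "M \<ge> 0"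
  using F_bound[of undefined 0] by simp

lemma D_eq: "D u u = dirichlet u"
  by (simp add: D_def power2_norm_eq_inner)

lemma E_eq: "E u u = (LINT p|lborel2. (fdq s u p)\<^sup>2)"
  by (simp add: E_def power2_eq_square)

lemma D_nonneg: "D u u \<ge> 0"
  by (simp add: D_def)

lemma E_nonneg: "E u u \<ge> 0"
  by (simp add: E_def)

lemma D_le_a: "D u u \<le> a u u"
  using C E_nonneg by (simp add: a_def)

lemma E_le: "u \<in> C1c \<Omega> \<Longrightarrow> E u u \<le> K * (P + 1) * D u u"
proof -
  assume u: "u \<in> C1c \<Omega>"
  have "E u u \<le> K * ((LINT x|lborel. (u x)\<^sup>2) + D u u)"
    unfolding E_eq D_eq by (rule fdq_le[OF C1c_UNIV[OF u]])
  also have "\<dots> \<le> K * (P * D u u + D u u)"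
    using Poincare[OF u] K_pos by (intro mult_left_mono add_right_mono) (auto simp: D_eq)
  finally show ?thesis
    by (simp add: algebra_simps)
qed

lemma D_lincomb:
  assumes u: "u \<in> C1c \<Omega>" and v: "v \<in> C1c \<Omega>"
  shows "D (\<lambda>x. \<alpha> * u x + \<beta> * v x) (\<lambda>x. \<alpha> * u x + \<beta> * v x) = \<alpha>\<^sup>2 * D u u + 2 * \<alpha> * \<beta> * D u v + \<beta>\<^sup>2 * D v v"
proof -
  note int = L2_integrable_inner[OF C1c_L2(2)[OF u] C1c_L2(2)[OF u]]
    L2_integrable_inner[OF C1c_L2(2)[OF u] C1c_L2(2)[OF v]]
    L2_integrable_inner[OF C1c_L2(2)[OF v] C1c_L2(2)[OF v]]
  have "D (\<lambda>x. \<alpha> * u x + \<beta> * v x) (\<lambda>x. \<alpha> * u x + \<beta> * v x) =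
      (LINT x|lborel. \<alpha>\<^sup>2 * (grad u x \<bullet> grad u x) + 2 * \<alpha> * \<beta> * (grad u x \<bullet> grad v x) + \<beta>\<^sup>2 * (grad v x \<bullet> grad v x))"
    unfolding D_def C1c_lincomb(2)[OF u v]
    by (intro Bochner_Integration.integral_cong)
      (auto simp: inner_add_left inner_add_right inner_commute power2_eq_square algebra_simps)
  also have "\<dots> = \<alpha>\<^sup>2 * D u u + 2 * \<alpha> * \<beta> * D u v + \<beta>\<^sup>2 * D v v"
    using int by (simp add: D_def)
  finally show ?thesis .
qed

lemma E_lincomb:
  assumes u: "u \<in> C1c \<Omega>" and v: "v \<in> C1c \<Omega>"
  shows "E (\<lambda>x. \<alpha> * u x + \<beta> * v x) (\<lambda>x. \<alpha> * u x + \<beta> * v x) = \<alpha>\<^sup>2 * E u u + 2 * \<alpha> * \<beta> * E u v + \<beta>\<^sup>2 * E v v"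
proof -
  note L2 = fdq_L2[OF C1c_UNIV[OF u]] fdq_L2[OF C1c_UNIV[OF v]]
  note int = L2_integrable_mult[OF L2(1) L2(1)] L2_integrable_mult[OF L2(1) L2(2)]
    L2_integrable_mult[OF L2(2) L2(2)]
  have "E (\<lambda>x. \<alpha> * u x + \<beta> * v x) (\<lambda>x. \<alpha> * u x + \<beta> * v x) =
      (LINT p|lborel2. \<alpha>\<^sup>2 * (fdq s u p * fdq s u p) + 2 * \<alpha> * \<beta> * (fdq s u p * fdq s v p) + \<beta>\<^sup>2 * (fdq s v p * fdq s v p))"
    unfolding E_def fdq_lincomb
    by (intro Bochner_Integration.integral_cong) (auto simp: power2_eq_square algebra_simps)
  also have "\<dots> = \<alpha>\<^sup>2 * E u u + 2 * \<alpha> * \<beta> * E u v + \<beta>\<^sup>2 * E v v"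
    using int by (simp add: E_def)
  finally show ?thesis .
qed

lemma a_lincomb:
  assumes "u \<in> C1c \<Omega>" "v \<in> C1c \<Omega>"
  shows "a (\<lambda>x. \<alpha> * u x + \<beta> * v x) (\<lambda>x. \<alpha> * u x + \<beta> * v x) = \<alpha>\<^sup>2 * a u u + 2 * \<alpha> * \<beta> * a u v + \<beta>\<^sup>2 * a v v"
  unfolding a_def D_lincomb[OF assms] E_lincomb[OF assms] by (simp add: algebra_simps)

lemma C1c_L1_small: "u \<in> C1c \<Omega> \<Longrightarrow> \<tau> > 0 \<Longrightarrow> (LINT x|lborel. \<bar>u x\<bar>) \<le> \<tau> * vol + P * D u u / \<tau>"
  using C1c_L1_le[OF _ \<Omega>, of u \<tau>] Poincare[of u] divide_right_mono[of _ _ \<tau>]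
  unfolding vol_def D_eq by (smt (verit))

lemma potential_le:
  assumes u: "u \<in> C1c \<Omega>"
  shows "potential u \<le> 4 * P * vol * \<epsilon>\<^sup>2 + D u u / 4"
proof -
  note int = C1c_integrable[OF u] C1c_integrable_abs[OF u]
  have "potential u \<le> (LINT x|lebesgue. \<epsilon> * \<bar>u x\<bar>)"
    unfolding potential_def using int
    by (intro integral_mono \<Phi>_integrable \<Phi>_le) (auto simp: integrable_completion borel_measurable_integrable)
  also have "\<dots> = \<epsilon> * (LINT x|lborel. \<bar>u x\<bar>)"
    using int by (simp add: integral_completion borel_measurable_integrable)
  \<comment> \<open>The weight \<open>4 * P * \<epsilon>\<close> turns the gradient term into a
    quarter of \<open>D u u\<close>, which the quadratic part of the energy absorbs.\<close>
  also have "\<dots> \<le> \<epsilon> * (4 * P * \<epsilon> * vol + P * D u u / (4 * P * \<epsilon>))"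
    using \<epsilon>_pos P_pos by (intro mult_left_mono C1c_L1_small[OF u]) auto
  also have "\<dots> = 4 * P * vol * \<epsilon>\<^sup>2 + D u u / 4"
    using \<epsilon>_pos P_pos by (simp add: field_simps power2_eq_square)
  finally show ?thesis .
qed

text \<open>Coercivity. As the infimum of \<open>J\<close> is at most 0, minimising sequences have
  gradient energy of order \<epsilon>^2 up to a vanishing error; the seminorm bound originates
  here.\<close>

lemma J_lower: "u \<in> C1c \<Omega> \<Longrightarrow> D u u \<le> 4 * J u + 16 * P * vol * \<epsilon>\<^sup>2"
  using potential_le[of u] D_le_a[of u] by (simp add: J_def)

lemma J_zero: "J (\<lambda>_. 0) = 0"
proof -
  have "grad (\<lambda>_. 0 :: real) = (\<lambda>_ :: real ^ 'n. 0)"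
    using grad_eq[OF GDERIV_const] by auto
  then show ?thesis
    by (simp add: J_def a_def D_def E_def fdq_def potential_def case_prod_beta)
qed

section \<open>Minimising sequences and their strong limits\<close>

definition I :: real where
  "I = Inf (J ` C1c \<Omega>)"

lemma I_le: "u \<in> C1c \<Omega> \<Longrightarrow> I \<le> J u"
  unfolding I_def
proof (rule cInf_lower)
  have "J u \<ge> - (4 * P * vol * \<epsilon>\<^sup>2)" if "u \<in> C1c \<Omega>" for u
    using J_lower[OF that] D_nonneg[of u] by simp
  then show "bdd_below (J ` C1c \<Omega>)"
    by (intro bdd_belowI2)
qed simp

lemma I_nonpos: "I \<le> 0"
  using I_le[OF C1c_zero] J_zero by simp

text \<open>The midpoint \<open>m\<close> is a competitor, so its energy is at least
  \<open>I\<close>, and the parallelogram identity converts this into a bound on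
  \<open>a w w\<close>. The potentials at \<open>u\<close> and \<open>v\<close> differ from that at
  \<open>m\<close> by at most \<open>M\<close> times half the L^1 distance of \<open>u\<close> and
  \<open>v\<close>.\<close>

lemma D_diff_le:
  assumes u: "u \<in> C1c \<Omega>" "J u \<le> I + \<alpha>" and v: "v \<in> C1c \<Omega>" "J v \<le> I + \<beta>"
  shows "D (\<lambda>x. u x - v x) (\<lambda>x. u x - v x) \<le> 4 * \<alpha> + 4 * \<beta> + 4 * M * (LINT x|lborel. \<bar>u x - v x\<bar>)"
proof -
  define w m where "w = (\<lambda>x. u x - v x)" and "m = (\<lambda>x. 1/2 * u x + 1/2 * v x)"
  have m: "m \<in> C1c \<Omega>"
    unfolding m_def by (rule C1c_lincomb(1)[OF u(1) v(1)])
  have "a w w = 2 * a u u + 2 * a v v - 4 * a m m"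
    using a_lincomb[OF u(1) v(1), of 1 "-1"] a_lincomb[OF u(1) v(1), of "1/2" "1/2"]
    by (simp add: w_def m_def field_simps)
  moreover have "I \<le> a m m / 2 - potential m"
    using I_le[OF m] by (simp add: J_def)
  moreover have "a u u / 2 - potential u \<le> I + \<alpha>" "a v v / 2 - potential v \<le> I + \<beta>"
    using u v by (simp_all add: J_def)
  moreover have "potential u - potential m \<le> M * ((LINT x|lborel. \<bar>u x - v x\<bar>) / 2)"
  proof -
    have "\<bar>potential u - potential m\<bar> \<le> M * (LINT x|lborel. \<bar>u x - m x\<bar>)"
      unfolding potential_def by (intro \<Phi>_integral_Lipschitz C1c_integrable[OF u(1)] C1c_integrable[OF m])
    also have "(\<lambda>x. \<bar>u x - m x\<bar>) = (\<lambda>x. \<bar>u x - v x\<bar> / 2)"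
      by (auto simp: m_def simp flip: diff_divide_distrib)
    also have "(LINT x|lborel. \<bar>u x - v x\<bar> / 2) = (LINT x|lborel. \<bar>u x - v x\<bar>) / 2"
      by simp
    finally show ?thesis by linarith
  qed
  moreover have "potential v - potential m \<le> M * ((LINT x|lborel. \<bar>u x - v x\<bar>) / 2)"
  proof -
    have "\<bar>potential v - potential m\<bar> \<le> M * (LINT x|lborel. \<bar>v x - m x\<bar>)"
      unfolding potential_def by (intro \<Phi>_integral_Lipschitz C1c_integrable[OF v(1)] C1c_integrable[OF m])
    also have "(\<lambda>x. \<bar>v x - m x\<bar>) = (\<lambda>x. \<bar>u x - v x\<bar> / 2)"
      by (auto simp: m_def abs_if)
    also have "(LINT x|lborel. \<bar>u x - v x\<bar> / 2) = (LINT x|lborel. \<bar>u x - v x\<bar>) / 2"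
      by simp
    finally show ?thesis by linarith
  qed
  ultimately have "a w w \<le> 4 * \<alpha> + 4 * \<beta> + 4 * M * (LINT x|lborel. \<bar>u x - v x\<bar>)"
    by (simp add: field_simps)
  then show ?thesis
    using D_le_a[of w] by (simp add: w_def)
qed

lemma minimizing_sequence:
  obtains u \<delta> where "\<And>n. u n \<in> C1c \<Omega>" "\<And>n. J (u n) \<le> I + \<delta> n" "\<And>n. \<delta> n \<ge> 0" "\<delta> \<longlonglongrightarrow> 0"
    "\<And>e. e > 0 \<Longrightarrow> \<exists>N. \<forall>m\<ge>N. \<forall>n\<ge>N. D (\<lambda>x. u m x - u n x) (\<lambda>x. u m x - u n x) \<le> e"
proof -
  have "\<exists>u\<in>C1c \<Omega>. J u < I + inverse (real (Suc n))" for n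
  proof -
    have "J ` C1c \<Omega> \<noteq> {}"
      using C1c_zero by auto
    then obtain y where "y \<in> J ` C1c \<Omega>" "y < I + inverse (real (Suc n))"
      using cInf_lessD[of "J ` C1c \<Omega>" "I + inverse (real (Suc n))"] by (auto simp: I_def)
    then show ?thesis by auto
  qed
  then obtain w where w: "\<And>n. w n \<in> C1c \<Omega>" "\<And>n. J (w n) < I + inverse (real (Suc n))"
    by metis
  have B: "dirichlet (w n) \<le> 4 + 16 * P * vol * \<epsilon>\<^sup>2" for n
  proof -
    have "inverse (real (Suc n)) \<le> 1"
      by (simp add: field_simps)
    then have "J (w n) \<le> 1"
      using w(2)[of n] I_nonpos by linarith
    then show ?thesis
      using J_lower[OF w(1)[of n]] by (simp only: D_eq)
  qed
  obtain r where r: "strict_mono (r :: nat \<Rightarrow> nat)"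
    "\<And>e. e > 0 \<Longrightarrow> \<exists>N. \<forall>m\<ge>N. \<forall>n\<ge>N. (LINT x|lborel. \<bar>w (r m) x - w (r n) x\<bar>) < e"
    by (rule L1_compactness[where u = w, OF bounded_subset[OF bounded_cball \<Omega>] w(1) B]) blast
  define \<delta> where "\<delta> n = inverse (real (Suc (r n)))" for n
  have \<delta>: "\<delta> \<longlonglongrightarrow> 0"
    unfolding \<delta>_def using LIMSEQ_subseq_LIMSEQ[OF LIMSEQ_inverse_real_of_nat r(1)] by (simp add: o_def)
  have J: "J (w (r n)) \<le> I + \<delta> n" for n
    using w(2)[of "r n"] by (simp add: \<delta>_def)
  have "\<exists>N. \<forall>m\<ge>N. \<forall>n\<ge>N. D (\<lambda>x. w (r m) x - w (r n) x) (\<lambda>x. w (r m) x - w (r n) x) \<le> e" if "e > 0" for e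
  proof -
    \<comment> \<open>By \<open>D_diff_le\<close> the two defects contribute at most
      \<open>e / 4\<close> each, and the L^1 distance at most \<open>e / 2\<close>;
      \<open>M + 1\<close> avoids division by 0.\<close>
    obtain N1 where N1: "\<And>n. n \<ge> N1 \<Longrightarrow> \<delta> n < e / 16"
      using order_tendstoD(2)[OF \<delta>, of "e / 16"] \<open>e > 0\<close> by (auto simp: eventually_sequentially)
    obtain N2 where N2: "\<And>m n. m \<ge> N2 \<Longrightarrow> n \<ge> N2 \<Longrightarrow> (LINT x|lborel. \<bar>w (r m) x - w (r n) x\<bar>) < e / (8 * (M + 1))"
      using r(2)[of "e / (8 * (M + 1))"] \<open>e > 0\<close> M_nonneg by (auto simp: add_nonneg_pos)
    have "D (\<lambda>x. w (r m) x - w (r n) x) (\<lambda>x. w (r m) x - w (r n) x) \<le> e"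
      if "m \<ge> max N1 N2" "n \<ge> max N1 N2" for m n
    proof -
      have "4 * M * (LINT x|lborel. \<bar>w (r m) x - w (r n) x\<bar>) \<le> 4 * (M + 1) * (e / (8 * (M + 1)))"
        using N2[of m n] that M_nonneg by (intro mult_mono) auto
      also have "\<dots> = e / 2"
      proof -
        have "4 * q * (e / (8 * q)) = e / 2" if "q > 0" for q
          using that by simp
        then show ?thesis
          using M_nonneg by (meson add_nonneg_pos zero_less_one)
      qed
      finally show ?thesis
        using D_diff_le[OF w(1) J w(1) J, of m n] N1[of m] N1[of n] that by linarith
    qed
    then show ?thesis by blast
  qed
  then show ?thesis
    using that[of "\<lambda>n. w (r n)" \<delta>] w(1) J \<delta> by (simp add: \<delta>_def)
qed

lemma minimizing_limit:
  obtains u \<delta> v G where "\<And>n. u n \<in> C1c \<Omega>" "\<And>n. J (u n) \<le> I + \<delta> n" "\<And>n. \<delta> n \<ge> 0" "\<delta> \<longlonglongrightarrow> 0"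
    "v \<in> borel_measurable borel" "v \<in> L2 lborel" "G \<in> L2 lborel" "fdq s v \<in> L2 lborel2"
    "AE x in lborel. x \<notin> \<Omega> \<longrightarrow> v x = 0"
    "(\<lambda>n. LINT x|lborel. (norm (u n x - v x))\<^sup>2) \<longlonglongrightarrow> 0"
    "(\<lambda>n. LINT x|lborel. (norm (grad (u n) x - G x))\<^sup>2) \<longlonglongrightarrow> 0"
    "(\<lambda>n. LINT p|lborel2. (norm (fdq s (u n) p - fdq s v p))\<^sup>2) \<longlonglongrightarrow> 0"
proof -
  obtain u \<delta> where u: "\<And>n. u n \<in> C1c \<Omega>" "\<And>n. J (u n) \<le> I + \<delta> n" "\<And>n. \<delta> n \<ge> 0" "\<delta> \<longlonglongrightarrow> 0"
    and cauchy: "\<And>e. e > 0 \<Longrightarrow> \<exists>N. \<forall>m\<ge>N. \<forall>n\<ge>N. D (\<lambda>x. u m x - u n x) (\<lambda>x. u m x - u n x) \<le> e"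
    by (rule minimizing_sequence) blast
  have [measurable]: "u n \<in> borel_measurable borel" "grad (u n) \<in> borel_measurable borel" for n
    by (rule C1c_borel[OF u(1)], rule C1c_grad_borel[OF u(1)])
  \<comment> \<open>Completeness is applied to the pair of function and gradient, so one subsequence
    and one limit serve both components.\<close>
  define h where "h n x = (u n x, grad (u n) x)" for n x
  have h_meas [measurable]: "h n \<in> borel_measurable lborel" for n
    unfolding h_def by measurable
  have norm_h: "(norm (p :: real \<times> (real ^ 'n)))\<^sup>2 = (fst p)\<^sup>2 + (norm (snd p))\<^sup>2" for p
    by (cases p) (simp add: norm_Pair)
  have w: "(\<lambda>x. u m x - u n x) \<in> C1c \<Omega>" for m n
    by (rule C1c_diff(1)[OF u(1) u(1)])
  have h_cauchy: "\<exists>N. \<forall>m\<ge>N. \<forall>n\<ge>N. (\<integral>\<^sup>+x. ennreal ((norm (h m x - h n x))\<^sup>2) \<partial>lborel) \<le> ennreal e" if "e > 0" for e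
  proof -
    have "e / (P + 1) > 0"
      using \<open>e > 0\<close> P_pos by simp
    then obtain N where N: "\<And>m n. m \<ge> N \<Longrightarrow> n \<ge> N \<Longrightarrow> D (\<lambda>x. u m x - u n x) (\<lambda>x. u m x - u n x) \<le> e / (P + 1)"
      using cauchy by blast
    have "(\<integral>\<^sup>+x. ennreal ((norm (h m x - h n x))\<^sup>2) \<partial>lborel) \<le> ennreal e" if "m \<ge> N" "n \<ge> N" for m n
    proof -
      let ?w = "\<lambda>x. u m x - u n x"
      have "(norm (h m x - h n x))\<^sup>2 = (?w x)\<^sup>2 + (norm (grad ?w x))\<^sup>2" for x
        by (simp add: norm_h h_def C1c_diff(2)[OF u(1) u(1)])
      then have "(\<integral>\<^sup>+x. ennreal ((norm (h m x - h n x))\<^sup>2) \<partial>lborel) =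
          ennreal (LINT x|lborel. (?w x)\<^sup>2 + (norm (grad ?w x))\<^sup>2)"
        using L2_integrable_norm_sq[OF C1c_L2(1)[OF w[of m n]]] L2_integrable_norm_sq[OF C1c_L2(2)[OF w[of m n]]]
        by (simp add: nn_integral_eq_integral del: ennreal_plus)
      also have "(LINT x|lborel. (?w x)\<^sup>2 + (norm (grad ?w x))\<^sup>2) = (LINT x|lborel. (?w x)\<^sup>2) + D ?w ?w"
        using L2_integrable_norm_sq[OF C1c_L2(1)[OF w[of m n]]] L2_integrable_norm_sq[OF C1c_L2(2)[OF w[of m n]]]
        by (simp add: D_eq)
      also have "\<dots> \<le> (P + 1) * D ?w ?w"
        using Poincare[OF w[of m n]] by (simp add: D_eq algebra_simps)
      also have "\<dots> \<le> (P + 1) * (e / (P + 1))"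
        using N[OF that] P_pos by (intro mult_left_mono) auto
      also have "\<dots> = e"
        using P_pos by simp
      finally show ?thesis
        by (simp add: ennreal_leI)
    qed
    then show ?thesis by blast
  qed
  obtain r f where r: "strict_mono r" and f [measurable]: "f \<in> borel_measurable lborel"
    and AE: "AE x in lborel. (\<lambda>k. h (r k) x) \<longlonglongrightarrow> f x"
    and lim: "\<And>e::real. e > 0 \<Longrightarrow> \<forall>\<^sub>F n in sequentially. (\<integral>\<^sup>+x. ennreal ((norm (h n x - f x))\<^sup>2) \<partial>lborel) \<le> ennreal e"
    by (rule L2_complete[where u = h, OF h_meas h_cauchy]; blast)
  define v where "v = (\<lambda>x. fst (f x))"
  define G where "G = (\<lambda>x. snd (f x))"
  have [measurable]: "v \<in> borel_measurable borel" "G \<in> borel_measurable borel"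
    using measurable_compose[OF f borel_measurable_continuous_onI[of fst]]
      measurable_compose[OF f borel_measurable_continuous_onI[of snd]]
    by (simp_all add: v_def G_def continuous_on_fst continuous_on_snd continuous_on_id)
  have AE_v: "AE x in lborel. (\<lambda>k. u (r k) x) \<longlonglongrightarrow> v x"
    using AE by eventually_elim (auto simp: h_def v_def dest: tendsto_fst)
  have lim_v: "\<forall>\<^sub>F n in sequentially. (\<integral>\<^sup>+x. ennreal ((norm (u n x - v x))\<^sup>2) \<partial>lborel) \<le> ennreal e"
    and lim_G: "\<forall>\<^sub>F n in sequentially. (\<integral>\<^sup>+x. ennreal ((norm (grad (u n) x - G x))\<^sup>2) \<partial>lborel) \<le> ennreal e"
    if "e > 0" for e
  proof -
    have "(norm (u n x - v x))\<^sup>2 \<le> (norm (h n x - f x))\<^sup>2" "(norm (grad (u n) x - G x))\<^sup>2 \<le> (norm (h n x - f x))\<^sup>2" for n x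
      unfolding norm_h[of "h n x - f x"] by (simp_all add: h_def v_def G_def)
    then have le: "(\<integral>\<^sup>+x. ennreal ((norm (u n x - v x))\<^sup>2) \<partial>lborel) \<le> (\<integral>\<^sup>+x. ennreal ((norm (h n x - f x))\<^sup>2) \<partial>lborel)"
      "(\<integral>\<^sup>+x. ennreal ((norm (grad (u n) x - G x))\<^sup>2) \<partial>lborel) \<le> (\<integral>\<^sup>+x. ennreal ((norm (h n x - f x))\<^sup>2) \<partial>lborel)" for n
      by (intro nn_integral_mono ennreal_leI; simp)+
    show "\<forall>\<^sub>F n in sequentially. (\<integral>\<^sup>+x. ennreal ((norm (u n x - v x))\<^sup>2) \<partial>lborel) \<le> ennreal e"
      using lim[OF that] by eventually_elim (rule order_trans[OF le(1)])
    show "\<forall>\<^sub>F n in sequentially. (\<integral>\<^sup>+x. ennreal ((norm (grad (u n) x - G x))\<^sup>2) \<partial>lborel) \<le> ennreal e"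
      using lim[OF that] by eventually_elim (rule order_trans[OF le(2)])
  qed
  have fdq_meas [measurable]: "fdq s (u n) \<in> borel_measurable lborel2" "fdq s v \<in> borel_measurable lborel2" for n
    by (rule fdq_measurable; measurable)+
  \<comment> \<open>A separate limit of the difference quotients would still have to be identified.
    Here almost everywhere convergence of the functions already names it, and \<open>E_le\<close>
    gives the Cauchy property.\<close>
  have lim_fdq: "\<forall>\<^sub>F n in sequentially. (\<integral>\<^sup>+p. ennreal ((norm (fdq s (u n) p - fdq s v p))\<^sup>2) \<partial>lborel2) \<le> ennreal e"
    if "e > 0" for e
  proof (rule L2_limit[OF fdq_meas _ r fdq_tendsto_AE[OF AE_v] that])
    fix e :: real
    assume "e > 0"
    then have "e / (K * (P + 1)) > 0"
      using P_pos K_pos by simp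
    then obtain N where N: "\<And>m n. m \<ge> N \<Longrightarrow> n \<ge> N \<Longrightarrow> D (\<lambda>x. u m x - u n x) (\<lambda>x. u m x - u n x) \<le> e / (K * (P + 1))"
      using cauchy by blast
    have "(\<integral>\<^sup>+p. ennreal ((norm (fdq s (u m) p - fdq s (u n) p))\<^sup>2) \<partial>lborel2) \<le> ennreal e"
      if "m \<ge> N" "n \<ge> N" for m n
    proof -
      let ?w = "\<lambda>x. u m x - u n x"
      have "(\<integral>\<^sup>+p. ennreal ((norm (fdq s (u m) p - fdq s (u n) p))\<^sup>2) \<partial>lborel2) =
          (\<integral>\<^sup>+p. ennreal ((fdq s ?w p)\<^sup>2) \<partial>lborel2)"
        using fdq_lincomb[of s 1 "u m" "-1" "u n"] by simp
      also have "\<dots> = ennreal (E ?w ?w)"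
        using L2_integrable_norm_sq[OF fdq_L2[OF C1c_UNIV[OF w[of m n]]]]
        by (simp add: E_eq nn_integral_eq_integral)
      also have "E ?w ?w \<le> K * (P + 1) * D ?w ?w"
        by (rule E_le[OF w])
      also have "\<dots> \<le> K * (P + 1) * (e / (K * (P + 1)))"
        using N[OF that] P_pos K_pos by (intro mult_left_mono) auto
      also have "\<dots> = e"
        using P_pos K_pos by simp
      finally show ?thesis
        by (simp add: ennreal_leI)
    qed
    then show "\<exists>N. \<forall>m\<ge>N. \<forall>n\<ge>N. (\<integral>\<^sup>+p. ennreal ((norm (fdq s (u m) p - fdq s (u n) p))\<^sup>2) \<partial>lborel2) \<le> ennreal e"
      by blast
  qed
  have L2_of_limit: "g \<in> L2 N"
    if q: "\<And>n. q n \<in> L2 N" and [measurable]: "g \<in> borel_measurable N"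
      and lim: "\<forall>\<^sub>F n in sequentially. (\<integral>\<^sup>+x. ennreal ((norm (q n x - g x))\<^sup>2) \<partial>N) \<le> ennreal 1"
    for N :: "'z measure" and q :: "nat \<Rightarrow> 'z \<Rightarrow> 'y::euclidean_space" and g
  proof -
    obtain n where n: "(\<integral>\<^sup>+x. ennreal ((norm (q n x - g x))\<^sup>2) \<partial>N) \<le> ennreal 1"
      using lim by (auto simp: eventually_sequentially)
    have "(\<lambda>x. q n x - g x) \<in> L2 N"
      using n L2_measurable[OF q[of n]] by (subst L2_iff_nn_integral) (auto intro: le_less_trans)
    from L2_diff[OF q[of n] this] show ?thesis
      by simp
  qed
  have L2s: "v \<in> L2 lborel" "G \<in> L2 lborel" "fdq s v \<in> L2 lborel2"
    using L2_of_limit[OF C1c_L2(1)[OF u(1)], of v] L2_of_limit[OF C1c_L2(2)[OF u(1)], of G]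
      L2_of_limit[OF fdq_L2[OF C1c_UNIV[OF u(1)]], of "fdq s v"]
      lim_v[of 1] lim_G[of 1] lim_fdq[of 1] by simp_all
  have supp: "AE x in lborel. x \<notin> \<Omega> \<longrightarrow> v x = 0"
    using AE_v
  proof eventually_elim
    case (elim x)
    then show ?case
      using C1c_eq_0[OF u(1)] by (auto simp: LIMSEQ_const_iff)
  qed
  have lims: "(\<lambda>n. LINT x|lborel. (norm (u n x - v x))\<^sup>2) \<longlonglongrightarrow> 0"
    "(\<lambda>n. LINT x|lborel. (norm (grad (u n) x - G x))\<^sup>2) \<longlonglongrightarrow> 0"
    "(\<lambda>n. LINT p|lborel2. (norm (fdq s (u n) p - fdq s v p))\<^sup>2) \<longlonglongrightarrow> 0"
    by (rule L2_tendsto_0[OF _ lim_v] L2_tendsto_0[OF _ lim_G] L2_tendsto_0[OF _ lim_fdq]; measurable)+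
  show ?thesis
    by (rule that[OF u \<open>v \<in> borel_measurable borel\<close> L2s supp lims])
qed

end

subsection \<open>The Euler--Lagrange equation\<close>

lemma C1c_uminus: "v \<in> C1c \<Omega> \<Longrightarrow> (\<lambda>x. - v x) \<in> C1c \<Omega>"
  and grad_uminus: "v \<in> C1c \<Omega> \<Longrightarrow> grad (\<lambda>x. - v x) = (\<lambda>x. - grad v x)"
  using C1c_minus[of v \<Omega>] by auto

lemma fdq_uminus: "fdq s (\<lambda>x. - v x) = (\<lambda>p. - fdq s v p)"
  by (auto simp: fdq_def algebra_simps)

text \<open>The outcome of \<open>minimizing_limit\<close> is turned into parameters so that the
  reflected sequence is a second instance. The number \<open>I\<^sub>0\<close> stands for the
  infimum, whose definition refers to the energy of one particular nonlinearity.\<close>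

locale minimizer = energy F M \<epsilon> s C \<Omega> R P K
  for F :: "real ^ 'n::finite \<Rightarrow> real \<Rightarrow> real" and M \<epsilon> s C :: real and \<Omega> R P K +
  fixes I\<^sub>0 :: real and U :: "nat \<Rightarrow> real ^ 'n \<Rightarrow> real" and \<delta> :: "nat \<Rightarrow> real"
    and u :: "real ^ 'n \<Rightarrow> real" and G :: "real ^ 'n \<Rightarrow> real ^ 'n"
  assumes I\<^sub>0_le: "\<And>\<phi>. \<phi> \<in> C1c \<Omega> \<Longrightarrow> I\<^sub>0 \<le> J \<phi>"
    and I\<^sub>0_nonpos: "I\<^sub>0 \<le> 0"
    and U: "\<And>n. U n \<in> C1c \<Omega>"
    and J_U: "\<And>n. J (U n) \<le> I\<^sub>0 + \<delta> n"
    and \<delta>_nonneg: "\<And>n. \<delta> n \<ge> 0"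
    and \<delta>_lim: "\<delta> \<longlonglongrightarrow> 0"
    and u_borel: "u \<in> borel_measurable borel"
    and u_L2: "u \<in> L2 lborel"
    and G_L2: "G \<in> L2 lborel"
    and fdq_u_L2: "fdq s u \<in> L2 lborel2"
    and u_supp: "AE x in lborel. x \<notin> \<Omega> \<longrightarrow> u x = 0"
    and U_lim: "(\<lambda>n. LINT x|lborel. (norm (U n x - u x))\<^sup>2) \<longlonglongrightarrow> 0"
    and grad_lim: "(\<lambda>n. LINT x|lborel. (norm (grad (U n) x - G x))\<^sup>2) \<longlonglongrightarrow> 0"
    and fdq_lim: "(\<lambda>n. LINT p|lborel2. (norm (fdq s (U n) p - fdq s u p))\<^sup>2) \<longlonglongrightarrow> 0"
begin

lemma u_integrable: "integrable lborel u"
  using u_supp \<Omega> by (intro L1_le_L2(1)[OF u_L2, of R]) (auto elim!: eventually_mono)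

lemma U_L1_lim: "(\<lambda>n. LINT x|lborel. \<bar>U n x - u x\<bar>) \<longlonglongrightarrow> 0"
proof (rule tendstoI)
  fix e :: real
  assume "e > 0"
  \<comment> \<open>Fixed before \<open>n\<close>: the volume term is at most \<open>e / 2\<close>,
    and L^2 convergence then handles the other one.\<close>
  define \<tau> where "\<tau> = e / (2 * (vol + 1))"
  have \<tau>: "\<tau> > 0"
    using \<open>e > 0\<close> vol_nonneg by (simp add: \<tau>_def add_nonneg_pos)
  have "\<forall>\<^sub>F n in sequentially. (LINT x|lborel. (norm (U n x - u x))\<^sup>2) < \<tau> * (e / 2)"
    using \<tau> \<open>e > 0\<close> by (intro order_tendstoD(2)[OF U_lim]) simp
  then show "\<forall>\<^sub>F n in sequentially. dist (LINT x|lborel. \<bar>U n x - u x\<bar>) 0 < e"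
  proof eventually_elim
    case (elim n)
    have "AE x in lborel. x \<notin> cball 0 R \<longrightarrow> U n x - u x = 0"
      using u_supp \<Omega> C1c_eq_0[OF U[of n]] by (auto simp: subset_eq elim!: eventually_mono)
    then have "(LINT x|lborel. \<bar>U n x - u x\<bar>) \<le> \<tau> * vol + (LINT x|lborel. (U n x - u x)\<^sup>2) / \<tau>"
      unfolding vol_def by (intro L1_le_L2(2) L2_diff C1c_L2(1)[OF U] u_L2 \<tau>)
    also have "\<tau> * vol \<le> e / 2"
    proof -
      have "\<tau> * vol \<le> \<tau> * (vol + 1)"
        using \<tau> by simp
      also have "\<dots> = e / 2"
      proof -
        have "e / (2 * q) * q = e / 2" if "q > 0" for q
          using that by simp
        then show ?thesis
          unfolding \<tau>_def using vol_nonneg by (meson add_nonneg_pos zero_less_one)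
      qed
      finally show ?thesis .
    qed
    also have "(LINT x|lborel. (U n x - u x)\<^sup>2) / \<tau> < e / 2"
      using elim \<tau> by (simp add: divide_less_eq mult.commute)
    finally show ?case
      by simp
  qed
qed

lemma potential_lim:
  assumes "integrable lborel \<psi>"
  shows "(\<lambda>n. potential (\<lambda>x. U n x + \<psi> x)) \<longlonglongrightarrow> potential (\<lambda>x. u x + \<psi> x)"
proof -
  have "(\<lambda>n. potential (\<lambda>x. U n x + \<psi> x) - potential (\<lambda>x. u x + \<psi> x)) \<longlonglongrightarrow> 0"
  proof (rule Lim_null_comparison)
    show "\<forall>\<^sub>F n in sequentially. norm (potential (\<lambda>x. U n x + \<psi> x) - potential (\<lambda>x. u x + \<psi> x))
        \<le> M * (LINT x|lborel. \<bar>U n x - u x\<bar>)"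
    proof (rule always_eventually, rule allI)
      fix n
      show "norm (potential (\<lambda>x. U n x + \<psi> x) - potential (\<lambda>x. u x + \<psi> x)) \<le> M * (LINT x|lborel. \<bar>U n x - u x\<bar>)"
        using \<Phi>_integral_Lipschitz[of "\<lambda>x. U n x + \<psi> x" "\<lambda>x. u x + \<psi> x"]
          C1c_integrable[OF U[of n]] u_integrable assms
        by (simp add: potential_def)
    qed
    show "(\<lambda>n. M * (LINT x|lborel. \<bar>U n x - u x\<bar>)) \<longlonglongrightarrow> 0"
      using tendsto_mult_left[OF U_L1_lim, of M] by simp
  qed
  then show ?thesis
    by (rule LIM_zero_cancel)
qed

text \<open>The limit \<open>u\<close> need not be differentiable: its weak gradient is \<open>G\<close>, and \<open>grad u\<close> is
  a junk value.\<close>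

definition a\<^sub>u :: "(real ^ 'n \<Rightarrow> real) \<Rightarrow> real" where
  "a\<^sub>u \<phi> = (LINT x|lborel. G x \<bullet> grad \<phi> x) + C * (LINT p|lborel2. fdq s u p * fdq s \<phi> p)"

lemma a_lim:
  assumes \<phi>: "\<phi> \<in> C1c \<Omega>"
  shows "(\<lambda>n. a (U n) \<phi>) \<longlonglongrightarrow> a\<^sub>u \<phi>"
proof -
  have "(\<lambda>n. D (U n) \<phi>) \<longlonglongrightarrow> (LINT x|lborel. G x \<bullet> grad \<phi> x)"
    unfolding D_def by (rule L2_tendsto_inner[OF C1c_L2(2)[OF U] G_L2 C1c_L2(2)[OF \<phi>] grad_lim])
  moreover have "(\<lambda>n. E (U n) \<phi>) \<longlonglongrightarrow> (LINT p|lborel2. fdq s u p * fdq s \<phi> p)"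
    using L2_tendsto_inner[OF fdq_L2[OF C1c_UNIV[OF U]] fdq_u_L2 fdq_L2[OF C1c_UNIV[OF \<phi>]] fdq_lim]
    by (simp add: E_def)
  ultimately show ?thesis
    unfolding a_def a\<^sub>u_def by (intro tendsto_intros)
qed

text \<open>Stated before the limit, with the defect \<open>\<delta> n\<close>, because the supremum
  bound perturbs \<open>U n\<close> by a function that itself depends on \<open>n\<close>.\<close>

lemma J_perturbation:
  assumes \<phi>: "\<phi> \<in> C1c \<Omega>"
  shows "potential (\<lambda>x. U n x + t * \<phi> x) - potential (U n) \<le> t * a (U n) \<phi> + t\<^sup>2 / 2 * a \<phi> \<phi> + \<delta> n"
proof -
  have "(\<lambda>x. U n x + t * \<phi> x) \<in> C1c \<Omega>"
    using C1c_lincomb(1)[OF U \<phi>, of 1 n t] by simp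
  then have "I\<^sub>0 \<le> J (\<lambda>x. U n x + t * \<phi> x)"
    by (rule I\<^sub>0_le)
  also have "\<dots> = a (U n) (U n) / 2 + t * a (U n) \<phi> + t\<^sup>2 / 2 * a \<phi> \<phi> - potential (\<lambda>x. U n x + t * \<phi> x)"
    using a_lincomb[OF U[of n] \<phi>, of 1 t] by (simp add: J_def field_simps)
  finally show ?thesis
    using J_U[of n] by (simp add: J_def)
qed

lemma limit_perturbation:
  assumes \<phi>: "\<phi> \<in> C1c \<Omega>"
  shows "potential (\<lambda>x. u x + t * \<phi> x) - potential u \<le> t * a\<^sub>u \<phi> + t\<^sup>2 / 2 * a \<phi> \<phi>"
proof (rule LIMSEQ_le)
  have "integrable lborel (\<lambda>x. t * \<phi> x)"
    using C1c_integrable[OF \<phi>] by simp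
  from tendsto_diff[OF potential_lim[OF this] potential_lim[of "\<lambda>_. 0"]]
  show "(\<lambda>n. potential (\<lambda>x. U n x + t * \<phi> x) - potential (U n)) \<longlonglongrightarrow> potential (\<lambda>x. u x + t * \<phi> x) - potential u"
    by simp
  have "(\<lambda>n. t * a (U n) \<phi> + t\<^sup>2 / 2 * a \<phi> \<phi> + \<delta> n) \<longlonglongrightarrow> t * a\<^sub>u \<phi> + t\<^sup>2 / 2 * a \<phi> \<phi> + 0"
    by (intro tendsto_intros a_lim[OF \<phi>] \<delta>_lim)
  then show "(\<lambda>n. t * a (U n) \<phi> + t\<^sup>2 / 2 * a \<phi> \<phi> + \<delta> n) \<longlonglongrightarrow> t * a\<^sub>u \<phi> + t\<^sup>2 / 2 * a \<phi> \<phi>"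
    by simp
  show "\<exists>N. \<forall>n\<ge>N. potential (\<lambda>x. U n x + t * \<phi> x) - potential (U n)
      \<le> t * a (U n) \<phi> + t\<^sup>2 / 2 * a \<phi> \<phi> + \<delta> n"
    using J_perturbation[OF \<phi>] by blast
qed

lemma F_u_measurable: "(\<lambda>x. F x (u x)) \<in> borel_measurable lebesgue"
proof -
  have "u \<in> borel_measurable lebesgue"
    using u_borel by (intro measurable_completion) simp
  then show ?thesis
    using F_comp_measurable[of "\<lambda>x. x" lebesgue u] by simp
qed

lemma F_u_integrable:
  assumes \<phi>: "\<phi> \<in> C1c \<Omega>"
  shows "integrable lebesgue (\<lambda>x. F x (u x) * \<phi> x)"
proof (rule Bochner_Integration.integrable_bound)
  show "integrable lebesgue (\<lambda>x. M * \<phi> x)"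
    using C1c_integrable[OF \<phi>] by (simp add: integrable_completion borel_measurable_integrable)
  show "(\<lambda>x. F x (u x) * \<phi> x) \<in> borel_measurable lebesgue"
    using C1c_borel[OF \<phi>] by (intro borel_measurable_times F_u_measurable measurable_completion) auto
  show "AE x in lebesgue. norm (F x (u x) * \<phi> x) \<le> norm (M * \<phi> x)"
    using F_bound M_nonneg by (auto simp: abs_mult intro!: mult_right_mono)
qed

text \<open>Divide \<open>limit_perturbation\<close> by a positive step and let it tend to 0; the
  Lipschitz bound on \<Phi> dominates the quotients. Positive steps are enough, as the converse
  inequality is this one for the negative of \<phi>.\<close>

lemma euler_lagrange_le:
  assumes \<phi>: "\<phi> \<in> C1c \<Omega>"
  shows "(LINT x|lebesgue. F x (u x) * \<phi> x) \<le> a\<^sub>u \<phi>"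
proof -
  define t where "t n = inverse (real (Suc n))" for n
  have t: "t n > 0" for n
    by (simp add: t_def)
  have t_lim: "t \<longlonglongrightarrow> 0"
    unfolding t_def by (rule LIMSEQ_inverse_real_of_nat)
  then have t_at: "filterlim t (at 0) sequentially"
    using t by (auto simp: filterlim_at less_le)
  have int: "integrable lborel (\<lambda>x. u x + t n * \<phi> x)" for n
    using u_integrable C1c_integrable[OF \<phi>] by auto
  let ?\<psi> = "\<lambda>n x. (\<Phi> x (u x + t n * \<phi> x) - \<Phi> x (u x)) / t n"
  have "(\<lambda>n. LINT x|lebesgue. ?\<psi> n x) \<longlonglongrightarrow> (LINT x|lebesgue. F x (u x) * \<phi> x)"
  proof (rule integral_dominated_convergence)
    show "(\<lambda>x. F x (u x) * \<phi> x) \<in> borel_measurable lebesgue"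
      using F_u_integrable[OF \<phi>] by auto
    show "?\<psi> n \<in> borel_measurable lebesgue" for n
      using \<Phi>_integrable[OF int[of n]] \<Phi>_integrable[OF u_integrable] by auto
    show "integrable lebesgue (\<lambda>x. M * \<bar>\<phi> x\<bar>)"
      using C1c_integrable_abs[OF \<phi>] by (simp add: integrable_completion borel_measurable_integrable)
    show "AE x in lebesgue. (\<lambda>n. ?\<psi> n x) \<longlonglongrightarrow> F x (u x) * \<phi> x"
    proof (rule AE_I2)
      fix x
      have "((\<lambda>\<tau>. u x + \<tau> * \<phi> x) has_real_derivative \<phi> x) (at 0)"
        by (auto intro!: derivative_eq_intros)
      from DERIV_chain2[OF \<Phi>_DERIV this]
      have "((\<lambda>\<tau>. \<Phi> x (u x + \<tau> * \<phi> x)) has_real_derivative F x (u x) * \<phi> x) (at 0)"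
        by simp
      then have "(\<lambda>\<tau>. (\<Phi> x (u x + \<tau> * \<phi> x) - \<Phi> x (u x)) / \<tau>) \<midarrow>0\<rightarrow> F x (u x) * \<phi> x"
        by (simp add: has_field_derivative_iff)
      from filterlim_compose[OF this t_at] show "(\<lambda>n. ?\<psi> n x) \<longlonglongrightarrow> F x (u x) * \<phi> x" .
    qed
    show "AE x in lebesgue. norm (?\<psi> n x) \<le> M * \<bar>\<phi> x\<bar>" for n
    proof (rule AE_I2)
      fix x
      have "\<bar>\<Phi> x (u x + t n * \<phi> x) - \<Phi> x (u x)\<bar> \<le> M * \<bar>t n * \<phi> x\<bar>"
        using \<Phi>_Lipschitz[of x "u x + t n * \<phi> x" "u x"] by simp
      then show "norm (?\<psi> n x) \<le> M * \<bar>\<phi> x\<bar>"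
        using t[of n] by (simp add: abs_mult divide_le_eq mult_ac)
    qed
  qed
  moreover have "(\<lambda>n. a\<^sub>u \<phi> + t n / 2 * a \<phi> \<phi>) \<longlonglongrightarrow> a\<^sub>u \<phi> + 0 / 2 * a \<phi> \<phi>"
    by (intro tendsto_intros t_lim) simp
  then have "(\<lambda>n. a\<^sub>u \<phi> + t n / 2 * a \<phi> \<phi>) \<longlonglongrightarrow> a\<^sub>u \<phi>"
    by simp
  moreover have "(LINT x|lebesgue. ?\<psi> n x) \<le> a\<^sub>u \<phi> + t n / 2 * a \<phi> \<phi>" for n
  proof -
    have "(LINT x|lebesgue. ?\<psi> n x) = (potential (\<lambda>x. u x + t n * \<phi> x) - potential u) / t n"
      using \<Phi>_integrable[OF int[of n]] \<Phi>_integrable[OF u_integrable] by (simp add: potential_def)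
    also have "\<dots> \<le> (t n * a\<^sub>u \<phi> + (t n)\<^sup>2 / 2 * a \<phi> \<phi>) / t n"
      using t[of n] by (intro divide_right_mono limit_perturbation[OF \<phi>]) auto
    also have "\<dots> = a\<^sub>u \<phi> + t n / 2 * a \<phi> \<phi>"
      using t[of n] by (simp add: field_simps power2_eq_square)
    finally show ?thesis .
  qed
  ultimately show ?thesis
    by (intro LIMSEQ_le[of _ _ "\<lambda>n. a\<^sub>u \<phi> + t n / 2 * a \<phi> \<phi>"]) auto
qed

lemma euler_lagrange:
  assumes \<phi>: "\<phi> \<in> C1c \<Omega>"
  shows "a\<^sub>u \<phi> = (LINT x|lebesgue. F x (u x) * \<phi> x)"
proof -
  have "a\<^sub>u (\<lambda>x. - \<phi> x) = - a\<^sub>u \<phi>"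
    by (simp add: a\<^sub>u_def grad_uminus[OF \<phi>] fdq_uminus algebra_simps)
  then show ?thesis
    using euler_lagrange_le[OF \<phi>] euler_lagrange_le[OF C1c_uminus[OF \<phi>]] by simp
qed

lemma weak_gradient_u: "weak_gradient u G"
  unfolding weak_gradient_def
proof (intro ballI allI)
  fix \<phi> :: "real ^ 'n \<Rightarrow> real" and i
  assume "\<phi> \<in> Cc_infinity UNIV"
  then have \<phi>: "\<phi> \<in> C1c UNIV"
    using Cc_infinity_subset_C1c by blast
  define g where "g = (\<lambda>x. grad \<phi> x $ i)"
  \<comment> \<open>Both sides of integration by parts are written as inner products with fixed L^2
    functions, to which \<open>L2_tendsto_inner\<close> applies.\<close>
  define H where "H = (\<lambda>x. \<phi> x *\<^sub>R axis i (1::real))"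
  have inner_H: "y \<bullet> H x = y $ i * \<phi> x" for x y
    by (simp add: H_def inner_axis)
  have [measurable]: "\<phi> \<in> borel_measurable borel"
    by (rule C1c_borel[OF \<phi>])
  have g: "g \<in> L2 lborel"
  proof -
    obtain L where L: "compact L" "\<And>x. x \<notin> L \<Longrightarrow> grad \<phi> x = 0"
      using C1c_support[OF \<phi>] by metis
    have cg: "continuous_on UNIV g"
      unfolding g_def by (intro continuous_intros C1c_continuous_grad[OF \<phi>])
    then have "integrable lborel (\<lambda>x. (norm (g x))\<^sup>2)"
      by (intro integrable_continuous_compact_support[OF _ L(1)] continuous_intros) (auto simp: g_def L)
    then show ?thesis
      using borel_measurable_continuous_onI[OF cg] by (simp add: L2_def)
  qed
  have H: "H \<in> L2 lborel"
  proof -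
    have "(\<lambda>x. (norm (H x))\<^sup>2) = (\<lambda>x. (norm (\<phi> x))\<^sup>2)"
      by (simp add: H_def)
    moreover have "H \<in> borel_measurable lborel"
      unfolding H_def by measurable
    ultimately show ?thesis
      using C1c_L2(1)[OF \<phi>] by (simp add: L2_def)
  qed
  have "(\<lambda>n. LINT x|lborel. U n x \<bullet> g x) \<longlonglongrightarrow> (LINT x|lborel. u x \<bullet> g x)"
    by (rule L2_tendsto_inner[OF C1c_L2(1)[OF U] u_L2 g U_lim])
  moreover have "(LINT x|lborel. U n x \<bullet> g x) = - (LINT x|lborel. grad (U n) x \<bullet> H x)" for n
    using C1c_integration_by_parts[OF U C1c_GDERIV[OF \<phi>] C1c_continuous_grad[OF \<phi>], of n i]
    by (simp add: g_def inner_H)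
  moreover have "(\<lambda>n. - (LINT x|lborel. grad (U n) x \<bullet> H x)) \<longlonglongrightarrow> - (LINT x|lborel. G x \<bullet> H x)"
    by (intro tendsto_minus L2_tendsto_inner[OF C1c_L2(2)[OF U] G_L2 H grad_lim])
  ultimately have "(LINT x|lborel. u x \<bullet> g x) = - (LINT x|lborel. G x \<bullet> H x)"
    by (simp add: LIMSEQ_unique)
  moreover have "(\<lambda>x. u x * g x) \<in> borel_measurable lborel" "(\<lambda>x. G x \<bullet> H x) \<in> borel_measurable lborel"
    using L2_measurable[OF u_L2] L2_measurable[OF g] L2_measurable[OF G_L2] L2_measurable[OF H] by auto
  ultimately show "(LINT x|lebesgue. u x * grad \<phi> x $ i) = - (LINT x|lebesgue. G x $ i * \<phi> x)"
    by (simp add: g_def inner_H integral_completion)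
qed

text \<open>Coercivity and \<open>E_le\<close> bound the nonlocal energies of the
  \<open>U n\<close>, where \<open>I\<^sub>0\<close> is at most 0; strong convergence carries the
  bound to \<open>u\<close>.\<close>

lemma fdq_u_small: "(LINT p|lborel2. (fdq s u p)\<^sup>2) \<le> K * (P + 1) * (16 * P * vol * \<epsilon>\<^sup>2)"
proof (rule LIMSEQ_le)
  note L2 = fdq_L2[OF C1c_UNIV[OF U]]
  let ?e = "\<lambda>n p. fdq s (U n) p - fdq s u p"
  have e: "?e n \<in> L2 lborel2" for n
    by (rule L2_diff[OF L2 fdq_u_L2])
  \<comment> \<open>Expanding the square this way leaves a pairing with a fixed function and an
    error that tends to 0.\<close>
  have "E (U n) (U n) = 2 * (LINT p|lborel2. fdq s (U n) p \<bullet> fdq s u p)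
      - (LINT p|lborel2. (fdq s u p)\<^sup>2) + (LINT p|lborel2. (norm (?e n p))\<^sup>2)" for n
  proof -
    have "(\<lambda>p. (fdq s (U n) p)\<^sup>2) = (\<lambda>p. 2 * (fdq s (U n) p \<bullet> fdq s u p) - (fdq s u p)\<^sup>2 + (norm (?e n p))\<^sup>2)"
      by (auto simp: power2_diff)
    then show ?thesis
      using L2_integrable_inner[OF L2 fdq_u_L2] L2_integrable_norm_sq[OF fdq_u_L2] L2_integrable_norm_sq[OF e[of n]]
      unfolding E_eq by simp
  qed
  moreover have "(\<lambda>n. 2 * (LINT p|lborel2. fdq s (U n) p \<bullet> fdq s u p)
      - (LINT p|lborel2. (fdq s u p)\<^sup>2) + (LINT p|lborel2. (norm (?e n p))\<^sup>2)) \<longlonglongrightarrow>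
      2 * (LINT p|lborel2. fdq s u p \<bullet> fdq s u p) - (LINT p|lborel2. (fdq s u p)\<^sup>2) + 0"
    by (intro tendsto_intros L2_tendsto_inner[OF L2 fdq_u_L2 fdq_u_L2 fdq_lim] fdq_lim)
  ultimately show "(\<lambda>n. E (U n) (U n)) \<longlonglongrightarrow> (LINT p|lborel2. (fdq s u p)\<^sup>2)"
    by (simp add: power2_eq_square)
  have "(\<lambda>n. K * (P + 1) * (4 * \<delta> n + 16 * P * vol * \<epsilon>\<^sup>2)) \<longlonglongrightarrow> K * (P + 1) * (4 * 0 + 16 * P * vol * \<epsilon>\<^sup>2)"
    by (intro tendsto_intros \<delta>_lim)
  then show "(\<lambda>n. K * (P + 1) * (4 * \<delta> n + 16 * P * vol * \<epsilon>\<^sup>2)) \<longlonglongrightarrow> K * (P + 1) * (16 * P * vol * \<epsilon>\<^sup>2)"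
    by simp
  have "E (U n) (U n) \<le> K * (P + 1) * (4 * \<delta> n + 16 * P * vol * \<epsilon>\<^sup>2)" for n
  proof (rule order_trans[OF E_le[OF U]])
    show "K * (P + 1) * D (U n) (U n) \<le> K * (P + 1) * (4 * \<delta> n + 16 * P * vol * \<epsilon>\<^sup>2)"
      using J_lower[OF U[of n]] J_U[of n] I\<^sub>0_nonpos K_pos P_pos by (intro mult_left_mono) auto
  qed
  then show "\<exists>N. \<forall>n\<ge>N. E (U n) (U n) \<le> K * (P + 1) * (4 * \<delta> n + 16 * P * vol * \<epsilon>\<^sup>2)"
    by blast
qed

lemma reflected_minimizer:
  "minimizer (\<lambda>x t. - F x (- t)) M \<epsilon> s C \<Omega> R P K I\<^sub>0 (\<lambda>n x. - U n x) \<delta> (\<lambda>x. - u x) (\<lambda>x. - G x)"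
proof -
  interpret R: bounded_nonlinearity "\<lambda>x t. - F x (- t)" M \<epsilon>
    by (rule reflected)
  interpret R: energy "\<lambda>x t. - F x (- t)" M \<epsilon> s C \<Omega> R P K
    by unfold_locales (use C \<Omega> P_pos K_pos Poincare fdq_L2 fdq_le in auto)
  \<comment> \<open>All quadratic terms are even, and the primitive of the reflected nonlinearity is
    the reflected primitive.\<close>
  have J: "R.J (\<lambda>x. - \<phi> x) = J \<phi>" if \<phi>: "\<phi> \<in> C1c \<Omega>" for \<phi>
    by (simp add: R.J_def J_def R.a_def a_def R.D_def D_def R.E_def E_def R.potential_def potential_def
        grad_uminus[OF \<phi>] fdq_uminus reflected_\<Phi>)
  show ?thesis
  proof
    show "I\<^sub>0 \<le> R.J \<phi>" if "\<phi> \<in> C1c \<Omega>" for \<phi>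
      using I\<^sub>0_le[OF C1c_uminus[OF that]] J[OF C1c_uminus[OF that]] by simp
    show "R.J (\<lambda>x. - U n x) \<le> I\<^sub>0 + \<delta> n" for n
      using J[OF U] J_U by simp
    show "(\<lambda>x. - U n x) \<in> C1c \<Omega>" for n
      by (rule C1c_uminus[OF U])
    show "AE x in lborel. x \<notin> \<Omega> \<longrightarrow> - u x = 0"
      using u_supp by simp
    show "(\<lambda>x. - u x) \<in> L2 lborel" "(\<lambda>x. - G x) \<in> L2 lborel"
      "fdq s (\<lambda>x. - u x) \<in> L2 lborel2"
      using L2_scaleR[OF u_L2, of "-1"] L2_scaleR[OF G_L2, of "-1"] L2_scaleR[OF fdq_u_L2, of "-1"]
      by (simp_all add: fdq_uminus)
    have neg: "norm (- a - - b) = norm (a - b)" for a b :: "'z::real_normed_vector"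
      by (simp add: norm_minus_commute)
    show "(\<lambda>n. LINT x|lborel. (norm (- U n x - - u x))\<^sup>2) \<longlonglongrightarrow> 0"
      using U_lim by (simp only: neg)
    show "(\<lambda>n. LINT x|lborel. (norm (grad (\<lambda>x. - U n x) x - - G x))\<^sup>2) \<longlonglongrightarrow> 0"
      using grad_lim by (simp only: grad_uminus[OF U] neg)
    show "(\<lambda>n. LINT p|lborel2. (norm (fdq s (\<lambda>x. - U n x) p - fdq s (\<lambda>x. - u x) p))\<^sup>2) \<longlonglongrightarrow> 0"
      using fdq_lim by (simp only: fdq_uminus neg)
  qed (use I\<^sub>0_nonpos \<delta>_nonneg \<delta>_lim u_borel in auto)
qed

end

subsection \<open>A barrier\<close>

text \<open>This function is superharmonic on \<open>{x. 3|x|\<^sup>2 \<le> \<kappa>}\<close> for both parts of the operator: there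
  its second differences are nonpositive for every increment, and not just for small ones.\<close>

definition barrier :: "real \<Rightarrow> real ^ 'n::finite \<Rightarrow> real" where
  "barrier \<kappa> x = \<kappa> / (\<kappa> + x \<bullet> x)"

definition barrier_grad :: "real \<Rightarrow> real ^ 'n::finite \<Rightarrow> real ^ 'n" where
  "barrier_grad \<kappa> x = (- 2 * \<kappa> / (\<kappa> + x \<bullet> x)\<^sup>2) *\<^sub>R x"

text \<open>Row \<open>i\<close> of the Hessian; the Laplacian is the sum over \<open>i\<close> of
  its \<open>i\<close>-th entries.\<close>

definition barrier_hess :: "real \<Rightarrow> 'n \<Rightarrow> real ^ 'n::finite \<Rightarrow> real ^ 'n" where
  "barrier_hess \<kappa> i x = (- 2 * \<kappa> / (\<kappa> + x \<bullet> x)\<^sup>2) *\<^sub>R axis i 1 + (8 * \<kappa> * x $ i / (\<kappa> + x \<bullet> x) ^ 3) *\<^sub>R x"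

lemma barrier_denominator: "\<kappa> > 0 \<Longrightarrow> \<kappa> + x \<bullet> x > 0"
  by (simp add: add_pos_nonneg)

lemma barrier_pos: "\<kappa> > 0 \<Longrightarrow> barrier \<kappa> x > 0"
  by (simp add: barrier_def barrier_denominator)

lemma barrier_le_1: "\<kappa> > 0 \<Longrightarrow> barrier \<kappa> x \<le> 1"
  by (simp add: barrier_def barrier_denominator)

lemma barrier_GDERIV: "\<kappa> > 0 \<Longrightarrow> GDERIV (barrier \<kappa>) x :> barrier_grad \<kappa> x"
  using barrier_denominator[of \<kappa> x] unfolding gderiv_def barrier_def[abs_def] barrier_grad_def
  by (auto intro!: derivative_eq_intros simp: field_simps power2_eq_square inner_commute)

lemma barrier_grad_GDERIV: "\<kappa> > 0 \<Longrightarrow> GDERIV (\<lambda>x. barrier_grad \<kappa> x $ i) x :> barrier_hess \<kappa> i x"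
proof -
  assume "\<kappa> > 0"
  define q where "q = \<kappa> + x \<bullet> x"
  have q: "q > 0"
    using barrier_denominator[OF \<open>\<kappa> > 0\<close>] by (simp add: q_def)
  have 1: "((\<lambda>x. x $ i) has_derivative (\<lambda>h. h $ i)) (at x)"
    by (rule bounded_linear.has_derivative[OF bounded_linear_vec_nth has_derivative_ident])
  have 2: "((\<lambda>x. \<kappa> + x \<bullet> x) has_derivative (\<lambda>h. 2 * (h \<bullet> x))) (at x)"
    by (auto intro!: derivative_eq_intros simp: inner_commute)
  have "((\<lambda>x. - 2 * \<kappa> / (\<kappa> + x \<bullet> x)\<^sup>2 * x $ i) has_derivative
      (\<lambda>h. - 2 * \<kappa> / q\<^sup>2 * h $ i + 8 * \<kappa> * x $ i / q ^ 3 * (h \<bullet> x))) (at x)"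
  proof -
    have "((\<lambda>t. - 2 * \<kappa> / t\<^sup>2) has_real_derivative 4 * \<kappa> / q ^ 3) (at (\<kappa> + x \<bullet> x))"
      unfolding q_def[symmetric] using q
      by (auto intro!: derivative_eq_intros simp: field_simps power2_eq_square power3_eq_cube)
    from has_derivative_mult[OF DERIV_compose_FDERIV[OF this 2] 1] show ?thesis
      by (rule has_derivative_eq_rhs) (auto simp: q_def algebra_simps)
  qed
  moreover have "(\<lambda>h. - 2 * \<kappa> / q\<^sup>2 * h $ i + 8 * \<kappa> * x $ i / q ^ 3 * (h \<bullet> x)) = (\<lambda>h. h \<bullet> barrier_hess \<kappa> i x)"
    by (auto simp: barrier_hess_def q_def inner_diff_right inner_add_right inner_axis)
  ultimately show ?thesis
    by (simp add: gderiv_def barrier_grad_def)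
qed

lemma barrier_continuous:
  fixes i :: "'n::finite"
  assumes "\<kappa> > 0"
  shows "continuous_on UNIV (barrier \<kappa> :: real ^ 'n \<Rightarrow> real)"
    and "continuous_on UNIV (barrier_grad \<kappa> :: real ^ 'n \<Rightarrow> real ^ 'n)"
    and "continuous_on UNIV (barrier_hess \<kappa> i)"
proof -
  have "\<kappa> + x \<bullet> x \<noteq> 0" for x :: "real ^ 'n"
    using barrier_denominator[OF assms, of x] by simp
  then show "continuous_on UNIV (barrier \<kappa> :: real ^ 'n \<Rightarrow> real)"
    "continuous_on UNIV (barrier_grad \<kappa> :: real ^ 'n \<Rightarrow> real ^ 'n)" "continuous_on UNIV (barrier_hess \<kappa> i)"
    unfolding barrier_def[abs_def] barrier_grad_def[abs_def] barrier_hess_def[abs_def]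
    by (auto intro!: continuous_intros)
qed

text \<open>The dimension multiplies a negative term, so two dimensions are the worst case. There,
  with \<open>y = x \<bullet> x\<close>, the numerator is
  \<open>4 * \<kappa> * (y - \<kappa>)\<close>, at most -8/3 times the square of \<kappa>, while
  \<open>q ^ 3\<close> is at most 64/27 times its cube; and 64/27 is below 8/3.\<close>

lemma barrier_laplacian:
  assumes \<kappa>: "\<kappa> > 0" and x: "3 * (x \<bullet> x) \<le> \<kappa>" and N: "CARD('n::finite) \<ge> 2"
  shows "(\<Sum>i\<in>UNIV. barrier_hess \<kappa> i (x :: real ^ 'n) $ i) \<le> - 1 / \<kappa>"
proof -
  define y where "y = x \<bullet> x"
  define q where "q = \<kappa> + y"
  have y: "0 \<le> y" "3 * y \<le> \<kappa>"
    using x by (simp_all add: y_def)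
  have q: "q > 0"
    using y \<kappa> by (simp add: q_def)
  have "(\<Sum>i\<in>UNIV. barrier_hess \<kappa> i x $ i) = (\<Sum>i\<in>(UNIV :: 'n set). - 2 * \<kappa> / q\<^sup>2 + 8 * \<kappa> / q ^ 3 * (x $ i * x $ i))"
    by (intro sum.cong) (auto simp: barrier_hess_def q_def y_def axis_def)
  also have "\<dots> = - 2 * \<kappa> / q\<^sup>2 * real CARD('n) + 8 * \<kappa> / q ^ 3 * y"
    unfolding sum.distrib sum_distrib_left[symmetric] y_def inner_vec_def by simp
  also have "\<dots> \<le> - 2 * \<kappa> / q\<^sup>2 * 2 + 8 * \<kappa> / q ^ 3 * y"
    using N \<kappa> q by (intro add_right_mono mult_left_mono_neg) auto
  also have "\<dots> = (8 * \<kappa> * y - 4 * \<kappa> * q) / q ^ 3"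
    using q by (simp add: field_simps power2_eq_square power3_eq_cube)
  also have "\<dots> \<le> - 1 / \<kappa>"
  proof -
    have "q \<le> 4/3 * \<kappa>"
      using y by (simp add: q_def)
    then have "q ^ 3 \<le> (4/3 * \<kappa>) ^ 3"
      using q by (intro power_mono) auto
    also have "\<dots> \<le> (8/3 * \<kappa>) * \<kappa> * \<kappa>"
      using \<kappa> by (simp add: power_mult_distrib power3_eq_cube)
    also have "\<dots> \<le> (4 * \<kappa> - 4 * y) * \<kappa> * \<kappa>"
      using y \<kappa> by (intro mult_right_mono) auto
    also have "\<dots> = - (8 * \<kappa> * y - 4 * \<kappa> * q) * \<kappa>"
      by (simp add: q_def algebra_simps)
    finally show ?thesis
      using q \<kappa> by (simp add: field_simps)
  qed
  finally show ?thesis .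
qed

text \<open>Adding the two fractions reduces the claim to \<open>b\<^sup>2 \<le> a * t\<close>.
  Cauchy-Schwarz bounds the left side by \<open>4 * (x \<bullet> x) * t\<close>, and
  \<open>3 * (x \<bullet> x) \<le> \<kappa>\<close> is what makes \<open>4 * (x \<bullet> x)\<close>
  at most \<open>a\<close>, for every \<open>z\<close>.\<close>

lemma barrier_second_difference:
  assumes \<kappa>: "\<kappa> > 0" and x: "3 * (x \<bullet> x) \<le> \<kappa>"
  shows "barrier \<kappa> (x + z) + barrier \<kappa> (x - z) \<le> 2 * barrier \<kappa> x"
proof -
  define a b y t where "a = \<kappa> + x \<bullet> x + z \<bullet> z" and "b = 2 * (x \<bullet> z)" and "y = \<kappa> + x \<bullet> x" and "t = z \<bullet> z"
  have pos: "a + b > 0" "a - b > 0" "y > 0" "t \<ge> 0"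
    using barrier_denominator[OF \<kappa>, of "x + z"] barrier_denominator[OF \<kappa>, of "x - z"] barrier_denominator[OF \<kappa>, of x]
    by (auto simp: a_def b_def y_def t_def inner_add inner_diff inner_commute algebra_simps)
  have "b\<^sup>2 \<le> 4 * (x \<bullet> x) * t"
    using Cauchy_Schwarz_ineq[of x z] by (simp add: b_def t_def power_mult_distrib)
  also have "\<dots> \<le> a * t"
    using pos
  proof (intro mult_right_mono)
    show "4 * (x \<bullet> x) \<le> a"
      unfolding a_def using x inner_ge_zero[of z] by linarith
  qed
  finally have b: "b\<^sup>2 \<le> a * t" .
  have a: "a = y + t"
    by (simp add: a_def y_def t_def)
  have "a * y \<le> (a + b) * (a - b)"
    using b by (simp add: a power2_eq_square algebra_simps)
  then have "(2 * a) * y \<le> 2 * ((a + b) * (a - b))"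
    by simp
  moreover have "(a + b) * (a - b) > 0"
    using pos by (intro mult_pos_pos)
  ultimately have "2 * a / ((a + b) * (a - b)) \<le> 2 / y"
    using pos by (subst frac_le_eq) (auto simp: divide_nonpos_pos)
  moreover have "2 * a / ((a + b) * (a - b)) = 1 / (a + b) + 1 / (a - b)"
    using pos by (simp add: add_frac_eq)
  ultimately have "\<kappa> * (1 / (a + b) + 1 / (a - b)) \<le> \<kappa> * (2 / y)"
    using \<kappa> by (intro mult_left_mono) auto
  then show ?thesis
    by (simp add: barrier_def a_def b_def y_def inner_add inner_diff inner_commute algebra_simps)
qed

text \<open>Integration by parts moves the derivative onto the barrier gradient; the Laplacian bound
  is then used only inside \<Omega>, where \<phi> may be nonzero.\<close>

lemma barrier_dirichlet:
  fixes \<phi> :: "real ^ 'n::finite \<Rightarrow> real"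
  assumes \<kappa>: "\<kappa> > 0" and \<Omega>: "\<And>x. x \<in> \<Omega> \<Longrightarrow> 3 * (x \<bullet> x) \<le> \<kappa>" and N: "CARD('n) \<ge> 2"
    and \<phi>: "\<phi> \<in> C1c \<Omega>" "\<And>x. \<phi> x \<ge> 0"
  shows "(LINT x|lborel. \<phi> x) / \<kappa> \<le> (LINT x|lborel. barrier_grad \<kappa> x \<bullet> grad \<phi> x)"
proof -
  obtain L where L: "compact L" "\<And>x. x \<notin> L \<Longrightarrow> \<phi> x = 0" "\<And>x. x \<notin> L \<Longrightarrow> grad \<phi> x = 0"
    using C1c_support[OF \<phi>(1)] by metis
  have int1: "integrable lborel (\<lambda>x. grad \<phi> x $ i * barrier_grad \<kappa> x $ i)" for i
    using L by (intro integrable_continuous_compact_support[OF _ L(1)] continuous_intros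
        C1c_continuous_grad[OF \<phi>(1)] barrier_continuous \<kappa>) auto
  have int2: "integrable lborel (\<lambda>x. \<phi> x * barrier_hess \<kappa> i x $ i)" for i
    using L by (intro integrable_continuous_compact_support[OF _ L(1)] continuous_intros
        C1c_continuous[OF \<phi>(1)] barrier_continuous \<kappa>) auto
  have "(LINT x|lborel. \<phi> x) / \<kappa> = (LINT x|lborel. \<phi> x / \<kappa>)"
    by simp
  also have "\<dots> \<le> (LINT x|lborel. (\<Sum>i\<in>UNIV. - (\<phi> x * barrier_hess \<kappa> i x $ i)))"
  proof (rule integral_mono)
    show "integrable lborel (\<lambda>x. \<phi> x / \<kappa>)"
      using C1c_integrable[OF \<phi>(1)] by simp
    show "integrable lborel (\<lambda>x. \<Sum>i\<in>UNIV. - (\<phi> x * barrier_hess \<kappa> i x $ i))"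
      using int2 by auto
    fix x
    show "\<phi> x / \<kappa> \<le> (\<Sum>i\<in>UNIV. - (\<phi> x * barrier_hess \<kappa> i x $ i))"
    proof (cases "x \<in> \<Omega>")
      case True
      have "\<phi> x * (1 / \<kappa>) \<le> \<phi> x * (- (\<Sum>i\<in>UNIV. barrier_hess \<kappa> i x $ i))"
        using barrier_laplacian[OF \<kappa> \<Omega>[OF True] N] \<phi>(2) by (intro mult_left_mono) auto
      then show ?thesis
        by (simp add: sum_distrib_left sum_negf)
    next
      case False
      then show ?thesis
        using C1c_eq_0[OF \<phi>(1)] by simp
    qed
  qed
  also have "\<dots> = (\<Sum>i\<in>UNIV. - (LINT x|lborel. \<phi> x * barrier_hess \<kappa> i x $ i))"
    using int2 by simp
  also have "\<dots> = (\<Sum>i\<in>UNIV. LINT x|lborel. grad \<phi> x $ i * barrier_grad \<kappa> x $ i)"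
    by (intro sum.cong refl, subst C1c_integration_by_parts[OF \<phi>(1) barrier_grad_GDERIV[OF \<kappa>] barrier_continuous(3)[OF \<kappa>]]) simp
  also have "\<dots> = (LINT x|lborel. barrier_grad \<kappa> x \<bullet> grad \<phi> x)"
    using int1 by (subst Bochner_Integration.integral_sum[symmetric]) (auto simp: inner_vec_def mult.commute)
  finally show ?thesis .
qed

lemma C1c_difference_integrable:
  assumes \<phi>: "\<phi> \<in> C1c \<Omega>" and f: "continuous_on UNIV f"
  shows "integrable lborel (\<lambda>x. f x * (\<phi> (x + z) - \<phi> x))"
proof -
  obtain L where L: "compact L" "\<And>x. x \<notin> L \<Longrightarrow> \<phi> x = 0"
    using C1c_support[OF \<phi>] by metis
  have cont: "continuous_on UNIV (\<lambda>x. f x * (\<phi> (x + z) - \<phi> x))"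
    by (intro continuous_intros f C1c_continuous[OF \<phi>] continuous_on_compose2[OF C1c_continuous[OF \<phi>]]) auto
  have "f x * (\<phi> (x + z) - \<phi> x) = 0" if "x \<notin> L \<union> (\<lambda>y. y - z) ` L" for x
  proof -
    have "x + z \<notin> L"
      using that by (metis UnCI add_diff_cancel_right' imageI)
    then show ?thesis
      using that L(2) by simp
  qed
  moreover have "compact (L \<union> (\<lambda>y. y - z) ` L)"
    using L(1) by (intro compact_Un compact_translation_subtract)
  ultimately show ?thesis
    using integrable_continuous_compact_support[OF cont] by blast
qed

text \<open>Summation by parts for one fixed increment: translation invariance rewrites the integral
  as that of \<phi> times the negative second difference of the barrier. With \<open>z\<close> fixed
  no singular integral arises.\<close>

lemma barrier_nonlocal:
  fixes \<phi> :: "real ^ 'n::finite \<Rightarrow> real"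
  assumes \<kappa>: "\<kappa> > 0" and \<Omega>: "\<And>x. x \<in> \<Omega> \<Longrightarrow> 3 * (x \<bullet> x) \<le> \<kappa>"
    and \<phi>: "\<phi> \<in> C1c \<Omega>" "\<And>x. \<phi> x \<ge> 0"
  shows "0 \<le> (LINT x|lborel. (barrier \<kappa> (x + z) - barrier \<kappa> x) * (\<phi> (x + z) - \<phi> x))"
proof -
  obtain L where L: "compact L" "\<And>x. x \<notin> L \<Longrightarrow> \<phi> x = 0"
    using C1c_support[OF \<phi>(1)] by metis
  note c = continuous_on_compose2[OF barrier_continuous(1)[OF \<kappa>]]
  \<comment> \<open>The four terms of the expanded product are values of \<open>A\<close> at shifts
    0, \<open>z\<close> and \<open>- z\<close>, two of them translated by \<open>z\<close>.\<close>
  define A where "A c x = barrier \<kappa> (x + c) * \<phi> x" for c x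
  have A: "continuous_on UNIV (A c)" "integrable lborel (A c)" for c
  proof -
    show "continuous_on UNIV (A c)"
      unfolding A_def by (intro continuous_intros c C1c_continuous[OF \<phi>(1)]) auto
    then show "integrable lborel (A c)"
      by (rule integrable_continuous_compact_support[OF _ L(1)]) (simp add: A_def L)
  qed
  have tr: "integrable lborel (\<lambda>x. A c (x + z))" "(LINT x|lborel. A c (x + z)) = (LINT x|lborel. A c x)" for c
    using integrable_lborel_translate[OF A(2)]
      integral_lborel_translate[OF borel_measurable_continuous_onI[OF A(1)]] by auto
  have "(LINT x|lborel. (barrier \<kappa> (x + z) - barrier \<kappa> x) * (\<phi> (x + z) - \<phi> x)) =
      (LINT x|lborel. A 0 (x + z) - A z x - A (- z) (x + z) + A 0 x)"
    by (intro Bochner_Integration.integral_cong) (auto simp: A_def algebra_simps)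
  also have "\<dots> = (LINT x|lborel. A 0 x) - (LINT x|lborel. A z x) - (LINT x|lborel. A (- z) x) + (LINT x|lborel. A 0 x)"
    using A(2) tr by simp
  also have "\<dots> = (LINT x|lborel. A 0 x - A z x - A (- z) x + A 0 x)"
    using A(2) by simp
  also have "\<dots> \<ge> 0"
  proof (rule Bochner_Integration.integral_nonneg)
    fix x
    show "A 0 x - A z x - A (- z) x + A 0 x \<ge> 0"
    proof (cases "x \<in> \<Omega>")
      case True
      have "0 \<le> (2 * barrier \<kappa> x - (barrier \<kappa> (x + z) + barrier \<kappa> (x - z))) * \<phi> x"
        using barrier_second_difference[OF \<kappa> \<Omega>[OF True], of z] \<phi>(2) by (intro mult_nonneg_nonneg) auto
      then show ?thesis
        by (simp add: A_def algebra_simps)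
    next
      case False
      then show ?thesis
        using C1c_eq_0[OF \<phi>(1)] by (simp add: A_def)
    qed
  qed
  finally show ?thesis .
qed

text \<open>The antiderivative of a continuous function rising from 0 to 1. It behaves like half the
  square near 0, so compositions with it keep continuous gradients.\<close>

lemma smooth_positive_part:
  "\<exists>\<beta> b :: real \<Rightarrow> real. (\<forall>t. (\<beta> has_real_derivative b t) (at t)) \<and> continuous_on UNIV b \<and>
    (\<forall>t. 0 \<le> b t) \<and> (\<forall>t. b t \<le> 1) \<and> (\<forall>t\<le>0. \<beta> t = 0) \<and> (\<forall>t>0. \<beta> t > 0) \<and> (\<forall>t. \<beta> t \<ge> 0) \<and>
    (\<forall>x y. x \<le> y \<longrightarrow> \<beta> x \<le> \<beta> y) \<and> (\<forall>x y. \<bar>\<beta> x - \<beta> y\<bar> \<le> \<bar>x - y\<bar>)"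
proof -
  define b :: "real \<Rightarrow> real" where "b t = max 0 (min t 1)" for t
  have b: "continuous_on UNIV b" "\<And>t. 0 \<le> b t" "\<And>t. b t \<le> 1"
    unfolding b_def by (auto intro!: continuous_intros)
  have "isCont b t" for t
    using b(1) by (simp add: continuous_on_eq_continuous_at)
  then obtain A where "\<And>t :: real. (A has_vector_derivative b t) (at t)"
    using einterval_antiderivative[of "-\<infinity>" \<infinity> b] by auto
  then have A: "(A has_real_derivative b t) (at t)" for t
    by (simp add: has_real_derivative_iff_has_vector_derivative)
  define \<beta> where "\<beta> t = A t - A 0" for t
  have d: "(\<beta> has_real_derivative b t) (at t)" for t
    unfolding \<beta>_def by (auto intro!: derivative_eq_intros A)
  have mono: "\<beta> x \<le> \<beta> y" if "x \<le> y" for x y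
    using d b(2) by (intro DERIV_nonneg_imp_nondecreasing[OF that]) blast
  have lip: "\<bar>\<beta> x - \<beta> y\<bar> \<le> \<bar>x - y\<bar>" for x y
    using field_differentiable_bound[of UNIV \<beta> b 1 x y] d b by auto
  have neg: "\<beta> t = 0" if "t \<le> 0" for t
  proof -
    have "\<beta> 0 \<le> \<beta> t"
    proof (rule DERIV_nonpos_imp_nonincreasing[OF that])
      fix x :: real
      assume "x \<le> 0"
      then have "b x = 0"
        by (simp add: b_def)
      then show "\<exists>y. (\<beta> has_real_derivative y) (at x) \<and> y \<le> 0"
        using d[of x] by auto
    qed
    with mono[OF that] show ?thesis
      by (simp add: \<beta>_def)
  qed
  have pos: "\<beta> t > 0" if "t > 0" for t
  proof -
    have "\<beta> 0 < \<beta> t"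
    proof (rule DERIV_pos_imp_increasing_open[OF that])
      show "\<exists>y. (\<beta> has_real_derivative y) (at x) \<and> y > 0" if "0 < x" "x < t" for x
        using d[of x] that by (auto simp: b_def)
      show "continuous_on {0..t} \<beta>"
        using d by (auto intro!: continuous_at_imp_continuous_on DERIV_isCont)
    qed
    then show ?thesis
      by (simp add: \<beta>_def)
  qed
  have "\<beta> t \<ge> 0" for t
    using neg[of t] pos[of t] by (cases "t \<le> 0") auto
  with d b neg pos mono lip show ?thesis
    by (intro exI[of _ \<beta>] exI[of _ b]) simp
qed

subsection \<open>The supremum bound\<close>

context minimizer
begin

text \<open>The multiple \<open>k * W\<close> of the barrier has negative Laplacian at least
  \<open>2 * \<epsilon>\<close> on \<Omega>, whereas \<open>F\<close> is at most \<epsilon> for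
  nonnegative values. Lowering \<open>U n\<close> by a multiple of \<open>v n\<close> would thus
  save energy unless the integral of \<open>v n\<close> were nearly 0.\<close>

lemma u_le:
  assumes N: "CARD('n) \<ge> 2" and \<kappa>: "\<kappa> > 0" "3 * R\<^sup>2 \<le> \<kappa>"
  shows "AE x in lborel. u x \<le> 2 * \<epsilon> * \<kappa>"
proof -
  have norm_\<Omega>: "norm x \<le> R" if "x \<in> \<Omega>" for x
    using \<Omega> that by auto
  have \<Omega>\<kappa>: "3 * (x \<bullet> x) \<le> \<kappa>" if "x \<in> \<Omega>" for x
    using power_mono[OF norm_\<Omega>[OF that], of 2] \<kappa> by (simp add: power2_norm_eq_inner)
  obtain \<beta> b :: "real \<Rightarrow> real" where "\<forall>t. (\<beta> has_real_derivative b t) (at t)" "continuous_on UNIV b"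
    "\<forall>t. 0 \<le> b t" "\<forall>t. b t \<le> 1" "\<forall>t\<le>0. \<beta> t = 0" "\<forall>t>0. \<beta> t > 0" "\<forall>t. \<beta> t \<ge> 0"
    "\<forall>x y. x \<le> y \<longrightarrow> \<beta> x \<le> \<beta> y" "\<forall>x y. \<bar>\<beta> x - \<beta> y\<bar> \<le> \<bar>x - y\<bar>"
    using smooth_positive_part by (elim exE conjE) (rule that)
  note \<beta> = this[rule_format]
  have \<beta>_cont: "continuous_on UNIV \<beta>"
    using \<beta>(1) by (auto intro!: continuous_at_imp_continuous_on DERIV_isCont)
  have \<beta>_le: "\<beta> t \<le> max t 0" for t
    using \<beta>(5)[of t] \<beta>(5)[of 0] \<beta>(9)[of t 0] by (cases "t \<le> 0") auto
  \<comment> \<open>The barrier yields the lower bound \<open>1 / \<kappa>\<close>; the factor 2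
    leaves a surplus \<epsilon> over the one-sided bound on \<open>F\<close>.\<close>
  define k where "k = 2 * \<epsilon> * \<kappa>"
  have k: "k > 0"
    using \<epsilon>_pos \<kappa> by (simp add: k_def)
  define W :: "real ^ 'n \<Rightarrow> real" where "W = barrier \<kappa>"
  have W: "W x > 0" "W x \<le> 1" for x
    using barrier_pos[OF \<kappa>(1)] barrier_le_1[OF \<kappa>(1)] by (auto simp: W_def)
  have W_cont: "continuous_on UNIV W"
    unfolding W_def by (rule barrier_continuous[OF \<kappa>(1)])
  define p where "p n x = U n x - k * W x" for n x
  define p' where "p' n x = grad (U n) x - k *\<^sub>R barrier_grad \<kappa> x" for n x
  define v where "v n x = \<beta> (p n x)" for n x
  have p_deriv: "GDERIV (p n) x :> p' n x" for n x
    using GDERIV_diff[OF C1c_GDERIV[OF U, of n x] GDERIV_mult[OF GDERIV_const[of k] barrier_GDERIV[OF \<kappa>(1), of x]]]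
    by (simp add: p_def[abs_def] p'_def W_def)
  have p_cont: "continuous_on UNIV (p n)" for n
    unfolding p_def[abs_def] by (intro continuous_intros C1c_continuous[OF U] W_cont)
  have v_C1c: "v n \<in> C1c \<Omega>" and v_grad: "grad (v n) = (\<lambda>x. b (p n x) *\<^sub>R p' n x)" for n
  proof -
    obtain L where L: "compact L" "L \<subseteq> \<Omega>" "\<And>x. x \<notin> L \<Longrightarrow> U n x = 0"
      using C1c_support[OF U] by metis
    have D: "GDERIV (v n) x :> b (p n x) *\<^sub>R p' n x" for x
      unfolding v_def[abs_def] by (rule GDERIV_DERIV_compose[OF p_deriv \<beta>(1)])
    have C: "continuous_on UNIV (\<lambda>x. b (p n x) *\<^sub>R p' n x)"
      unfolding p'_def
      by (intro continuous_intros continuous_on_compose2[OF \<beta>(2) p_cont] C1c_continuous_grad[OF U]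
          barrier_continuous \<kappa>) auto
    \<comment> \<open>Where \<open>U n\<close> vanishes, positivity of the barrier makes
      \<open>p n\<close> negative, so \<open>v n\<close> inherits its compact support from
      \<open>U n\<close>.\<close>
    have S: "{x. v n x \<noteq> 0} \<subseteq> L"
    proof
      fix x
      assume "x \<in> {x. v n x \<noteq> 0}"
      then have "p n x > 0"
        using \<beta>(5)[of "p n x"] by (force simp: v_def)
      then have "U n x \<noteq> 0"
        using mult_pos_pos[OF k W(1)[of x]] by (auto simp: p_def)
      then show "x \<in> L"
        using L(3) by blast
    qed
    show "v n \<in> C1c \<Omega>" "grad (v n) = (\<lambda>x. b (p n x) *\<^sub>R p' n x)"
      by (rule C1cI[OF D C S L(1,2)])+
  qed
  have v_nonneg: "v n x \<ge> 0" for n x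
    using \<beta>(7) by (simp add: v_def)
  define V where "V n = (LINT x|lborel. v n x)" for n
  have local: "2 * \<epsilon> * V n \<le> D (U n) (v n)" for n
  proof -
    have int1: "integrable lborel (\<lambda>x. grad (U n) x \<bullet> grad (v n) x)"
      by (rule L2_integrable_inner[OF C1c_L2(2)[OF U] C1c_L2(2)[OF v_C1c]])
    obtain L where L: "compact L" "\<And>x. x \<notin> L \<Longrightarrow> grad (v n) x = 0"
      using C1c_support[OF v_C1c] by metis
    have int2: "integrable lborel (\<lambda>x. barrier_grad \<kappa> x \<bullet> grad (v n) x)"
      using L by (intro integrable_continuous_compact_support[OF _ L(1)] continuous_intros
          barrier_continuous C1c_continuous_grad[OF v_C1c] \<kappa>) auto
    \<comment> \<open>The gradient of \<open>v n\<close> is a nonnegative multiple of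
      \<open>p' n\<close>.\<close>
    have "0 \<le> (LINT x|lborel. p' n x \<bullet> grad (v n) x)"
      using \<beta>(3) by (intro Bochner_Integration.integral_nonneg) (simp add: v_grad)
    also have "\<dots> = D (U n) (v n) - k * (LINT x|lborel. barrier_grad \<kappa> x \<bullet> grad (v n) x)"
      using int1 int2 by (simp add: p'_def D_def inner_diff_left)
    finally have "k * (LINT x|lborel. barrier_grad \<kappa> x \<bullet> grad (v n) x) \<le> D (U n) (v n)"
      by simp
    moreover have "k * (V n / \<kappa>) \<le> k * (LINT x|lborel. barrier_grad \<kappa> x \<bullet> grad (v n) x)"
      unfolding V_def using k
      by (intro mult_left_mono barrier_dirichlet[OF \<kappa>(1) \<Omega>\<kappa> N v_C1c v_nonneg]) auto
    moreover have "k * (V n / \<kappa>) = 2 * \<epsilon> * V n"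
      using \<kappa> by (simp add: k_def)
    ultimately show ?thesis by linarith
  qed
  have nonlocal: "E (U n) (v n) \<ge> 0" for n
  proof -
    have int: "integrable lborel2 (case_prod (\<lambda>x z. fdq s (U n) (x, z) * fdq s (v n) (x, z)))"
      using L2_integrable_mult[OF fdq_L2[OF C1c_UNIV[OF U]] fdq_L2[OF C1c_UNIV[OF v_C1c]]]
      by (simp add: case_prod_unfold)
    \<comment> \<open>Integrating over \<open>x\<close> first allows splitting \<open>U n\<close>
      into \<open>p n\<close> and the barrier for each fixed \<open>z\<close>; there the compact
      support of \<open>v n\<close> gives integrability, though the barrier has no compact
      support.\<close>
    have "E (U n) (v n) = (LINT z|lborel. LINT x|lborel. fdq s (U n) (x, z) * fdq s (v n) (x, z))"
      using lborel_pair.integral_snd[OF int] by (simp add: E_def case_prod_unfold)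
    also have "\<dots> \<ge> 0"
    proof (rule Bochner_Integration.integral_nonneg)
      fix z
      have shift: "continuous_on UNIV (\<lambda>x. q (x + z) - q x)" if "continuous_on UNIV q" for q :: "real ^ 'n \<Rightarrow> real"
        by (intro continuous_intros that continuous_on_compose2[OF that]) auto
      note int = C1c_difference_integrable[OF v_C1c[of n] shift[OF p_cont]]
        C1c_difference_integrable[OF v_C1c[of n] shift[OF W_cont]]
      \<comment> \<open>As \<beta> is monotone, the increments of \<open>p n\<close> and
        \<open>v n\<close> never have opposite signs.\<close>
      have "0 \<le> (LINT x|lborel. (p n (x + z) - p n x) * (v n (x + z) - v n x))"
      proof (rule Bochner_Integration.integral_nonneg)
        fix x
        show "(p n (x + z) - p n x) * (v n (x + z) - v n x) \<ge> 0"
          using \<beta>(8)[of "p n x" "p n (x + z)"] \<beta>(8)[of "p n (x + z)" "p n x"]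
          by (cases "p n x \<le> p n (x + z)") (auto simp: v_def zero_le_mult_iff)
      qed
      moreover have "0 \<le> k * (LINT x|lborel. (W (x + z) - W x) * (v n (x + z) - v n x))"
        unfolding W_def using k by (intro mult_nonneg_nonneg barrier_nonlocal[OF \<kappa>(1) \<Omega>\<kappa> v_C1c v_nonneg]) auto
      ultimately have "0 \<le> (LINT x|lborel. (p n (x + z) - p n x) * (v n (x + z) - v n x))
          + k * (LINT x|lborel. (W (x + z) - W x) * (v n (x + z) - v n x))"
        by simp
      also have "\<dots> = (LINT x|lborel. (p n (x + z) - p n x) * (v n (x + z) - v n x)
          + k * ((W (x + z) - W x) * (v n (x + z) - v n x)))"
        using int by simp
      also have "\<dots> = (LINT x|lborel. (U n (x + z) - U n x) * (v n (x + z) - v n x))"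
        by (intro Bochner_Integration.integral_cong) (auto simp: p_def algebra_simps)
      finally show "0 \<le> (LINT x|lborel. fdq s (U n) (x, z) * fdq s (v n) (x, z))"
        by (simp add: fdq_mult)
    qed
    finally show ?thesis .
  qed
  obtain B where B: "\<And>n. \<delta> n \<le> B"
    using convergent_imp_Bseq[OF convergentI[OF \<delta>_lim]] unfolding Bseq_def by (auto dest: abs_le_D1)
  \<comment> \<open>A bound on \<open>a (v n) (v n)\<close> independent of \<open>n\<close>: the
    barrier gradient has norm at most \<open>2 * R / \<kappa>\<close> on \<Omega>, and coercivity
    bounds the energies of the \<open>U n\<close>.\<close>
  define A where "A = (1 + C * (K * (P + 1))) *
    (2 * (4 * B + 16 * P * vol * \<epsilon>\<^sup>2) + 2 * (k * (2 * R / \<kappa>))\<^sup>2 * vol)"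
  have a_v: "a (v n) (v n) \<le> A" for n
  proof -
    have ind: "integrable lborel (indicator (cball (0::real ^ 'n) R) :: real ^ 'n \<Rightarrow> real)"
      using emeasure_bounded_finite[OF bounded_cball, of "0 :: real ^ 'n" R]
      by (intro integrable_real_indicator) auto
    note sq = L2_integrable_norm_sq[OF C1c_L2(2)[OF U[of n]]]
    have "D (v n) (v n) \<le> (LINT x|lborel. 2 * (norm (grad (U n) x))\<^sup>2 + 2 * (k * (2 * R / \<kappa>))\<^sup>2 * indicator (cball 0 R) x)"
      unfolding D_eq
    proof (rule integral_mono)
      show "integrable lborel (\<lambda>x. (norm (grad (v n) x))\<^sup>2)"
        by (rule L2_integrable_norm_sq[OF C1c_L2(2)[OF v_C1c]])
      show "integrable lborel (\<lambda>x. 2 * (norm (grad (U n) x))\<^sup>2 + 2 * (k * (2 * R / \<kappa>))\<^sup>2 * indicator (cball 0 R) x)"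
        by (intro Bochner_Integration.integrable_add integrable_mult_right sq ind)
      fix x
      show "(norm (grad (v n) x))\<^sup>2 \<le> 2 * (norm (grad (U n) x))\<^sup>2 + 2 * (k * (2 * R / \<kappa>))\<^sup>2 * indicator (cball 0 R) x"
      proof (cases "x \<in> \<Omega>")
        case False
        then show ?thesis
          using C1c_grad_eq_0'[OF v_C1c] by simp
      next
        case True
        have bg: "norm (barrier_grad \<kappa> x) \<le> 2 * R / \<kappa>"
        proof -
          have "norm (barrier_grad \<kappa> x) = 2 * \<kappa> / (\<kappa> + x \<bullet> x)\<^sup>2 * norm x"
            using \<kappa> by (simp add: barrier_grad_def)
          also have "\<dots> \<le> 2 * \<kappa> / \<kappa>\<^sup>2 * R"
            using \<kappa> norm_\<Omega>[OF True] barrier_denominator[OF \<kappa>(1), of x]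
            by (intro mult_mono divide_left_mono power_mono) auto
          finally show ?thesis
            using \<kappa> by (simp add: power2_eq_square)
        qed
        have "norm (grad (v n) x) \<le> norm (p' n x)"
          using \<beta>(3,4) by (simp add: v_grad mult_left_le_one_le)
        also have "\<dots> \<le> norm (grad (U n) x) + k * norm (barrier_grad \<kappa> x)"
          using norm_triangle_ineq4[of "grad (U n) x" "k *\<^sub>R barrier_grad \<kappa> x"] k by (simp add: p'_def)
        also have "\<dots> \<le> norm (grad (U n) x) + k * (2 * R / \<kappa>)"
          using bg k by (intro add_left_mono mult_left_mono) auto
        finally have "(norm (grad (v n) x))\<^sup>2 \<le> (norm (grad (U n) x) + k * (2 * R / \<kappa>))\<^sup>2"
          by (rule power_mono) simp
        also have "\<dots> \<le> 2 * (norm (grad (U n) x))\<^sup>2 + 2 * (k * (2 * R / \<kappa>))\<^sup>2"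
          using sum_squares_bound[of "norm (grad (U n) x)" "k * (2 * R / \<kappa>)"] by (simp add: power2_sum)
        finally show ?thesis
          using norm_\<Omega>[OF True] by simp
      qed
    qed
    also have "\<dots> = 2 * D (U n) (U n) + 2 * (k * (2 * R / \<kappa>))\<^sup>2 * vol"
      using sq ind by (subst Bochner_Integration.integral_add) (auto simp: D_eq vol_def)
    also have "D (U n) (U n) \<le> 4 * B + 16 * P * vol * \<epsilon>\<^sup>2"
      using J_lower[OF U[of n]] J_U[of n] I\<^sub>0_nonpos B[of n] by linarith
    finally have D: "D (v n) (v n) \<le> 2 * (4 * B + 16 * P * vol * \<epsilon>\<^sup>2) + 2 * (k * (2 * R / \<kappa>))\<^sup>2 * vol"
      by simp
    have "a (v n) (v n) \<le> D (v n) (v n) + C * (K * (P + 1) * D (v n) (v n))"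
      unfolding a_def using C by (intro add_left_mono mult_left_mono E_le[OF v_C1c])
    also have "\<dots> = (1 + C * (K * (P + 1))) * D (v n) (v n)"
      by (simp add: algebra_simps)
    also have "\<dots> \<le> A"
      unfolding A_def using D C K_pos P_pos by (intro mult_left_mono) auto
    finally show ?thesis .
  qed
  \<comment> \<open>Minimality along \<open>- \<tau> * v n\<close>: the quadratic form gains at
    least \<open>2 * \<epsilon> * \<tau> * V n\<close>, the potential costs at most half of that,
    and the difference remains.\<close>
  have main: "\<tau> * \<epsilon> * V n \<le> \<delta> n + \<tau>\<^sup>2 / 2 * A" if \<tau>: "0 < \<tau>" "\<tau> \<le> 1" for n \<tau>
  proof -
    have int: "integrable lborel (\<lambda>x. U n x + - \<tau> * v n x)"
      using C1c_integrable[OF U] C1c_integrable[OF v_C1c] by auto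
    have "potential (U n) - potential (\<lambda>x. U n x + - \<tau> * v n x) \<le> \<epsilon> * \<tau> * V n"
    proof -
      have "potential (U n) - potential (\<lambda>x. U n x + - \<tau> * v n x) =
          (LINT x|lebesgue. \<Phi> x (U n x) - \<Phi> x (U n x + - \<tau> * v n x))"
        unfolding potential_def using \<Phi>_integrable[OF C1c_integrable[OF U]] \<Phi>_integrable[OF int] by simp
      also have "\<dots> \<le> (LINT x|lebesgue. \<epsilon> * \<tau> * v n x)"
      proof (rule integral_mono)
        show "integrable lebesgue (\<lambda>x. \<Phi> x (U n x) - \<Phi> x (U n x + - \<tau> * v n x))"
          using \<Phi>_integrable[OF C1c_integrable[OF U]] \<Phi>_integrable[OF int] by simp
        show "integrable lebesgue (\<lambda>x. \<epsilon> * \<tau> * v n x)"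
          using C1c_integrable[OF v_C1c] by (simp add: integrable_completion borel_measurable_integrable)
        fix x
        show "\<Phi> x (U n x) - \<Phi> x (U n x + - \<tau> * v n x) \<le> \<epsilon> * \<tau> * v n x"
        proof (cases "p n x \<le> 0")
          case True
          then show ?thesis
            using \<beta>(5) by (simp add: v_def)
        next
          case False
          \<comment> \<open>Since \<open>v n x \<le> p n x\<close> and
            \<open>\<tau> \<le> 1\<close>, the lowered value stays above \<open>k * W x\<close>,
            hence in the range where the one-sided bound on \<open>F\<close> holds.\<close>
          have "\<tau> * v n x \<le> 1 * v n x"
            using \<tau> v_nonneg by (intro mult_right_mono) auto
          also have "v n x \<le> p n x"
            using \<beta>_le[of "p n x"] False by (simp add: v_def)
          finally have "\<tau> * v n x \<le> U n x"
            using mult_pos_pos[OF k W(1)[of x]] by (simp add: p_def)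
          then show ?thesis
            using \<Phi>_upper_increment[of "U n x + - \<tau> * v n x" "U n x" x] \<tau> v_nonneg[of n x]
            by (simp add: mult.assoc)
        qed
      qed
      also have "\<dots> = \<epsilon> * \<tau> * V n"
        using C1c_integrable[OF v_C1c] by (simp add: V_def integral_completion borel_measurable_integrable)
      finally show ?thesis .
    qed
    moreover have "potential (\<lambda>x. U n x + - \<tau> * v n x) - potential (U n)
        \<le> - \<tau> * a (U n) (v n) + (- \<tau>)\<^sup>2 / 2 * a (v n) (v n) + \<delta> n"
      by (rule J_perturbation[OF v_C1c])
    moreover have "\<tau> * (2 * \<epsilon> * V n) \<le> \<tau> * a (U n) (v n)"
      using local[of n] mult_nonneg_nonneg[OF C nonlocal[of n]] \<tau> unfolding a_def by (intro mult_left_mono) auto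
    moreover have "\<tau>\<^sup>2 / 2 * a (v n) (v n) \<le> \<tau>\<^sup>2 / 2 * A"
      by (intro mult_left_mono a_v) auto
    ultimately show ?thesis
      by (simp add: algebra_simps)
  qed
  \<comment> \<open>The L^1 limit of the \<open>v n\<close>, because \<beta> is 1-Lipschitz; its
    vanishing means that \<open>u\<close> stays below the barrier.\<close>
  define w where "w x = \<beta> (u x - k * W x)" for x
  have w_int: "integrable lborel w"
  proof (rule Bochner_Integration.integrable_bound[OF u_integrable])
    have "W \<in> borel_measurable borel" "\<beta> \<in> borel_measurable borel"
      by (intro borel_measurable_continuous_onI W_cont \<beta>_cont)+
    then show "w \<in> borel_measurable lborel"
      using u_borel unfolding w_def by measurable
    show "AE x in lborel. norm (w x) \<le> norm (u x)"
    proof (rule AE_I2)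
      fix x
      show "norm (w x) \<le> norm (u x)"
        using \<beta>_le[of "u x - k * W x"] \<beta>(7)[of "u x - k * W x"] mult_pos_pos[OF k W(1)[of x]]
        by (auto simp: w_def max_def split: if_splits)
    qed
  qed
  have V_lim: "V \<longlonglongrightarrow> (LINT x|lborel. w x)"
  proof -
    have "(\<lambda>n. V n - (LINT x|lborel. w x)) \<longlonglongrightarrow> 0"
    proof (rule Lim_null_comparison[OF always_eventually U_L1_lim], rule allI)
      fix n
      have "V n - (LINT x|lborel. w x) = (LINT x|lborel. v n x - w x)"
        unfolding V_def using C1c_integrable[OF v_C1c] w_int by simp
      also have "norm \<dots> \<le> (LINT x|lborel. \<bar>v n x - w x\<bar>)"
        using integral_norm_bound[of lborel "\<lambda>x. v n x - w x"] by simp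
      also have "\<dots> \<le> (LINT x|lborel. \<bar>U n x - u x\<bar>)"
      proof (rule integral_mono)
        show "integrable lborel (\<lambda>x. \<bar>v n x - w x\<bar>)" "integrable lborel (\<lambda>x. \<bar>U n x - u x\<bar>)"
          using C1c_integrable[OF v_C1c] w_int C1c_integrable[OF U] u_integrable by auto
        show "\<bar>v n x - w x\<bar> \<le> \<bar>U n x - u x\<bar>" for x
          using \<beta>(9)[of "p n x" "u x - k * W x"] by (simp add: v_def w_def p_def)
      qed
      finally show "norm (V n - (LINT x|lborel. w x)) \<le> (LINT x|lborel. \<bar>U n x - u x\<bar>)" .
    qed
    then show ?thesis
      by (rule LIM_zero_cancel)
  qed
  \<comment> \<open>First \<open>n\<close> tends to infinity, which removes the defect; dividing by
    \<tau> then leaves a bound that vanishes with \<tau>.\<close>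
  have w_small: "\<epsilon> * (LINT x|lborel. w x) \<le> \<tau> / 2 * A" if \<tau>: "0 < \<tau>" "\<tau> \<le> 1" for \<tau>
  proof -
    have "\<tau> * \<epsilon> * (LINT x|lborel. w x) \<le> 0 + \<tau>\<^sup>2 / 2 * A"
    proof (rule LIMSEQ_le)
      show "(\<lambda>n. \<tau> * \<epsilon> * V n) \<longlonglongrightarrow> \<tau> * \<epsilon> * (LINT x|lborel. w x)"
        by (intro tendsto_intros V_lim)
      show "(\<lambda>n. \<delta> n + \<tau>\<^sup>2 / 2 * A) \<longlonglongrightarrow> 0 + \<tau>\<^sup>2 / 2 * A"
        by (intro tendsto_intros \<delta>_lim)
    qed (use main[OF \<tau>] in auto)
    then have "\<tau> * (\<epsilon> * (LINT x|lborel. w x)) \<le> \<tau> * (\<tau> / 2 * A)"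
      by (simp add: power2_eq_square mult_ac)
    then show ?thesis
      using \<tau> by (simp only: mult_le_cancel_left_pos)
  qed
  have "\<epsilon> * (LINT x|lborel. w x) \<le> 0"
  proof (rule LIMSEQ_le_const)
    have "(\<lambda>n. inverse (real (Suc n)) / 2 * A) \<longlonglongrightarrow> 0 / 2 * A"
      by (intro tendsto_intros LIMSEQ_inverse_real_of_nat) simp
    then show "(\<lambda>n. inverse (real (Suc n)) / 2 * A) \<longlonglongrightarrow> 0"
      by simp
    have "inverse (real (Suc n)) \<le> 1" for n
      by (simp add: field_simps)
    then show "\<exists>N. \<forall>n\<ge>N. \<epsilon> * (LINT x|lborel. w x) \<le> inverse (real (Suc n)) / 2 * A"
      using w_small by (metis inverse_positive_iff_positive of_nat_0_less_iff zero_less_Suc)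
  qed
  moreover have w_nonneg: "w x \<ge> 0" for x
    using \<beta>(7) by (simp add: w_def)
  then have "(LINT x|lborel. w x) \<ge> 0"
    by (rule Bochner_Integration.integral_nonneg)
  ultimately have "(LINT x|lborel. w x) = 0"
    using \<epsilon>_pos by (simp add: mult_le_0_iff)
  then have "AE x in lborel. w x = 0"
    using integral_nonneg_eq_0_iff_AE[OF w_int] w_nonneg by simp
  then show ?thesis
  proof eventually_elim
    case (elim x)
    then have "u x \<le> k * W x"
      using \<beta>(6)[of "u x - k * W x"] by (force simp: w_def)
    also have "\<dots> \<le> k * 1"
      using k W by (intro mult_left_mono) auto
    finally show ?case
      by (simp add: k_def)
  qed
qed

lemma u_bounded:
  assumes "CARD('n) \<ge> 2" "\<kappa> > 0" "3 * R\<^sup>2 \<le> \<kappa>"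
  shows "AE x in lborel. \<bar>u x\<bar> \<le> 2 * \<epsilon> * \<kappa>"
  using u_le[OF assms] minimizer.u_le[OF reflected_minimizer assms]
  by eventually_elim auto

end

subsection \<open>Truncated nonlinearities\<close>

lemma frac_const_nonneg: "frac_const s TYPE('n::finite) \<ge> 0"
  unfolding frac_const_def
  by (intro inverse_nonnegative_iff_nonnegative[THEN iffD2] Bochner_Integration.integral_nonneg) auto

text \<open>At 0 the sign condition itself is void, but the limits from the right and from the left
  have opposite signs. Both one-sided bounds on the truncated nonlinearity need this value.\<close>

lemma sign_condition_at_0:
  fixes g :: "real \<Rightarrow> real"
  assumes cont: "continuous_on UNIV g" and sign: "\<And>t. g t * t \<le> 0"
  shows "g 0 = 0"
proof -
  have lim: "(g \<longlongrightarrow> g 0) (at_right 0)" "(g \<longlongrightarrow> g 0) (at_left 0)"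
    using cont by (auto simp: continuous_on_def intro: tendsto_within_subset)
  have pos: "g t \<le> 0" if "t > 0" for t
    using sign[of t] that by (simp add: mult_le_0_iff)
  have neg: "0 \<le> g t" if "t < 0" for t
    using sign[of t] that by (auto simp: mult_le_0_iff)
  have "g 0 \<le> 0"
    using lim(1)
  proof (rule tendsto_upperbound)
    show "\<forall>\<^sub>F t in at_right 0. g t \<le> 0"
      using eventually_at_right_less[of 0]
      by eventually_elim (rule pos)
  qed simp
  moreover have "g 0 \<ge> 0"
    using lim(2)
  proof (rule tendsto_lowerbound)
    show "\<forall>\<^sub>F t in at_left 0. 0 \<le> g t"
      unfolding eventually_at_left_field using neg by (auto intro!: exI[of _ "-1"])
  qed simp
  ultimately show ?thesis by simp
qed

lemma truncated_bound:
  fixes f :: "real \<Rightarrow> real"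
  assumes "\<forall>t. \<bar>f t\<bar> \<le> c * (1 + \<bar>t\<bar> powr e)" "c > 0" "e > 0" "\<bar>t\<bar> \<le> 1"
  shows "\<bar>f t\<bar> \<le> 2 * c"
proof -
  have "\<bar>t\<bar> powr e \<le> 1"
    using assms by (intro powr_le1) auto
  then have "c * (1 + \<bar>t\<bar> powr e) \<le> c * 2"
    using assms by (intro mult_left_mono) auto
  then show ?thesis
    using assms(1) by (smt (verit))
qed

text \<open>\<open>F'\<close> is the original nonlinearity. It has to agree with \<open>F\<close>
  only along \<open>u\<close>, which is what the supremum bound provides.\<close>

lemma weak_solution_bounded_nonlinearity:
  fixes \<Omega> :: "(real ^ 'n::finite) set"
  assumes m: "minimizer F M \<epsilon> s (frac_const s TYPE('n)) \<Omega> R P K I\<^sub>0 U \<delta> u G"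
    and \<Omega>: "open \<Omega>"
    and F': "AE x in lebesgue. x \<in> \<Omega> \<longrightarrow> F' x (u x) = F x (u x)"
  shows "weak_solution s \<Omega> F' u"
proof -
  interpret minimizer F M \<epsilon> s "frac_const s TYPE('n)" \<Omega> R P K I\<^sub>0 U \<delta> u G
    by (rule m)
  have sq: "square_integrable f" if f: "f \<in> L2 lborel" for f :: "real ^ 'n \<Rightarrow> 'z::euclidean_space"
  proof -
    have "f \<in> borel_measurable lborel"
      by (rule L2_measurable[OF f])
    then show ?thesis
      using L2_integrable_norm_sq[OF f] unfolding square_integrable_def
      by (auto simp: integrable_completion intro: measurable_completion)
  qed
  have weak: "square_integrable G" "weak_gradient u G"
    by (rule sq[OF G_L2], rule weak_gradient_u)
  have H1: "u \<in> H1"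
    using sq[OF u_L2] weak by (auto simp: H1_def)
  have supp: "AE x in lebesgue. x \<notin> \<Omega> \<longrightarrow> u x = 0"
    using u_supp by (simp add: AE_completion_iff)
  have "integrable lebesgue (\<lambda>(x, y). (u x - u y) * (v x - v y) / norm (x - y) powr (real CARD('n) + 2 * s)) \<and>
      set_integrable lebesgue \<Omega> (\<lambda>x. F' x (u x) * v x) \<and>
      (LINT x:\<Omega>|lebesgue. G x \<bullet> grad v x) +
        frac_const s TYPE('n) *
          (LINT (x, y)|lebesgue. (u x - u y) * (v x - v y) / norm (x - y) powr (real CARD('n) + 2 * s)) =
      (LINT x:\<Omega>|lebesgue. F' x (u x) * v x)"
    if "v \<in> Cc_infinity \<Omega>" for v
  proof -
    have v: "v \<in> C1c \<Omega>"
      using that Cc_infinity_subset_C1c by blast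
    note nl = nonlocal_form_eq_fdq[OF u_borel C1c_borel[OF v] fdq_u_L2 fdq_L2[OF C1c_UNIV[OF v]]]
    have int: "integrable lebesgue (\<lambda>x. F x (u x) * v x)"
      by (rule F_u_integrable[OF v])
    have AE: "AE x in lebesgue. F x (u x) * v x = indicator \<Omega> x *\<^sub>R (F' x (u x) * v x)"
      using F'
    proof eventually_elim
      case (elim x)
      then show ?case
        using C1c_eq_0[OF v, of x] by (cases "x \<in> \<Omega>") auto
    qed
    \<comment> \<open>Measurability of \<open>F' x (u x)\<close> on \<Omega> is inherited from the
      truncated composition: the two agree almost everywhere and the measure is complete.\<close>
    have meas: "(\<lambda>x. indicator \<Omega> x *\<^sub>R (F' x (u x) * v x)) \<in> borel_measurable lebesgue"
      by (rule borel_measurable_AE[OF borel_measurable_integrable[OF int] AE])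
    have "set_integrable lebesgue \<Omega> (\<lambda>x. F' x (u x) * v x)"
      unfolding set_integrable_def
      by (rule integrable_cong_AE_imp[OF int meas AE])
    moreover have "(LINT x:\<Omega>|lebesgue. F' x (u x) * v x) = (LINT x|lebesgue. F x (u x) * v x)"
      unfolding set_lebesgue_integral_def
      by (rule integral_cong_AE[symmetric, OF borel_measurable_integrable[OF int] meas AE])
    moreover have "(LINT x:\<Omega>|lebesgue. G x \<bullet> grad v x) = (LINT x|lborel. G x \<bullet> grad v x)"
    proof -
      have "(LINT x:\<Omega>|lebesgue. G x \<bullet> grad v x) = (LINT x|lebesgue. G x \<bullet> grad v x)"
        unfolding set_lebesgue_integral_def
        using C1c_grad_eq_0'[OF v] by (intro Bochner_Integration.integral_cong) (auto simp: indicator_def)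
      also have "\<dots> = (LINT x|lborel. G x \<bullet> grad v x)"
        using L2_integrable_inner[OF G_L2 C1c_L2(2)[OF v]]
        by (intro integral_completion) auto
      finally show ?thesis .
    qed
    ultimately show ?thesis
      using nl euler_lagrange[OF v] by (simp add: a\<^sub>u_def)
  qed
  then show ?thesis
    unfolding weak_solution_def using H1 supp weak by blast
qed

lemma gagliardo_seminorm_less_1:
  fixes u :: "real ^ 'n::finite \<Rightarrow> real"
  assumes u: "u \<in> borel_measurable borel" and L2: "fdq s u \<in> L2 lborel2"
    and less: "(LINT p|lborel2. (fdq s u p)\<^sup>2) < 1"
  shows "gagliardo_seminorm s u < 1"
proof -
  let ?I = "LINT p|lborel2. (fdq s u p)\<^sup>2"
  have "(\<integral>\<^sup>+p. ennreal ((fdq s u p)\<^sup>2) \<partial>lborel2) = ennreal ?I"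
    using L2_integrable_norm_sq[OF L2] by (simp add: nn_integral_eq_integral)
  then have "gagliardo_seminorm s u = ennreal (sqrt ?I)"
    by (simp add: gagliardo_seminorm_def gagliardo_integral_eq_fdq[OF u])
  also have "\<dots> < ennreal 1"
    using less by (intro ennreal_lessI) auto
  finally show ?thesis
    by simp
qed

text \<open>Here \<open>f\<close> is the perturbation already multiplied by \<lambda>, hence small
  on [-1, 1]; \<open>g\<close> is merely bounded there and has the right sign.\<close>

lemma truncated_weak_solution:
  fixes \<Omega> :: "(real ^ 'n::finite) set" and f g :: "real ^ 'n \<Rightarrow> real \<Rightarrow> real"
  assumes N: "CARD('n) \<ge> 2" and open_\<Omega>: "open \<Omega>" and \<Omega>_cball: "\<Omega> \<subseteq> cball 0 R"
    and PK: "P > 0" "K > 0"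
    and Poincare: "\<And>v. v \<in> C1c \<Omega> \<Longrightarrow> (LINT x|lborel. (v x)\<^sup>2) \<le> P * dirichlet v"
    and fdq_L2: "\<And>v :: real ^ 'n \<Rightarrow> real. v \<in> C1c UNIV \<Longrightarrow> fdq s v \<in> L2 lborel2"
    and fdq_le: "\<And>v :: real ^ 'n \<Rightarrow> real. v \<in> C1c UNIV \<Longrightarrow> (LINT p|lborel2. (fdq s v p)\<^sup>2)
      \<le> K * ((LINT x|lborel. (v x)\<^sup>2) + dirichlet v)"
    and \<epsilon>: "\<epsilon> > 0" "2 * \<epsilon> * (3 * R\<^sup>2 + 1) \<le> 1"
      "K * (P + 1) * (16 * P * measure lborel (cball (0 :: real ^ 'n) R) * \<epsilon>\<^sup>2) < 1"
    and g: "caratheodory \<Omega> g" "AE x in lebesgue. x \<in> \<Omega> \<longrightarrow> (\<forall>t. \<bar>t\<bar> \<le> 1 \<longrightarrow> \<bar>g x t\<bar> \<le> B) \<and> (\<forall>t. g x t * t \<le> 0)"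
    and f: "caratheodory \<Omega> f" "AE x in lebesgue. x \<in> \<Omega> \<longrightarrow> (\<forall>t. \<bar>t\<bar> \<le> 1 \<longrightarrow> \<bar>f x t\<bar> \<le> \<epsilon>)"
  shows "\<exists>u. weak_solution s \<Omega> (\<lambda>x t. f x t + g x t) u \<and> gagliardo_seminorm s u < 1"
proof -
  \<comment> \<open>All almost-everywhere conditions are gathered into one null set
    \<open>Z\<close>, so that a function set to 0 on \<open>Z\<close> satisfies the locale
    assumptions at every point.\<close>
  define good where "good x \<longleftrightarrow> (x \<in> \<Omega> \<longrightarrow> continuous_on UNIV (f x) \<and> continuous_on UNIV (g x) \<and>
      (\<forall>t. \<bar>t\<bar> \<le> 1 \<longrightarrow> \<bar>g x t\<bar> \<le> B) \<and> (\<forall>t. g x t * t \<le> 0) \<and> (\<forall>t. \<bar>t\<bar> \<le> 1 \<longrightarrow> \<bar>f x t\<bar> \<le> \<epsilon>))" for x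
  have "AE x in lebesgue. good x"
    using f(1)[unfolded caratheodory_def, THEN conjunct2] g(1)[unfolded caratheodory_def, THEN conjunct2] f(2) g(2)
    unfolding good_def by eventually_elim simp
  then obtain Z where Z_null: "Z \<in> null_sets lebesgue" and "{x. \<not> good x} \<subseteq> Z"
    by (auto simp: eventually_ae_filter)
  then have good: "good x" if "x \<in> \<Omega> - Z" for x
    using that by auto
  have Z: "continuous_on UNIV (f x)" "continuous_on UNIV (g x)"
    "\<bar>t\<bar> \<le> 1 \<Longrightarrow> \<bar>g x t\<bar> \<le> B" "g x t * t \<le> 0" "\<bar>t\<bar> \<le> 1 \<Longrightarrow> \<bar>f x t\<bar> \<le> \<epsilon>" if "x \<in> \<Omega> - Z" for x t
    using good[OF that] that by (auto simp: good_def)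
  define cl :: "real \<Rightarrow> real" where "cl t = max (- 1) (min t 1)" for t
  have cl: "\<bar>cl t\<bar> \<le> 1" for t
    by (auto simp: cl_def)
  define F where "F x t = (if x \<in> \<Omega> - Z then f x (cl t) + g x (cl t) else 0)" for x t
  have \<Omega>_sets: "\<Omega> \<in> sets lebesgue" "\<Omega> - Z \<in> sets lebesgue"
    using open_\<Omega> Z_null by auto
  \<comment> \<open>The absolute value of \<open>B\<close> is taken because nothing forces
    \<open>B\<close> to be nonnegative when \<Omega> minus \<open>Z\<close> is empty.\<close>
  interpret bounded_nonlinearity F "\<epsilon> + \<bar>B\<bar>" \<epsilon>
  proof
    show "(\<lambda>x. F x t) \<in> borel_measurable lebesgue" for t
    proof -
      have "(\<lambda>x. f x (cl t) + g x (cl t)) \<in> borel_measurable (lebesgue_on \<Omega>)"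
        using f(1) g(1) by (intro borel_measurable_add) (simp_all add: caratheodory_def)
      then have "(\<lambda>x. f x (cl t) + g x (cl t)) \<in> borel_measurable (lebesgue_on (\<Omega> - Z))"
        by (rule measurable_restrict_mono) auto
      then have "(\<lambda>x. if x \<in> \<Omega> - Z then f x (cl t) + g x (cl t) else 0) \<in> borel_measurable lebesgue"
        using \<Omega>_sets by (subst borel_measurable_if) auto
      then show ?thesis
        by (simp only: F_def)
    qed
    show "continuous_on UNIV (F x)" for x
    proof (cases "x \<in> \<Omega> - Z")
      case True
      have "continuous_on UNIV cl"
        unfolding cl_def by (intro continuous_intros)
      then have "continuous_on UNIV (\<lambda>t. f x (cl t) + g x (cl t))"
        by (intro continuous_intros continuous_on_compose2[OF Z(1)[OF True]] continuous_on_compose2[OF Z(2)[OF True]]) auto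
      moreover have "F x = (\<lambda>t. f x (cl t) + g x (cl t))"
        using True by (auto simp: F_def)
      ultimately show ?thesis
        by simp
    next
      case False
      then have "F x = (\<lambda>t. 0)"
        by (auto simp: F_def)
      then show ?thesis
        by simp
    qed
    have sign: "g x (cl t) \<le> 0" if "x \<in> \<Omega> - Z" "t \<ge> 0" for x t
    proof (cases "t = 0")
      case True
      then show ?thesis
        using sign_condition_at_0[OF Z(2,4)] that by (simp add: cl_def)
    next
      case False
      then have "cl t > 0"
        using that by (simp add: cl_def)
      then show ?thesis
        using Z(4)[OF that(1), of "cl t"] by (simp add: mult_le_0_iff)
    qed
    have sign': "0 \<le> g x (cl t)" if "x \<in> \<Omega> - Z" "t \<le> 0" for x t
    proof (cases "t = 0")
      case True
      then show ?thesis
        using sign_condition_at_0[OF Z(2,4)] that by (simp add: cl_def)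
    next
      case False
      then have "cl t < 0"
        using that by (simp add: cl_def)
      then show ?thesis
        using Z(4)[OF that(1), of "cl t"] by (auto simp: mult_le_0_iff)
    qed
    show "\<bar>F x t\<bar> \<le> \<epsilon> + \<bar>B\<bar>" for x t
      using Z(3)[of x "cl t"] Z(5)[of x "cl t"] cl[of t] \<epsilon>(1)
      by (cases "x \<in> \<Omega> - Z") (auto simp: F_def)
    show "F x t \<le> \<epsilon>" if "t \<ge> 0" for x t
      using sign[OF _ that, of x] Z(5)[of x "cl t"] cl[of t] \<epsilon>(1)
      by (cases "x \<in> \<Omega> - Z") (auto simp: F_def)
    show "- \<epsilon> \<le> F x t" if "t \<le> 0" for x t
      using sign'[OF _ that, of x] Z(5)[of x "cl t"] cl[of t] \<epsilon>(1)
      by (cases "x \<in> \<Omega> - Z") (auto simp: F_def)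
  qed (rule \<epsilon>(1))
  interpret energy F "\<epsilon> + \<bar>B\<bar>" \<epsilon> s "frac_const s TYPE('n)" \<Omega> R P K
    by unfold_locales (use \<Omega>_cball PK Poincare fdq_L2 fdq_le frac_const_nonneg in auto)
  obtain U \<delta> u G where lim: "\<And>n. U n \<in> C1c \<Omega>" "\<And>n. J (U n) \<le> I + \<delta> n" "\<And>n. \<delta> n \<ge> 0" "\<delta> \<longlonglongrightarrow> 0"
    "u \<in> borel_measurable borel" "u \<in> L2 lborel" "G \<in> L2 lborel" "fdq s u \<in> L2 lborel2"
    "AE x in lborel. x \<notin> \<Omega> \<longrightarrow> u x = 0"
    "(\<lambda>n. LINT x|lborel. (norm (U n x - u x))\<^sup>2) \<longlonglongrightarrow> 0"
    "(\<lambda>n. LINT x|lborel. (norm (grad (U n) x - G x))\<^sup>2) \<longlonglongrightarrow> 0"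
    "(\<lambda>n. LINT p|lborel2. (norm (fdq s (U n) p - fdq s u p))\<^sup>2) \<longlonglongrightarrow> 0"
    by (rule minimizing_limit) blast
  have m: "minimizer F (\<epsilon> + \<bar>B\<bar>) \<epsilon> s (frac_const s TYPE('n)) \<Omega> R P K I U \<delta> u G"
    by unfold_locales (rule I_le I_nonpos lim; assumption?)+
  \<comment> \<open>The barrier parameter is \<open>3 * R\<^sup>2 + 1\<close>, positive even for
    \<open>R = 0\<close>; the second condition on \<epsilon> then brings the bound below the
    truncation level 1.\<close>
  have "AE x in lborel. \<bar>u x\<bar> \<le> 2 * \<epsilon> * (3 * R\<^sup>2 + 1)"
    by (rule minimizer.u_bounded[OF m N]) (auto intro: add_nonneg_pos)
  then have u_1: "AE x in lebesgue. \<bar>u x\<bar> \<le> 1"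
    unfolding AE_completion_iff by eventually_elim (use \<epsilon>(2) in linarith)
  have "AE x in lebesgue. x \<in> \<Omega> \<longrightarrow> f x (u x) + g x (u x) = F x (u x)"
    using u_1 AE_not_in[OF Z_null]
  proof eventually_elim
    case (elim x)
    then have "cl (u x) = u x"
      by (auto simp: cl_def)
    then show ?case
      using elim by (simp add: F_def)
  qed
  then have "weak_solution s \<Omega> (\<lambda>x t. f x t + g x t) u"
    by (intro weak_solution_bounded_nonlinearity[OF m open_\<Omega>])
  moreover have "gagliardo_seminorm s u < 1"
    using minimizer.fdq_u_small[OF m] \<epsilon>(3) lim(5,8)
    by (intro gagliardo_seminorm_less_1) (auto simp: vol_def)
  ultimately show ?thesis by blast
qed

theorem theorem3p2:
  fixes s C1 r :: real
    and \<Omega> :: "(real ^ 'n::finite) set"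
    and g :: "real ^ 'n \<Rightarrow> real \<Rightarrow> real"
  assumes "0 < s" "s < 1"
    and "CARD('n) \<ge> 2"
    and "domain_set \<Omega>" "bounded \<Omega>" "C1_boundary \<Omega>"
    and "caratheodory \<Omega> g"
    and "C1 > 0" "1 < r" "ereal r < crit_exponent CARD('n)"
    and "AE x\<in>\<Omega> in lebesgue.
           (\<forall>t. \<bar>g x t\<bar> \<le> C1 * (1 + \<bar>t\<bar> powr (r - 1))) \<and>
           antimono (g x) \<and>
           (\<forall>t. g x t * t \<le> 0)"
  shows "\<exists>h\<in>Cc_infinity \<Omega>. \<forall>f :: real ^ 'n \<Rightarrow> real \<Rightarrow> real.
           caratheodory \<Omega> f \<and>
           (\<exists>C2>0. \<exists>q>1. ereal q < crit_exponent CARD('n) \<and>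
              (AE x\<in>\<Omega> in lebesgue. \<forall>t. \<bar>f x t\<bar> \<le> C2 * (1 + \<bar>t\<bar> powr (q - 1)))) \<longrightarrow>
           (\<exists>lam_star>0. \<forall>lam\<in>{- lam_star..lam_star}. \<exists>u.
              weak_solution s \<Omega> (\<lambda>x t. lam * f x t + g x t + h x) u \<and>
              gagliardo_seminorm s u < 1)"
proof -
  obtain R where R: "\<Omega> \<subseteq> cball 0 R"
    using \<open>bounded \<Omega>\<close> by (auto simp: bounded_iff subset_eq)
  obtain P where P: "P > 0" "\<And>v. v \<in> C1c \<Omega> \<Longrightarrow>
      (LINT x|lborel. (v x)\<^sup>2) \<le> P * dirichlet v"
    using Poincare_inequality[OF \<open>bounded \<Omega>\<close>] by blast
  obtain K where K: "K > 0"
    "\<And>v :: real ^ 'n \<Rightarrow> real. v \<in> C1c UNIV \<Longrightarrow> fdq s v \<in> L2 lborel2"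
    "\<And>v :: real ^ 'n \<Rightarrow> real. v \<in> C1c UNIV \<Longrightarrow> (LINT p|lborel2. (fdq s v p)\<^sup>2)
      \<le> K * ((LINT x|lborel. (v x)\<^sup>2) + dirichlet v)"
    using fdq_bound[OF \<open>0 < s\<close> \<open>s < 1\<close>, where 'n = 'n] by blast
  define A where "A = K * (P + 1) * (16 * P * measure lborel (cball (0 :: real ^ 'n) R))"
  have "A \<ge> 0"
    using K(1) P(1) by (simp add: A_def)
  \<comment> \<open>The first entry keeps the solution within the truncation level. The second makes
    the squared seminorm, at most \<open>A * \<epsilon>\<^sup>2\<close>, smaller than 1, through
    \<open>\<epsilon>\<^sup>2 \<le> \<epsilon>\<close> and \<open>A / (A + 1) < 1\<close>.\<close>
  define \<epsilon> where "\<epsilon> = min (1 / (2 * (3 * R\<^sup>2 + 1))) (1 / (A + 1))"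
  have den: "3 * R\<^sup>2 + 1 > 0"
    by (simp add: add_nonneg_pos)
  have \<epsilon>: "\<epsilon> > 0" "2 * \<epsilon> * (3 * R\<^sup>2 + 1) \<le> 1" "A * \<epsilon>\<^sup>2 < 1"
  proof -
    show "\<epsilon> > 0"
      using den \<open>A \<ge> 0\<close> by (simp add: \<epsilon>_def)
    have "\<epsilon> * (2 * (3 * R\<^sup>2 + 1)) \<le> 1 / (2 * (3 * R\<^sup>2 + 1)) * (2 * (3 * R\<^sup>2 + 1))"
      using den by (intro mult_right_mono) (auto simp: \<epsilon>_def)
    then show "2 * \<epsilon> * (3 * R\<^sup>2 + 1) \<le> 1"
      using den by (simp add: mult_ac)
    have \<epsilon>A: "\<epsilon> \<le> 1 / (A + 1)"
      by (simp add: \<epsilon>_def)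
    also have "\<dots> \<le> 1"
      using \<open>A \<ge> 0\<close> by simp
    finally have "\<epsilon>\<^sup>2 \<le> \<epsilon>"
      using \<open>\<epsilon> > 0\<close> by (simp add: power2_eq_square)
    then have "A * \<epsilon>\<^sup>2 \<le> A * (1 / (A + 1))"
      using \<epsilon>A \<open>A \<ge> 0\<close> by (intro mult_left_mono) auto
    also have "\<dots> < 1"
      using \<open>A \<ge> 0\<close> by simp
    finally show "A * \<epsilon>\<^sup>2 < 1" .
  qed
  have Ck_0: "Ck k (\<lambda>_ :: real ^ 'n. 0)" for k
  proof (induction k)
    case (Suc k)
    then show ?case
      by (auto intro!: exI[of _ "\<lambda>_. 0"] GDERIV_const)
  qed simp
  show ?thesis
  proof (rule bexI[of _ "\<lambda>_. 0"], intro allI impI)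
    show "(\<lambda>_. 0) \<in> Cc_infinity \<Omega>"
      using Ck_0 by (simp add: Cc_infinity_def)
    fix f :: "real ^ 'n \<Rightarrow> real \<Rightarrow> real"
    assume "caratheodory \<Omega> f \<and> (\<exists>C2>0. \<exists>q>1. ereal q < crit_exponent CARD('n) \<and>
              (AE x\<in>\<Omega> in lebesgue. \<forall>t. \<bar>f x t\<bar> \<le> C2 * (1 + \<bar>t\<bar> powr (q - 1))))"
    then obtain C2 q where f: "caratheodory \<Omega> f" "C2 > 0" "q > 1"
      "AE x\<in>\<Omega> in lebesgue. \<forall>t. \<bar>f x t\<bar> \<le> C2 * (1 + \<bar>t\<bar> powr (q - 1))"
      by blast
    show "\<exists>lam_star>0. \<forall>lam\<in>{- lam_star..lam_star}. \<exists>u.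
              weak_solution s \<Omega> (\<lambda>x t. lam * f x t + g x t + 0) u \<and> gagliardo_seminorm s u < 1"
    \<comment> \<open>On [-1, 1] the growth condition gives the bound \<open>2 * C2\<close> for
      \<open>f\<close>, so this threshold makes the scaled term at most \<epsilon>.\<close>
    proof (rule exI[of _ "\<epsilon> / (2 * C2)"], intro conjI ballI)
      show "\<epsilon> / (2 * C2) > 0"
        using \<epsilon>(1) f(2) by simp
      fix lam
      assume lam: "lam \<in> {- (\<epsilon> / (2 * C2))..\<epsilon> / (2 * C2)}"
      have "\<exists>u. weak_solution s \<Omega> (\<lambda>x t. lam * f x t + g x t) u \<and> gagliardo_seminorm s u < 1"
      proof (rule truncated_weak_solution[OF \<open>CARD('n) \<ge> 2\<close> _ R P(1) K(1) P(2) K(2,3) \<epsilon>(1,2)])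
        show "open \<Omega>"
          using \<open>domain_set \<Omega>\<close> by (simp add: domain_set_def)
        show "K * (P + 1) * (16 * P * measure lborel (cball (0 :: real ^ 'n) R) * \<epsilon>\<^sup>2) < 1"
          using \<epsilon>(3) by (simp add: A_def mult_ac)
        show "caratheodory \<Omega> g"
          by fact
        show "AE x in lebesgue. x \<in> \<Omega> \<longrightarrow> (\<forall>t. \<bar>t\<bar> \<le> 1 \<longrightarrow> \<bar>g x t\<bar> \<le> 2 * C1) \<and> (\<forall>t. g x t * t \<le> 0)"
          using assms(11) by eventually_elim (use truncated_bound[of "g _" C1 "r - 1"] assms(8,9) in auto)
        show "caratheodory \<Omega> (\<lambda>x t. lam * f x t)"
          unfolding caratheodory_def
        proof (intro conjI allI)
          show "(\<lambda>x. lam * f x t) \<in> borel_measurable (lebesgue_on \<Omega>)" for t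
            using f(1) by (intro borel_measurable_times borel_measurable_const) (simp add: caratheodory_def)
          show "AE x\<in>\<Omega> in lebesgue. continuous_on UNIV (\<lambda>t. lam * f x t)"
            using f(1)[unfolded caratheodory_def, THEN conjunct2]
            by eventually_elim (auto intro!: continuous_intros)
        qed
        show "AE x in lebesgue. x \<in> \<Omega> \<longrightarrow> (\<forall>t. \<bar>t\<bar> \<le> 1 \<longrightarrow> \<bar>lam * f x t\<bar> \<le> \<epsilon>)"
          using f(4)
        proof eventually_elim
          case (elim x)
          show ?case
          proof (intro impI allI)
            fix t :: real
            assume "x \<in> \<Omega>" "\<bar>t\<bar> \<le> 1"
            then have "\<bar>f x t\<bar> \<le> 2 * C2"
              using elim f(2,3) by (intro truncated_bound[of _ _ "q - 1"]) auto
            then have "\<bar>lam * f x t\<bar> \<le> \<epsilon> / (2 * C2) * (2 * C2)"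
              unfolding abs_mult using lam f(2) \<epsilon>(1) by (intro mult_mono) auto
            then show "\<bar>lam * f x t\<bar> \<le> \<epsilon>"
              using f(2) by simp
          qed
        qed
      qed
      then show "\<exists>u. weak_solution s \<Omega> (\<lambda>x t. lam * f x t + g x t + 0) u \<and> gagliardo_seminorm s u < 1"
        by simp
    qed
  qed
qed

end
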